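(* There exists a function $u^*\in\mathscr{N}$ such that (i) $J(u^* )=\inf_{u\in\mathscr{N}}J(u)=d$; (ii) $u^*$ is a ground state solution of the boundary value problem $-M(\|\nabla u\|_p^p)\Delta_p u=|u|^{q-1}u\log|u|$ in $\Omega$, $u=0$ on $\partial\Omega$, namely $u^*\in\Phi\setminus\{0\}$ and $J(u^* )=\inf_{u\in\Phi\setminus\{0\}}J(u)$.
   Context: $\Omega\subset\mathbb{R}^n$ ($n\ge1$) is a bounded domain with smooth boundary; $a>0$, $b>0$, $M(s)=a+bs$; $2\le p<2^*$ and $2p-1<q<p^*-2$, where $p^*=\frac{np}{n-p}$ is the Sobolev conjugate of $p$ ($p^*=+\infty$ if $p\ge n$; likewise for $2^*$). $\|\cdot\|_r$ is the $L^r(\Omega)$ norm, $(u,v)=\int_\Omega uv\,dx$, $\Delta_p u=\mathrm{div}(|\nabla u|^{p-2}\nabla u)$. For $u\in W_0^{1,p}(\Omega)$ (with $0\log 0=0$): $J(u)=\frac{a}{p}\|\nabla u\|_p^p+\frac{b}{2p}\|\nabla u\|_p^{2p}-\frac{1}{q+1}\int_\Omega|u|^{q+1}\log|u|\,dx+\frac{1}{(q+1)^2}\|u\|_{q+1}^{q+1}$, $I(u)=a\|\nabla u\|_p^p+b\|\nabla u\|_p^{2p}-\int_\Omega|u|^{q+1}\log|u|\,dx$, $\mathscr{N}=\{u\in W_0^{1,p}(\Omega): I(u)=0,\ \|\nabla u\|_p\ne0\}$, $d=\inf\{J(u):u\in\mathscr{N}\}$. $\Phi$ is the set of solutions of the boundary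 value problem: $\Phi=\{u\in W_0^{1,p}(\Omega):\langle J'(u),\varphi\rangle=0\ \forall\varphi\in W_0^{1,p}(\Omega)\}$, where $\langle J'(u),\varphi\rangle=\frac{d}{d\tau}J(u+\tau\varphi)|_{\tau=0}=M(\|\nabla u\|_p^p)(|\nabla u|^{p-2}\nabla u,\nabla\varphi)-(|u|^{q-1}u\log|u|,\varphi)$. *)

theory Defs
  imports "HOL-Analysis.Analysis"
begin

section \<open>Smooth functions and domains with smooth boundary\<close>

text \<open>On an open set, \<open>C\<^sup>k\<close> is defined through iterated partial derivatives.\<close>

fun Ck_on :: "nat \<Rightarrow> 'a set \<Rightarrow> ('a::euclidean_space \<Rightarrow> real) \<Rightarrow> bool" where
  "Ck_on 0 S f \<longleftrightarrow> continuous_on S f"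
| "Ck_on (Suc k) S f \<longleftrightarrow> f differentiable_on S \<and>
     (\<forall>i\<in>Basis. Ck_on k S (\<lambda>x. frechet_derivative f (at x) i))"

definition smooth_on :: "'a set \<Rightarrow> ('a::euclidean_space \<Rightarrow> real) \<Rightarrow> bool" where
  "smooth_on S f \<longleftrightarrow> (\<forall>k. Ck_on k S f)"

text \<open>Near each boundary point, after a rotation of the coordinates, the set is the region
  strictly above the graph of a smooth function. Here \<open>e\<close> is the vertical direction and
  \<open>x - (x \<bullet> e) *\<^sub>R e\<close> is the orthogonal projection of \<open>x\<close> to the horizontal hyperplane; only the
  values of \<open>g\<close> on this hyperplane matter.\<close>

definition smooth_boundary :: "'a::euclidean_space set \<Rightarrow> bool" where
  "smooth_boundary \<Omega> \<longleftrightarrow>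
     (\<forall>x0\<in>frontier \<Omega>. \<exists>r>0. \<exists>e g. norm e = 1 \<and> smooth_on UNIV g \<and>
        \<Omega> \<inter> ball x0 r = {x \<in> ball x0 r. x \<bullet> e > g (x - (x \<bullet> e) *\<^sub>R e)})"

definition smooth_bounded_domain :: "'a::euclidean_space set \<Rightarrow> bool" where
  "smooth_bounded_domain \<Omega> \<longleftrightarrow>
     open \<Omega> \<and> connected \<Omega> \<and> \<Omega> \<noteq> {} \<and> bounded \<Omega> \<and> smooth_boundary \<Omega>"


section \<open>Lebesgue and Sobolev spaces\<close>

text \<open>Elements of the function spaces are represented by functions on the whole space; only their
  restrictions to \<open>\<Omega>\<close> matter, and these only up to equality almost everywhere.\<close>

definition Lp :: "real \<Rightarrow> 'a::euclidean_space set \<Rightarrow> ('a \<Rightarrow> 'b::euclidean_space) set" where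
  "Lp r \<Omega> = {f \<in> borel_measurable (lebesgue_on \<Omega>).
     integrable (lebesgue_on \<Omega>) (\<lambda>x. norm (f x) powr r)}"

definition Lp_norm :: "real \<Rightarrow> 'a::euclidean_space set \<Rightarrow> ('a \<Rightarrow> 'b::euclidean_space) \<Rightarrow> real" where
  "Lp_norm r \<Omega> f = (\<integral>x. norm (f x) powr r \<partial>lebesgue_on \<Omega>) powr (1 / r)"

definition locally_integrable ::
    "'a::euclidean_space set \<Rightarrow> ('a \<Rightarrow> 'b::euclidean_space) \<Rightarrow> bool" where
  "locally_integrable \<Omega> f \<longleftrightarrow> (\<forall>K. compact K \<and> K \<subseteq> \<Omega> \<longrightarrow> integrable (lebesgue_on K) f)"

definition test_functions :: "'a::euclidean_space set \<Rightarrow> ('a \<Rightarrow> real) set" where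
  "test_functions \<Omega> = {\<phi>. smooth_on UNIV \<phi> \<and>
     compact (closure {x. \<phi> x \<noteq> 0}) \<and> closure {x. \<phi> x \<noteq> 0} \<subseteq> \<Omega>}"

definition is_weak_gradient ::
    "'a::euclidean_space set \<Rightarrow> ('a \<Rightarrow> real) \<Rightarrow> ('a \<Rightarrow> 'a) \<Rightarrow> bool" where
  "is_weak_gradient \<Omega> u G \<longleftrightarrow>
     locally_integrable \<Omega> u \<and> locally_integrable \<Omega> G \<and>
     (\<forall>\<phi>\<in>test_functions \<Omega>. \<forall>i\<in>Basis.
        (\<integral>x. u x * frechet_derivative \<phi> (at x) i \<partial>lebesgue_on \<Omega>) =
        - (\<integral>x. (G x \<bullet> i) * \<phi> x \<partial>lebesgue_on \<Omega>))"

text \<open>The weak gradient is unique up to equality almost everywhere on \<open>\<Omega>\<close>, and it is only used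
  under integrals over \<open>\<Omega>\<close>, so the choice of the representative is immaterial.\<close>

definition weak_gradient :: "'a::euclidean_space set \<Rightarrow> ('a \<Rightarrow> real) \<Rightarrow> 'a \<Rightarrow> 'a" where
  "weak_gradient \<Omega> u = (SOME G. is_weak_gradient \<Omega> u G)"

definition W1p :: "real \<Rightarrow> 'a::euclidean_space set \<Rightarrow> ('a \<Rightarrow> real) set" where
  "W1p p \<Omega> = {u \<in> Lp p \<Omega>. \<exists>G\<in>Lp p \<Omega>. is_weak_gradient \<Omega> u G}"

definition W1p_norm :: "real \<Rightarrow> 'a::euclidean_space set \<Rightarrow> ('a \<Rightarrow> real) \<Rightarrow> real" where
  "W1p_norm p \<Omega> u = Lp_norm p \<Omega> u + Lp_norm p \<Omega> (weak_gradient \<Omega> u)"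

text \<open>The closure of the test functions in \<open>W\<^sup>1\<^sup>,\<^sup>p\<close>.\<close>

definition W01p :: "real \<Rightarrow> 'a::euclidean_space set \<Rightarrow> ('a \<Rightarrow> real) set" where
  "W01p p \<Omega> = {u \<in> W1p p \<Omega>. \<exists>\<phi>. (\<forall>k::nat. \<phi> k \<in> test_functions \<Omega>) \<and>
     (\<lambda>k. W1p_norm p \<Omega> (\<lambda>x. \<phi> k x - u x)) \<longlonglongrightarrow> 0}"

text \<open>The functions representing the zero element.\<close>

definition ae_zero :: "'a::euclidean_space set \<Rightarrow> ('a \<Rightarrow> real) set" where
  "ae_zero \<Omega> = {u. AE x in lebesgue_on \<Omega>. u x = 0}"

definition sobolev_conjugate :: "nat \<Rightarrow> real \<Rightarrow> ereal" where
  "sobolev_conjugate n r = (if r < real n then ereal (real n * r / (real n - r)) else \<infinity>)"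


section \<open>The Kirchhoff problem with logarithmic nonlinearity\<close>

text \<open>The convention \<open>0 log 0 = 0\<close> holds automatically, since \<open>0 powr r = 0\<close>.\<close>

definition Kirchhoff_M :: "real \<Rightarrow> real \<Rightarrow> real \<Rightarrow> real" where
  "Kirchhoff_M a b s = a + b * s"

definition energy_J ::
    "real \<Rightarrow> real \<Rightarrow> real \<Rightarrow> real \<Rightarrow> 'a::euclidean_space set \<Rightarrow> ('a \<Rightarrow> real) \<Rightarrow> real" where
  "energy_J a b p q \<Omega> u =
     a / p * Lp_norm p \<Omega> (weak_gradient \<Omega> u) powr p
     + b / (2 * p) * Lp_norm p \<Omega> (weak_gradient \<Omega> u) powr (2 * p)
     - 1 / (q + 1) * (\<integral>x. \<bar>u x\<bar> powr (q + 1) * ln \<bar>u x\<bar> \<partial>lebesgue_on \<Omega>)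
     + 1 / (q + 1)\<^sup>2 * Lp_norm (q + 1) \<Omega> u powr (q + 1)"

definition Nehari_I ::
    "real \<Rightarrow> real \<Rightarrow> real \<Rightarrow> real \<Rightarrow> 'a::euclidean_space set \<Rightarrow> ('a \<Rightarrow> real) \<Rightarrow> real" where
  "Nehari_I a b p q \<Omega> u =
     a * Lp_norm p \<Omega> (weak_gradient \<Omega> u) powr p
     + b * Lp_norm p \<Omega> (weak_gradient \<Omega> u) powr (2 * p)
     - (\<integral>x. \<bar>u x\<bar> powr (q + 1) * ln \<bar>u x\<bar> \<partial>lebesgue_on \<Omega>)"

definition Nehari_manifold ::
    "real \<Rightarrow> real \<Rightarrow> real \<Rightarrow> real \<Rightarrow> 'a::euclidean_space set \<Rightarrow> ('a \<Rightarrow> real) set" where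
  "Nehari_manifold a b p q \<Omega> =
     {u \<in> W01p p \<Omega>. Nehari_I a b p q \<Omega> u = 0 \<and> Lp_norm p \<Omega> (weak_gradient \<Omega> u) \<noteq> 0}"

text \<open>Infima are taken in the extended reals, where they are always genuine greatest lower bounds;
  on \<^typ>\<open>real\<close>, the infimum of an empty or unbounded set would be an unspecified number.\<close>

definition depth_d ::
    "real \<Rightarrow> real \<Rightarrow> real \<Rightarrow> real \<Rightarrow> 'a::euclidean_space set \<Rightarrow> ereal" where
  "depth_d a b p q \<Omega> = (INF u\<in>Nehari_manifold a b p q \<Omega>. ereal (energy_J a b p q \<Omega> u))"

text \<open>The pairing \<open>\<langle>J'(u), \<phi>\<rangle>\<close>, i.e. the derivative of \<open>\<tau> \<mapsto> J (u + \<tau> \<phi>)\<close> at \<open>\<tau> = 0\<close>, written out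
  as the weak form of the boundary value problem
  \<open>- M (\<parallel>\<nabla>u\<parallel>\<^sub>p\<^sup>p) \<Delta>\<^sub>p u = \<bar>u\<bar>\<^sup>q\<^sup>-\<^sup>1 u log \<bar>u\<bar>\<close> in \<open>\<Omega>\<close>, \<open>u = 0\<close> on \<open>\<partial>\<Omega>\<close>.\<close>

definition energy_J' ::
    "real \<Rightarrow> real \<Rightarrow> real \<Rightarrow> real \<Rightarrow> 'a::euclidean_space set \<Rightarrow> ('a \<Rightarrow> real) \<Rightarrow> ('a \<Rightarrow> real) \<Rightarrow> real" where
  "energy_J' a b p q \<Omega> u \<phi> =
     Kirchhoff_M a b (Lp_norm p \<Omega> (weak_gradient \<Omega> u) powr p) *
       (\<integral>x. (norm (weak_gradient \<Omega> u x) powr (p - 2) *\<^sub>R weak_gradient \<Omega> u x)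
             \<bullet> weak_gradient \<Omega> \<phi> x \<partial>lebesgue_on \<Omega>)
     - (\<integral>x. (\<bar>u x\<bar> powr (q - 1) * u x * ln \<bar>u x\<bar>) * \<phi> x \<partial>lebesgue_on \<Omega>)"

definition solutions_Phi ::
    "real \<Rightarrow> real \<Rightarrow> real \<Rightarrow> real \<Rightarrow> 'a::euclidean_space set \<Rightarrow> ('a \<Rightarrow> real) set" where
  "solutions_Phi a b p q \<Omega> =
     {u \<in> W01p p \<Omega>. \<forall>\<phi>\<in>W01p p \<Omega>. energy_J' a b p q \<Omega> u \<phi> = 0}"

definition ground_state ::
    "real \<Rightarrow> real \<Rightarrow> real \<Rightarrow> real \<Rightarrow> 'a::euclidean_space set \<Rightarrow> ('a \<Rightarrow> real) \<Rightarrow> bool" where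
  "ground_state a b p q \<Omega> u \<longleftrightarrow>
     u \<in> solutions_Phi a b p q \<Omega> - ae_zero \<Omega> \<and>
     ereal (energy_J a b p q \<Omega> u) =
       (INF v\<in>solutions_Phi a b p q \<Omega> - ae_zero \<Omega>. ereal (energy_J a b p q \<Omega> v))"

end

theory Submission
  imports Defs "HOL-Complex_Analysis.Great_Picard"
begin

text \<open>Write \<open>E(u) = \<parallel>\<nabla>u\<parallel>\<^sub>p\<^sup>p\<close> and \<open>s = q + 2\<close>; the hypothesis on \<open>q\<close> says that \<open>s\<close> is below the
  Sobolev conjugate of \<open>p\<close>, and \<open>\<bar>u\<bar>\<^sup>q\<^sup>+\<^sup>1 log \<bar>u\<bar> \<le> \<bar>u\<bar>\<^sup>s\<close>.

  The embedding into \<open>L\<^sup>s\<close> and its compactness both come from one estimate for test functions: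
  the \<open>L\<^sup>s\<close> distance between \<open>\<phi>\<close> and its average over a translated ball is controlled by
  \<open>\<parallel>\<nabla>\<phi>\<parallel>\<^sub>p\<close>. For a far away ball the average vanishes (Sobolev and Poincare); for a small ball
  around the origin the constant tends to \<open>0\<close> while the averages are equi-Lipschitz (Rellich).

  On the Nehari manifold \<open>J\<close> is a positive combination of \<open>E(u)\<close>, \<open>E(u)\<^sup>2\<close> and
  \<open>\<parallel>u\<parallel>\<^sub>q\<^sub>+\<^sub>1\<^sup>q\<^sup>+\<^sup>1\<close>, so a minimising sequence is bounded and \<open>E\<close> stays away from \<open>0\<close>. Its limit \<open>v\<close>
  satisfies \<open>I(v) \<le> 0\<close>, hence \<open>c v\<close> lies on the manifold for some \<open>c \<le> 1\<close>, and \<open>J(c v) \<le> d\<close>.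
  If \<open>\<langle>J'(u), \<phi>\<rangle> < 0\<close> at a minimiser \<open>u\<close>, then points \<open>c u + t \<phi>\<close> of the manifold with \<open>c\<close> near \<open>1\<close>
  and small \<open>t > 0\<close> would have \<open>J(c u + t \<phi>) < J(c u) \<le> J(u)\<close>, since \<open>u\<close> maximises \<open>J\<close> on its
  ray. Conversely every nontrivial solution lies on the manifold, by testing with itself.\<close>

section \<open>Smooth functions and test functions\<close>

text \<open>The function chosen by \<open>weak_gradient\<close> is determined only up to null sets,
  and the gradient of a limit is not visible in the limit itself. The argument therefore moves pairs
  \<open>(u, G)\<close> in the closure of the graph of \<open>grad\<close> over test functions;
  uniqueness of weak gradients identifies this closure with \<open>W01p\<close>. Norms are replaced
  by their p-th powers \<open>LP_int\<close>, whose triangle inequality with factor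
  \<open>2 powr p\<close> is enough for every limit.

  The logarithm exceeds each fixed multiple of the power \<open>q + 1\<close>, but one more unit in
  the exponent absorbs it. Strong convergence in that larger exponent makes all terms without
  gradient continuous, and only the gradient energy needs lower semicontinuity.

  A Lagrange multiplier rule would require the constraint \<open>I = 0\<close> to be differentiable
  with nondegenerate derivative. Here continuity of \<open>I\<close> and its strict change of sign
  along a ray replace this; the sign change rests on \<open>q + 1 > 2 * p\<close>, which also makes
  the coefficients of the reduced functional positive. The case \<open>p \<ge> 2\<close> gives
  Clarkson's inequality in its simplest form.\<close>

lemma Ck_on_UNIV_SucI:
  assumes "\<And>x. (f has_derivative D x) (at x)" and "\<And>i. i \<in> Basis \<Longrightarrow> Ck_on k UNIV (\<lambda>x. D x i)"
  shows "Ck_on (Suc k) UNIV f"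
proof -
  have "frechet_derivative f (at x) = D x" for x
    using frechet_derivative_at[OF assms(1)[of x]] by simp
  moreover have "f differentiable_on UNIV"
    using assms(1) by (auto simp: differentiable_on_def differentiable_def)
  ultimately show ?thesis using assms(2) by simp
qed

lemma Ck_on_UNIV_SucD:
  assumes "Ck_on (Suc k) UNIV f"
  shows "(f has_derivative frechet_derivative f (at x)) (at x)"
    and "i \<in> Basis \<Longrightarrow> Ck_on k UNIV (\<lambda>x. frechet_derivative f (at x) i)"
  using assms by (auto simp: differentiable_on_def frechet_derivative_works)

text \<open>The product rule leaves one factor undifferentiated, and that factor is then needed with
  one order of smoothness less.\<close>

lemma Ck_on_UNIV_pred: "Ck_on (Suc k) UNIV f \<Longrightarrow> Ck_on k UNIV f"
proof (induction k arbitrary: f)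
  case 0
  then show ?case by (auto intro: differentiable_imp_continuous_on)
next
  case (Suc k)
  then show ?case by (metis Ck_on.simps(2))
qed

lemma Ck_on_UNIV_const: "Ck_on k UNIV (\<lambda>x. c)"
proof (induction k arbitrary: c)
  case (Suc k)
  show ?case by (rule Ck_on_UNIV_SucI[where D="\<lambda>x h. 0"]) (use Suc in auto)
qed auto

lemma Ck_on_UNIV_add: "Ck_on k UNIV f \<Longrightarrow> Ck_on k UNIV g \<Longrightarrow> Ck_on k UNIV (\<lambda>x. f x + g x)"
proof (induction k arbitrary: f g)
  case (Suc k)
  show ?case
    by (rule Ck_on_UNIV_SucI, rule has_derivative_add[OF Ck_on_UNIV_SucD(1)[OF Suc.prems(1)] Ck_on_UNIV_SucD(1)[OF Suc.prems(2)]])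
      (intro Suc.IH Ck_on_UNIV_SucD(2)[OF Suc.prems(1)] Ck_on_UNIV_SucD(2)[OF Suc.prems(2)])
qed (auto intro: continuous_intros)

lemma Ck_on_UNIV_mult: "Ck_on k UNIV f \<Longrightarrow> Ck_on k UNIV g \<Longrightarrow> Ck_on k UNIV (\<lambda>x. f x * g x)"
proof (induction k arbitrary: f g)
  case (Suc k)
  show ?case
  proof (rule Ck_on_UNIV_SucI, rule has_derivative_mult[OF Ck_on_UNIV_SucD(1)[OF Suc.prems(1)] Ck_on_UNIV_SucD(1)[OF Suc.prems(2)]])
    show "Ck_on k UNIV (\<lambda>x. f x * frechet_derivative g (at x) i + frechet_derivative f (at x) i * g x)"
      if "i \<in> Basis" for i
      using that by (intro Ck_on_UNIV_add Suc.IH Ck_on_UNIV_SucD(2)[OF Suc.prems(1)] Ck_on_UNIV_SucD(2)[OF Suc.prems(2)]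
        Ck_on_UNIV_pred[OF Suc.prems(1)] Ck_on_UNIV_pred[OF Suc.prems(2)])
  qed
qed (auto intro: continuous_intros)

lemma Ck_on_UNIV_prod:
  "finite I \<Longrightarrow> (\<And>i. i \<in> I \<Longrightarrow> Ck_on k UNIV (f i)) \<Longrightarrow> Ck_on k UNIV (\<lambda>x. \<Prod>i\<in>I. f i x)"
  by (induction I rule: finite_induct) (auto intro: Ck_on_UNIV_mult Ck_on_UNIV_const)

text \<open>The derivative of \<open>flat P\<close> is again of this form, so \<open>flat P\<close> is smooth at \<open>0\<close> as well.\<close>

definition flat :: "real poly \<Rightarrow> real \<Rightarrow> real" where
  "flat P t = (if t > 0 then poly P (1 / t) * exp (- 1 / t) else 0)"

text \<open>Each monomial loses against the exponential at infinity; the substitution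
  \<open>x = 1 / t\<close> carries this to \<open>0\<close> from the right.\<close>

lemma poly_inverse_exp_tendsto_0:
  "((\<lambda>t::real. poly P (1 / t) * exp (- 1 / t)) \<longlongrightarrow> 0) (at_right 0)"
proof -
  have "((\<lambda>x::real. poly P x * exp (- x)) \<longlongrightarrow> 0) at_top"
  proof (induction P)
    case (pCons c P)
    have lim: "((\<lambda>x::real. x ^ n / exp x) \<longlongrightarrow> 0) at_top" for n
      by (rule tendsto_power_div_exp_0)
    have 1: "((\<lambda>x::real. (\<Sum>i\<le>degree (pCons c P). coeff (pCons c P) i * (x ^ i / exp x))) \<longlongrightarrow> 0) at_top"
      by (intro tendsto_null_sum tendsto_mult_right_zero lim)
    show ?case
      by (rule Lim_transform_eventually[OF 1])
        (auto simp: poly_altdef sum_distrib_left sum_distrib_right exp_minus divide_inverse mult_ac simp del: degree_pCons_eq_if coeff_pCons_Suc sum.atMost_Suc intro!: always_eventually sum.cong)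
  qed auto
  then have "((\<lambda>t::real. poly P (inverse t) * exp (- inverse t)) \<longlongrightarrow> 0) (at_right 0)"
    using filterlim_compose filterlim_inverse_at_top_right by blast
  then show ?thesis by (simp add: divide_inverse)
qed

text \<open>Differentiating \<open>1 / t\<close> contributes \<open>1 / t^2\<close>, which is the
  polynomial \<open>[:0, 0, 1:]\<close> at \<open>1 / t\<close>. The exponential supplies
  \<open>P\<close> and the polynomial factor supplies \<open>- pderiv P\<close>.\<close>

lemma flat_has_derivative:
  "(flat P has_real_derivative flat ([:0, 0, 1:] * (P - pderiv P)) t) (at t)"
proof -
  consider "t > 0" | "t < 0" | "t = 0" by linarith
  then show ?thesis
  proof cases
    case 1
    have "((\<lambda>t. poly P (1 / t) * exp (- 1 / t)) has_real_derivative flat ([:0, 0, 1:] * (P - pderiv P)) t) (at t)"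
    proof -
      have 2: "((\<lambda>t. 1 / t) has_real_derivative - (1 / t\<^sup>2)) (at t)" "((\<lambda>t. - 1 / t) has_real_derivative 1 / t\<^sup>2) (at t)"
        using 1 by (auto intro!: derivative_eq_intros simp: power2_eq_square)
      have "((\<lambda>t. poly P (1 / t) * exp (- 1 / t)) has_real_derivative
          (poly (pderiv P) (1 / t) * - (1 / t\<^sup>2)) * exp (- 1 / t) + (exp (- 1 / t) * (1 / t\<^sup>2)) * poly P (1 / t)) (at t)"
        by (intro DERIV_mult DERIV_chain2[OF poly_DERIV 2(1)] DERIV_chain2[OF DERIV_exp 2(2)])
      then show ?thesis
        using 1 by (simp add: flat_def power2_eq_square algebra_simps)
    qed
    then show ?thesis
      by (rule has_field_derivative_transform_within_open[where S="{0<..}"]) (use 1 in \<open>auto simp: flat_def\<close>)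
  next
    case 2
    have "((\<lambda>t. 0::real) has_real_derivative 0) (at t)" by simp
    then have "(flat P has_real_derivative 0) (at t)"
      by (rule has_field_derivative_transform_within_open[where S="{..<0}"]) (use 2 in \<open>auto simp: flat_def\<close>)
    then show ?thesis using 2 by (simp add: flat_def)
  next
    case 3
    \<comment> \<open>Division by \<open>t\<close> is multiplication by \<open>[:0, 1:]\<close> at
      \<open>1 / t\<close>, so the difference quotient at \<open>0\<close> is again of the flat form
      and tends to \<open>0\<close>.\<close>
    have right: "((\<lambda>y. (flat P y - flat P 0) / (y - 0)) \<longlongrightarrow> 0) (at_right 0)"
    proof (rule Lim_transform_eventually[OF poly_inverse_exp_tendsto_0[of "[:0, 1:] * P"]])
      show "\<forall>\<^sub>F x in at_right 0. poly ([:0, 1:] * P) (1 / x) * exp (- 1 / x) = (flat P x - flat P 0) / (x - 0)"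
        unfolding eventually_at_filter by (auto simp: flat_def divide_simps intro!: always_eventually)
    qed
    have left: "((\<lambda>y. (flat P y - flat P 0) / (y - 0)) \<longlongrightarrow> 0) (at_left 0)"
      by (rule Lim_transform_eventually[OF tendsto_const])
        (auto simp: flat_def eventually_at_filter intro!: always_eventually)
    show ?thesis
      using 3 right left by (auto simp: has_field_derivative_iff filterlim_split_at flat_def)
  qed
qed

text \<open>\<open>P\<close> stays arbitrary in the induction because each derivative replaces it by
  another polynomial. Affine inner functions are all that the box bumps need, which spares a general
  chain rule for \<open>Ck_on\<close>.\<close>

lemma Ck_on_UNIV_flat: "Ck_on k UNIV (\<lambda>x::'a::euclidean_space. flat P (x \<bullet> v + c))"
proof (induction k arbitrary: P)
  case 0
  have "continuous_on UNIV (flat P)"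
    by (rule DERIV_continuous_on, rule DERIV_subset[OF flat_has_derivative]) auto
  then have "continuous_on UNIV (\<lambda>x. flat P (x \<bullet> v + c))"
    by (rule continuous_on_compose2[of UNIV "flat P"]) (auto intro!: continuous_intros)
  then show ?case by simp
next
  case (Suc k)
  let ?Q = "[:0, 0, 1:] * (P - pderiv P)"
  show ?case
  proof (rule Ck_on_UNIV_SucI[where D="\<lambda>x h. flat ?Q (x \<bullet> v + c) * (h \<bullet> v)"])
    show "((\<lambda>x. flat P (x \<bullet> v + c)) has_derivative (\<lambda>h. flat ?Q (x \<bullet> v + c) * (h \<bullet> v))) (at x)" for x
    proof -
      have "((\<lambda>x. x \<bullet> v + c) has_derivative (\<lambda>h. h \<bullet> v)) (at x)"
        by (auto intro!: derivative_eq_intros)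
      from has_derivative_compose[OF this flat_has_derivative[unfolded has_field_derivative_def]]
      show ?thesis .
    qed
    show "Ck_on k UNIV (\<lambda>x. flat ?Q (x \<bullet> v + c) * (i \<bullet> v))" for i
      by (intro Ck_on_UNIV_mult Suc.IH Ck_on_UNIV_const)
  qed
qed

section \<open>Gradients and supports of test functions\<close>

lemma continuous_vanishing_bounded:
  fixes g :: "'a::topological_space \<Rightarrow> 'b::real_normed_vector"
  assumes "compact K" "continuous_on UNIV g" "\<And>x. x \<notin> K \<Longrightarrow> g x = 0"
  obtains C where "C \<ge> 0" "\<And>x. norm (g x) \<le> C"
proof -
  have "bounded (g ` K)"
    using compact_continuous_image[OF continuous_on_subset[OF assms(2)] assms(1)] compact_imp_bounded by auto
  then obtain C where C: "\<And>x. x \<in> K \<Longrightarrow> norm (g x) \<le> C" by (auto simp: bounded_iff)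
  have "norm (g x) \<le> max C 0" for x using C[of x] assms(3)[of x] by (cases "x \<in> K") auto
  then show ?thesis using that[of "max C 0"] by simp
qed

text \<open>The vector that represents the derivative through the inner product; its components are
  the partial derivatives occurring in \<open>is_weak_gradient\<close>.\<close>

definition grad :: "('a::euclidean_space \<Rightarrow> real) \<Rightarrow> 'a \<Rightarrow> 'a" where
  "grad f x = (\<Sum>i\<in>Basis. frechet_derivative f (at x) i *\<^sub>R i)"

lemma grad_inner_Basis: "i \<in> Basis \<Longrightarrow> grad f x \<bullet> i = frechet_derivative f (at x) i"
  unfolding grad_def by simp

lemma has_derivative_grad_iff:
  "f differentiable (at x) \<longleftrightarrow> (f has_derivative (\<lambda>h. grad f x \<bullet> h)) (at x)"
proof
  assume "f differentiable (at x)"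
  then have d: "(f has_derivative frechet_derivative f (at x)) (at x)"
    by (simp add: frechet_derivative_works)
  then interpret bounded_linear "frechet_derivative f (at x)" by (rule has_derivative_bounded_linear)
  have "frechet_derivative f (at x) h = grad f x \<bullet> h" for h
  proof -
    have "frechet_derivative f (at x) h = frechet_derivative f (at x) (\<Sum>i\<in>Basis. (h \<bullet> i) *\<^sub>R i)"
      by (simp add: euclidean_representation)
    also have "\<dots> = grad f x \<bullet> h"
      by (simp add: sum scale grad_def inner_sum_left inner_sum_right inner_commute mult.commute)
    finally show ?thesis .
  qed
  then have "frechet_derivative f (at x) = (\<lambda>h. grad f x \<bullet> h)" by auto
  with d show "(f has_derivative (\<lambda>h. grad f x \<bullet> h)) (at x)" by simp
qed (auto simp: differentiable_def)

lemma gradI: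
  assumes "(f has_derivative (\<lambda>h. v \<bullet> h)) (at x)"
  shows "grad f x = v"
proof -
  have "frechet_derivative f (at x) = (\<lambda>h. v \<bullet> h)" using frechet_derivative_at[OF assms] by simp
  then show ?thesis by (simp add: grad_def euclidean_representation)
qed

text \<open>The estimates below see a test function only as a C^1 function that vanishes, together
  with its gradient, outside a compact subset of \<Omega>.\<close>

lemma
  assumes "\<phi> \<in> test_functions \<Omega>"
  shows test_has_derivative: "(\<phi> has_derivative (\<lambda>h. grad \<phi> x \<bullet> h)) (at x)"
    and test_continuous: "continuous_on UNIV \<phi>"
    and test_grad_continuous: "continuous_on UNIV (grad \<phi>)"
    and test_support: "\<exists>K. compact K \<and> K \<subseteq> \<Omega> \<and> (\<forall>x. x \<notin> K \<longrightarrow> \<phi> x = 0 \<and> grad \<phi> x = 0)"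
proof -
  have Ck: "Ck_on k UNIV \<phi>" for k using assms by (auto simp: test_functions_def smooth_on_def)
  show der: "(\<phi> has_derivative (\<lambda>h. grad \<phi> x \<bullet> h)) (at x)" for x
    using Ck_on_UNIV_SucD(1)[OF Ck] has_derivative_grad_iff differentiable_def by blast
  show "continuous_on UNIV \<phi>" using Ck[of 0] by simp
  show "continuous_on UNIV (grad \<phi>)"
    unfolding grad_def by (intro continuous_intros) (use Ck[of "Suc 0"] in simp)
  let ?K = "closure {x. \<phi> x \<noteq> 0}"
  have zero: "\<phi> x = 0" if "x \<notin> ?K" for x
    using that closure_subset[of "{x. \<phi> x \<noteq> 0}"] by blast
  \<comment> \<open>Off the closed support the function is \<open>0\<close> on an open
    neighbourhood, hence its gradient is \<open>0\<close> as well.\<close>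
  have "\<phi> x = 0 \<and> grad \<phi> x = 0" if "x \<notin> ?K" for x
  proof
    show "\<phi> x = 0" using that by (rule zero)
    have "((\<lambda>x. 0::real) has_derivative (\<lambda>h. 0 \<bullet> h)) (at x)" by simp
    then have "(\<phi> has_derivative (\<lambda>h. 0 \<bullet> h)) (at x)"
      by (rule has_derivative_transform_within_open[OF _ open_Compl[OF closed_closure[of "{x. \<phi> x \<noteq> 0}"]]])
        (use that in blast, metis ComplD zero)
    then show "grad \<phi> x = 0" by (rule gradI)
  qed
  then show "\<exists>K. compact K \<and> K \<subseteq> \<Omega> \<and> (\<forall>x. x \<notin> K \<longrightarrow> \<phi> x = 0 \<and> grad \<phi> x = 0)"
    using assms unfolding test_functions_def mem_Collect_eq by blast
qed

lemma test_functions_lincomb: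
  assumes "\<phi> \<in> test_functions \<Omega>" "\<psi> \<in> test_functions \<Omega>"
  shows "(\<lambda>x. s * \<phi> x + t * \<psi> x) \<in> test_functions \<Omega>"
    and "grad (\<lambda>x. s * \<phi> x + t * \<psi> x) = (\<lambda>x. s *\<^sub>R grad \<phi> x + t *\<^sub>R grad \<psi> x)"
proof -
  let ?f = "\<lambda>x. s * \<phi> x + t * \<psi> x"
  have sub: "closure {x. ?f x \<noteq> 0} \<subseteq> closure {x. \<phi> x \<noteq> 0} \<union> closure {x. \<psi> x \<noteq> 0}"
    unfolding closure_Un[symmetric] by (rule closure_mono) auto
  have closed_subset_compact: "compact (closure A)" if "closure A \<subseteq> B" "compact B" for A B :: "'a set"
    using that compact_Int_closed[of B "closure A"] by (simp add: Int_absorb1)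
  have "smooth_on UNIV ?f"
    using assms unfolding test_functions_def smooth_on_def
    by (auto intro!: Ck_on_UNIV_add Ck_on_UNIV_mult Ck_on_UNIV_const)
  moreover have "compact (closure {x. ?f x \<noteq> 0})"
    by (rule closed_subset_compact[OF sub]) (use assms in \<open>simp add: test_functions_def compact_Un del: compact_closure\<close>)
  ultimately show "?f \<in> test_functions \<Omega>"
    using sub assms unfolding test_functions_def by blast
  show "grad ?f = (\<lambda>x. s *\<^sub>R grad \<phi> x + t *\<^sub>R grad \<psi> x)"
    by (intro ext gradI) (auto intro!: derivative_eq_intros test_has_derivative[OF assms(1)] test_has_derivative[OF assms(2)] simp: inner_left_distrib)
qed

text \<open>A product over the coordinates of smooth cutoffs at both faces of the box. Since
  \<open>exp (- 1 / (k * c))\<close> tends to \<open>1\<close> for \<open>c > 0\<close>, the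
  parameter \<open>k\<close> lets the bumps approach the indicator of the open box.\<close>

definition box_bump :: "'a::euclidean_space \<Rightarrow> 'a \<Rightarrow> nat \<Rightarrow> 'a \<Rightarrow> real" where
  "box_bump u v k x = (\<Prod>i\<in>Basis. flat 1 (real k * (x \<bullet> i - u \<bullet> i)) * flat 1 (real k * (v \<bullet> i - x \<bullet> i)))"

lemma flat_1: "flat 1 t = (if t > 0 then exp (- 1 / t) else 0)"
  by (simp add: flat_def)

lemma box_bump_bounds: "0 \<le> box_bump u v k x" "box_bump u v k x \<le> 1"
  unfolding box_bump_def
  by (auto intro!: prod_nonneg prod_le_1 mult_le_one simp: flat_1)

lemma box_bump_pos_iff: "k > 0 \<Longrightarrow> box_bump u v k x \<noteq> 0 \<longleftrightarrow> x \<in> box u v"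
  unfolding box_bump_def by (auto simp: flat_1 mem_box zero_less_mult_iff split: if_splits)

lemma box_bump_test:
  assumes "k > 0" "cbox u v \<subseteq> \<Omega>"
  shows "box_bump u v k \<in> test_functions \<Omega>"
proof -
  have "{x. box_bump u v k x \<noteq> 0} = box u v" using box_bump_pos_iff[OF assms(1)] by auto
  then have sub: "closure {x. box_bump u v k x \<noteq> 0} \<subseteq> cbox u v"
    by (simp add: closure_minimal box_subset_cbox closed_cbox)
  have "Ck_on n UNIV (box_bump u v k)" for n
  proof -
    have "Ck_on n UNIV (\<lambda>x. flat 1 (real k * (x \<bullet> i - u \<bullet> i)))" for i
      using Ck_on_UNIV_flat[of n 1 "real k *\<^sub>R i" "- real k * (u \<bullet> i)"] by (simp add: algebra_simps)
    moreover have "Ck_on n UNIV (\<lambda>x. flat 1 (real k * (v \<bullet> i - x \<bullet> i)))" for i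
      using Ck_on_UNIV_flat[of n 1 "- real k *\<^sub>R i" "real k * (v \<bullet> i)"] by (simp add: algebra_simps)
    ultimately show ?thesis
      unfolding box_bump_def[abs_def] by (intro Ck_on_UNIV_prod Ck_on_UNIV_mult) auto
  qed
  then show ?thesis
    using sub assms(2) compact_Int_closed[OF compact_cbox closed_closure, of u v "{x. box_bump u v k x \<noteq> 0}"]
    by (auto simp: test_functions_def smooth_on_def Int_absorb1)
qed

lemma box_bump_tendsto: "(\<lambda>k. box_bump u v (Suc k) x) \<longlonglongrightarrow> indicator (box u v) x"
proof -
  have 1: "(\<lambda>k. flat 1 (real (Suc k) * c)) \<longlonglongrightarrow> (if c > 0 then 1 else 0)" for c
  proof (cases "c > 0")
    case True
    have "(\<lambda>k. exp (- (1 / c) * inverse (real (Suc k)))) \<longlonglongrightarrow> exp (- (1 / c) * 0)"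
      by (intro tendsto_intros LIMSEQ_inverse_real_of_nat)
    then show ?thesis using True by (simp add: flat_1 divide_inverse mult_ac)
  next
    case False
    then show ?thesis by (simp add: flat_1 zero_less_mult_iff)
  qed
  have "(\<lambda>k. box_bump u v (Suc k) x) \<longlonglongrightarrow>
      (\<Prod>i\<in>Basis. (if x \<bullet> i - u \<bullet> i > 0 then 1 else 0) * (if v \<bullet> i - x \<bullet> i > 0 then 1 else 0))"
    unfolding box_bump_def by (intro tendsto_prod tendsto_mult 1)
  also have "(\<Prod>i\<in>Basis. (if x \<bullet> i - u \<bullet> i > 0 then 1 else 0) * (if v \<bullet> i - x \<bullet> i > 0 then 1 else 0)) = (indicator (box u v) x :: real)"
    by (auto simp: indicator_def mem_box)
  finally show ?thesis .
qed

section \<open>Powers and \<open>L\<^sup>p\<close> convergence\<close>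

lemma powr_tangent_le:
  fixes y m p :: real
  assumes "p \<ge> 1" "y \<ge> 0" "m \<ge> 0"
  shows "m powr p + p * m powr (p - 1) * (y - m) \<le> y powr p"
proof -
  \<comment> \<open>The tangent argument runs on the open half line, so \<open>m = 0\<close> and
    \<open>y = 0\<close> are separate. For \<open>m = 0\<close> the convention
    \<open>0 powr 0 = 0\<close> makes the slope vanish even if \<open>p = 1\<close>.\<close>
  consider "m = 0" | "m > 0" "y = 0" | "m > 0" "y > 0" using assms by linarith
  then show ?thesis
  proof cases
    case 2
    have "m powr p = m powr (p - 1) * m" using 2 powr_mult_base[of m "p - 1"] by (simp add: mult.commute)
    then show ?thesis using 2 assms by (simp add: algebra_simps mult_right_mono)
  next
    case 3
    have "((\<lambda>x. x powr p) has_real_derivative p * m powr (p - 1)) (at m within {0<..})"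
      using 3 by (auto intro!: derivative_eq_intros)
    from convex_on_imp_above_tangent[OF powr_convex[OF assms(1)] _ _ _ this, of y] 3
    show ?thesis by (simp add: interior_open)
  qed (use assms in auto)
qed

text \<open>The tangent at the midpoint lies below the power at both ends, and its two linear terms
  cancel.\<close>

lemma powr_midpoint_le:
  fixes x y p :: real
  assumes "p \<ge> 1" "x \<ge> 0" "y \<ge> 0"
  shows "((x + y) / 2) powr p \<le> (x powr p + y powr p) / 2"
proof -
  let ?m = "(x + y) / 2"
  have "?m powr p + p * ?m powr (p - 1) * (x - ?m) \<le> x powr p"
    "?m powr p + p * ?m powr (p - 1) * (y - ?m) \<le> y powr p"
    by (rule powr_tangent_le; use assms in simp)+
  moreover have "T * (x - ?m) + T * (y - ?m) = 0" for T
    by (simp add: field_simps)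
  from this[of "p * ?m powr (p - 1)"] calculation show ?thesis by argo
qed

lemma norm_powr_midpoint_le:
  fixes x y :: "'b::real_normed_vector"
  assumes "p \<ge> (1::real)"
  shows "norm ((1/2) *\<^sub>R (x + y)) powr p \<le> (norm x powr p + norm y powr p) / 2"
proof -
  have "norm ((1/2) *\<^sub>R (x + y)) \<le> (norm x + norm y) / 2"
    using norm_triangle_ineq[of x y] by simp
  then have "norm ((1/2) *\<^sub>R (x + y)) powr p \<le> ((norm x + norm y) / 2) powr p"
    using assms by (intro powr_mono2) auto
  also have "\<dots> \<le> (norm x powr p + norm y powr p) / 2"
    using assms by (intro powr_midpoint_le) auto
  finally show ?thesis .
qed

text \<open>With one factor split off, the remaining power \<open>r - 1\<close> is monotone, so both
  terms may use the larger base \<open>x + y\<close>.\<close>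

lemma powr_superadditive:
  fixes x y r :: real
  assumes "r \<ge> 1" "x \<ge> 0" "y \<ge> 0"
  shows "x powr r + y powr r \<le> (x + y) powr r"
proof -
  have eq: "t powr r = t * t powr (r - 1)" if "t \<ge> 0" for t :: real
    using powr_mult_base[OF that, of "r - 1"] by simp
  have "x powr r + y powr r \<le> x * (x + y) powr (r - 1) + y * (x + y) powr (r - 1)"
    unfolding eq[OF assms(2)] eq[OF assms(3)]
    using assms by (intro add_mono mult_left_mono powr_mono2) auto
  also have "\<dots> = (x + y) powr r" using eq[of "x + y"] assms by (simp add: algebra_simps)
  finally show ?thesis .
qed

text \<open>The parallelogram law is the case \<open>p = 2\<close>. Passing to the power
  \<open>p / 2 \<ge> 1\<close> costs superadditivity on the left and convexity on the right.\<close>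

lemma Clarkson_pointwise:
  fixes x y :: "'b::real_inner"
  assumes "p \<ge> (2::real)"
  shows "norm ((1/2) *\<^sub>R (x + y)) powr p + norm ((1/2) *\<^sub>R (x - y)) powr p
    \<le> (norm x powr p + norm y powr p) / 2"
proof -
  have eq: "norm z powr p = (norm z ^ 2) powr (p / 2)" for z :: 'b
    using powr_powr[of "norm z" 2 "p / 2"] powr_numeral[of "norm z" "num.Bit0 num.One"] by simp
  have sum: "norm ((1/2) *\<^sub>R (x + y)) ^ 2 + norm ((1/2) *\<^sub>R (x - y)) ^ 2 = (norm x ^ 2 + norm y ^ 2) / 2"
    unfolding power2_norm_eq_inner by (simp add: inner_add inner_diff inner_commute field_simps)
  have "norm ((1/2) *\<^sub>R (x + y)) powr p + norm ((1/2) *\<^sub>R (x - y)) powr p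
      \<le> ((norm x ^ 2 + norm y ^ 2) / 2) powr (p / 2)"
    unfolding eq sum[symmetric] using assms by (intro powr_superadditive) auto
  also have "\<dots> \<le> (norm x powr p + norm y powr p) / 2"
    unfolding eq using assms by (intro powr_midpoint_le) auto
  finally show ?thesis .
qed

text \<open>The norm of a sum is at most twice the larger norm. The constant is crude but holds for
  every \<open>p \<ge> 0\<close>, and the limits below only need some constant.\<close>

lemma norm_add_powr_le:
  fixes x y :: "'b::real_normed_vector"
  assumes "p \<ge> (0::real)"
  shows "norm (x + y) powr p \<le> 2 powr p * (norm x powr p + norm y powr p)"
proof -
  have "norm (x + y) \<le> 2 * max (norm x) (norm y)" using norm_triangle_ineq[of x y] by auto
  then have "norm (x + y) powr p \<le> (2 * max (norm x) (norm y)) powr p"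
    using assms by (intro powr_mono2) auto
  also have "\<dots> = 2 powr p * max (norm x) (norm y) powr p" by (simp add: powr_mult)
  also have "\<dots> \<le> 2 powr p * (norm x powr p + norm y powr p)"
    by (intro mult_left_mono) (auto simp: max_def)
  finally show ?thesis .
qed

text \<open>Convergence in \<open>L^p\<close> gives convergence almost everywhere only along
  subsequences; this criterion returns from there to the whole sequence.\<close>

lemma tendsto_if_subseq_tendsto:
  fixes f :: "nat \<Rightarrow> 'b::metric_space"
  assumes "\<And>r :: nat \<Rightarrow> nat. strict_mono r \<Longrightarrow> \<exists>r'. strict_mono r' \<and> (\<lambda>n. f (r (r' n))) \<longlonglongrightarrow> l"
  shows "f \<longlonglongrightarrow> l"
proof (rule ccontr)
  assume "\<not> f \<longlonglongrightarrow> l"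
  then obtain e where e: "e > 0" "\<exists>\<^sub>F n in sequentially. \<not> dist (f n) l < e"
    by (auto simp: tendsto_iff frequently_def)
  then have "infinite {n. \<not> dist (f n) l < e}"
    by (simp add: cofinite_eq_sequentially[symmetric] frequently_cofinite)
  then obtain r :: "nat \<Rightarrow> nat" where r: "strict_mono r" "\<And>n. r n \<in> {n. \<not> dist (f n) l < e}"
    using infinite_enumerate by blast
  obtain r' where "(\<lambda>n. f (r (r' n))) \<longlonglongrightarrow> l" using assms[OF r(1)] by blast
  then have "\<forall>\<^sub>F n in sequentially. dist (f (r (r' n))) l < e" using e(1) by (auto simp: tendsto_iff)
  then show False using r(2) by (auto simp: eventually_sequentially)
qed

section \<open>Convergence and completeness for p-th power integrals\<close>

definition LP :: "'x measure \<Rightarrow> real \<Rightarrow> ('x \<Rightarrow> 'b::euclidean_space) set" where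
  "LP M p = {f \<in> borel_measurable M. integrable M (\<lambda>x. norm (f x) powr p)}"

text \<open>The p-th power of the norm. It is homogeneous of degree \<open>p\<close>, the form in
  which the energy occurs, and taking no root keeps midpoint and tangent inequalities integrable
  term by term.\<close>

definition LP_int :: "'x measure \<Rightarrow> real \<Rightarrow> ('x \<Rightarrow> 'b::euclidean_space) \<Rightarrow> real" where
  "LP_int M p f = (\<integral>x. norm (f x) powr p \<partial>M)"

lemma LP_int_nonneg: "LP_int M p f \<ge> 0"
  unfolding LP_int_def by simp

lemma LP_measurable: "f \<in> LP M p \<Longrightarrow> f \<in> borel_measurable M"
  and LP_integrable: "f \<in> LP M p \<Longrightarrow> integrable M (\<lambda>x. norm (f x) powr p)"
  by (auto simp: LP_def)

lemma LP_scaleR: "f \<in> LP M p \<Longrightarrow> (\<lambda>x. c *\<^sub>R f x) \<in> LP M p"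
  and LP_int_scaleR: "LP_int M p (\<lambda>x. c *\<^sub>R f x) = \<bar>c\<bar> powr p * LP_int M p f"
  by (auto simp: LP_def LP_int_def powr_mult)

lemma LP_add:
  assumes "p \<ge> 0" "f \<in> LP M p" "g \<in> LP M p"
  shows "(\<lambda>x. f x + g x) \<in> LP M p"
    and "LP_int M p (\<lambda>x. f x + g x) \<le> 2 powr p * (LP_int M p f + LP_int M p g)"
proof -
  note [measurable] = LP_measurable[OF assms(2)] LP_measurable[OF assms(3)]
  have int: "integrable M (\<lambda>x. 2 powr p * (norm (f x) powr p + norm (g x) powr p))"
    using assms by (auto simp: LP_def)
  have sum: "integrable M (\<lambda>x. norm (f x + g x) powr p)"
    by (rule Bochner_Integration.integrable_bound[OF int])
      (use norm_add_powr_le[OF assms(1)] in \<open>auto intro!: AE_I2 simp: abs_mult\<close>)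
  then show "(\<lambda>x. f x + g x) \<in> LP M p" by (simp add: LP_def)
  have "LP_int M p (\<lambda>x. f x + g x) \<le> (\<integral>x. 2 powr p * (norm (f x) powr p + norm (g x) powr p) \<partial>M)"
    unfolding LP_int_def by (rule integral_mono[OF sum int]) (rule norm_add_powr_le[OF assms(1)])
  also have "\<dots> = 2 powr p * (LP_int M p f + LP_int M p g)"
    unfolding LP_int_def using assms by (simp add: LP_def)
  finally show "LP_int M p (\<lambda>x. f x + g x) \<le> 2 powr p * (LP_int M p f + LP_int M p g)" .
qed

lemma LP_int_minus_commute: "LP_int M p (\<lambda>x. f x - g x) = LP_int M p (\<lambda>x. g x - f x)"
  by (simp add: LP_int_def norm_minus_commute)

lemma LP_diff:
  assumes "p \<ge> 0" "f \<in> LP M p" "g \<in> LP M p"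
  shows "(\<lambda>x. f x - g x) \<in> LP M p"
    and "LP_int M p (\<lambda>x. f x - g x) \<le> 2 powr p * (LP_int M p f + LP_int M p g)"
  using LP_add[OF assms(1,2) LP_scaleR[OF assms(3), of "-1"]] LP_int_scaleR[of M p "-1" g] by auto

lemma LP_triangle:
  assumes "p \<ge> 0" "f \<in> LP M p" "g \<in> LP M p" "h \<in> LP M p"
  shows "LP_int M p (\<lambda>x. f x - h x) \<le> 2 powr p * (LP_int M p (\<lambda>x. f x - g x) + LP_int M p (\<lambda>x. g x - h x))"
  using LP_add(2)[OF assms(1) LP_diff(1)[OF assms(1,2,3)] LP_diff(1)[OF assms(1,3,4)]] by simp

text \<open>Geometric smallness makes the sum of all \<open>norm (w k x) powr p\<close> integrable.
  That sum dominates each term, and where it is finite the terms tend to \<open>0\<close>.\<close>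

lemma LP_fast_null:
  fixes w :: "nat \<Rightarrow> 'x \<Rightarrow> 'b::euclidean_space"
  assumes p: "p > 0" and w: "\<And>k. w k \<in> LP M p" and small: "\<And>k. LP_int M p (w k) \<le> (1/2) ^ k"
  obtains W where "integrable M W" "AE x in M. \<forall>k. norm (w k x) powr p \<le> W x"
    "AE x in M. (\<lambda>k. w k x) \<longlonglongrightarrow> 0"
proof -
  note [measurable] = LP_measurable[OF w]
  define S where "S x = (\<Sum>k. ennreal (norm (w k x) powr p))" for x
  have S_meas[measurable]: "S \<in> borel_measurable M" unfolding S_def by measurable
  have "(\<integral>\<^sup>+x. S x \<partial>M) = (\<Sum>k. \<integral>\<^sup>+x. ennreal (norm (w k x) powr p) \<partial>M)"
    unfolding S_def by (rule nn_integral_suminf) auto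
  also have "\<dots> = (\<Sum>k. ennreal (LP_int M p (w k)))"
    unfolding LP_int_def by (subst nn_integral_eq_integral[OF LP_integrable[OF w]]) auto
  also have "\<dots> \<le> (\<Sum>k. ennreal ((1/2) ^ k))"
    by (intro suminf_le ennreal_leI small) auto
  also have "\<dots> < \<infinity>"
    by (subst suminf_ennreal2) (auto simp: summable_geometric)
  finally have fin: "(\<integral>\<^sup>+x. S x \<partial>M) < \<infinity>" .
  then have AE: "AE x in M. S x \<noteq> \<infinity>" by (intro nn_integral_PInf_AE) auto
  show ?thesis
  proof
    show "integrable M (\<lambda>x. enn2real (S x))"
    proof (rule integrableI_bounded)
      have "(\<integral>\<^sup>+ x. ennreal (norm (enn2real (S x))) \<partial>M) \<le> (\<integral>\<^sup>+x. S x \<partial>M)"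
        by (intro nn_integral_mono) (simp add: ennreal_enn2real_if)
      then show "(\<integral>\<^sup>+ x. ennreal (norm (enn2real (S x))) \<partial>M) < \<infinity>" using fin by simp
    qed measurable
    have *: "(\<forall>k. norm (w k x) powr p \<le> enn2real (S x)) \<and> (\<lambda>k. w k x) \<longlonglongrightarrow> 0" if "S x \<noteq> \<infinity>" for x
    proof -
      have sm: "summable (\<lambda>k. norm (w k x) powr p)"
        using that by (intro summable_suminf_not_top) (auto simp: S_def)
      have S: "S x = ennreal (\<Sum>k. norm (w k x) powr p)"
        unfolding S_def using that by (intro suminf_ennreal) (auto simp: S_def)
      have "norm (w k x) powr p \<le> (\<Sum>k. norm (w k x) powr p)" for k
        using sum_le_suminf[OF sm, of "{k}"] by simp
      then have 1: "\<forall>k. norm (w k x) powr p \<le> enn2real (S x)"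
        unfolding S by (simp add: suminf_nonneg[OF sm])
      have "(\<lambda>k. (norm (w k x) powr p) powr (1 / p)) \<longlonglongrightarrow> 0 powr (1 / p)"
        using p by (intro tendsto_powr' summable_LIMSEQ_zero[OF sm] tendsto_const) auto
      then have "(\<lambda>k. norm (w k x)) \<longlonglongrightarrow> 0" using p by (simp add: powr_powr)
      then show ?thesis using 1 tendsto_norm_zero_iff by blast
    qed
    show "AE x in M. \<forall>k. norm (w k x) powr p \<le> enn2real (S x)"
      "AE x in M. (\<lambda>k. w k x) \<longlonglongrightarrow> 0"
      using AE by (eventually_elim; use * in blast)+
  qed
qed

lemma exists_fast_subseq:
  fixes a :: "nat \<Rightarrow> real"
  assumes "a \<longlonglongrightarrow> 0" "\<And>k. e k > (0::real)"
  obtains r :: "nat \<Rightarrow> nat" where "strict_mono r" "\<And>k n. n \<ge> r k \<Longrightarrow> a n \<le> e k"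
proof -
  have "\<exists>N. \<forall>n\<ge>N. a n \<le> e k" for k
    using order_tendstoD(2)[OF assms(1) assms(2)[of k]] by (auto simp: eventually_sequentially intro: less_imp_le)
  then obtain N where N: "\<And>k n. n \<ge> N k \<Longrightarrow> a n \<le> e k" by metis
  \<comment> \<open>The partial sums make \<open>r k\<close> at least \<open>N k\<close> and
    nondecreasing; the added \<open>k\<close> makes it strictly increasing.\<close>
  define r where "r k = (\<Sum>j\<le>k. N j) + k" for k
  have "strict_mono r" unfolding strict_mono_Suc_iff r_def by simp
  moreover have "N k \<le> r k" for k
    unfolding r_def by (rule trans_le_add1) (rule member_le_sum, auto)
  ultimately show ?thesis using N that by (meson le_trans)
qed

lemma LP_null_subseq:
  fixes w :: "nat \<Rightarrow> 'x \<Rightarrow> 'b::euclidean_space"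
  assumes p: "p > 0" and w: "\<And>k. w k \<in> LP M p" and lim: "(\<lambda>k. LP_int M p (w k)) \<longlonglongrightarrow> 0"
  obtains r W where "strict_mono (r :: nat \<Rightarrow> nat)" "integrable M W"
    "AE x in M. \<forall>k. norm (w (r k) x) powr p \<le> W x" "AE x in M. (\<lambda>k. w (r k) x) \<longlonglongrightarrow> 0"
proof -
  obtain r :: "nat \<Rightarrow> nat" where r: "strict_mono r" "\<And>k n. n \<ge> r k \<Longrightarrow> LP_int M p (w n) \<le> (1/2) ^ k"
    using exists_fast_subseq[OF lim, of "\<lambda>k. (1/2) ^ k"] by auto
  obtain W where "integrable M W" "AE x in M. \<forall>k. norm (w (r k) x) powr p \<le> W x" "AE x in M. (\<lambda>k. w (r k) x) \<longlonglongrightarrow> 0"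
    using LP_fast_null[of p "\<lambda>k. w (r k)" M] p w r(2) by auto
  with r(1) show ?thesis using that by blast
qed

lemma LP_complete:
  fixes f :: "nat \<Rightarrow> 'x \<Rightarrow> 'b::euclidean_space"
  assumes p: "p > 0" and f: "\<And>k. f k \<in> LP M p"
    and Cauchy: "\<And>e. e > 0 \<Longrightarrow> \<exists>N. \<forall>m\<ge>N. \<forall>n\<ge>N. LP_int M p (\<lambda>x. f m x - f n x) < e"
  obtains g where "g \<in> LP M p" "(\<lambda>n. LP_int M p (\<lambda>x. f n x - g x)) \<longlonglongrightarrow> 0"
proof -
  note [measurable] = LP_measurable[OF f]
  \<comment> \<open>The divisor \<open>(2 ^ k) powr p\<close> pays for the factor
    \<open>2 ^ k\<close> in \<open>w\<close> below. The rescaled increments still tend to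
    \<open>0\<close> almost everywhere, so the increments themselves lie under a geometric
    series.\<close>
  define e :: "nat \<Rightarrow> real" where "e k = (1/2) ^ k / (2 ^ k) powr p" for k
  have e: "e k > 0" for k by (simp add: e_def)
  have "\<forall>k. \<exists>N. \<forall>m\<ge>N. \<forall>n\<ge>N. LP_int M p (\<lambda>x. f m x - f n x) < e k" using Cauchy[OF e] by blast
  then obtain N where N: "\<And>k m n. m \<ge> N k \<Longrightarrow> n \<ge> N k \<Longrightarrow> LP_int M p (\<lambda>x. f m x - f n x) < e k" by metis
  define r where "r k = (\<Sum>j\<le>k. N j) + k" for k
  have r: "strict_mono r" unfolding strict_mono_Suc_iff r_def by simp
  have "N k \<le> r k" for k
    unfolding r_def by (rule trans_le_add1) (rule member_le_sum, auto)
  moreover have "r k \<le> r (Suc k)" for k using r by (simp add: strict_mono_Suc_iff less_imp_le)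
  ultimately have step: "LP_int M p (\<lambda>x. f (r (Suc k)) x - f (r k) x) < e k" for k
    by (intro N) (meson order_trans)+
  define w where "w k x = 2 ^ k *\<^sub>R (f (r (Suc k)) x - f (r k) x)" for k x
  have w: "w k \<in> LP M p" for k
    unfolding w_def using p f by (intro LP_scaleR LP_diff) auto
  have "LP_int M p (w k) \<le> (1/2) ^ k" for k
    unfolding w_def LP_int_scaleR using step[of k] by (simp add: e_def field_simps)
  from LP_fast_null[OF p w this] obtain W where "AE x in M. (\<lambda>k. w k x) \<longlonglongrightarrow> 0" by blast
  then have conv: "AE x in M. convergent (\<lambda>k. f (r k) x)"
  proof eventually_elim
    case (elim x)
    then obtain C where C: "\<And>k. norm (w k x) \<le> C"
      by (metis convergentI convergent_imp_Bseq Bseq_def)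
    have "norm (f (r (Suc k)) x - f (r k) x) \<le> C * (1/2) ^ k" for k
      using C[of k] unfolding w_def norm_scaleR by (simp add: field_simps)
    then have "summable (\<lambda>k. f (r (Suc k)) x - f (r k) x)"
      by (intro summable_comparison_test'[OF summable_mult[OF summable_geometric[of "1/2"]]]) auto
    then have "convergent (\<lambda>n. (\<Sum>k<n. f (r (Suc k)) x - f (r k) x) + f (r 0) x)"
      by (intro convergent_add convergent_const) (simp add: summable_iff_convergent)
    then show ?case using sum_lessThan_telescope[of "\<lambda>k. f (r k) x"] by simp
  qed
  define g where "g x = lim (\<lambda>k. f (r k) x)" for x
  have [measurable]: "g \<in> borel_measurable M" unfolding g_def by measurable
  have lim: "AE x in M. (\<lambda>k. f (r k) x) \<longlonglongrightarrow> g x"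
    using conv by eventually_elim (simp add: g_def convergent_LIMSEQ_iff)
  \<comment> \<open>Fatou's lemma lets the second index go to infinity in the Cauchy estimate, which
    bounds the distance to the pointwise limit \<open>g\<close>.\<close>
  have Fatou: "(\<integral>\<^sup>+x. ennreal (norm (f n x - g x) powr p) \<partial>M) \<le> ennreal c"
    if c: "\<And>m. m \<ge> n \<Longrightarrow> LP_int M p (\<lambda>x. f n x - f m x) \<le> c" for n c
  proof -
    have "(\<integral>\<^sup>+x. ennreal (norm (f n x - g x) powr p) \<partial>M)
        = (\<integral>\<^sup>+x. liminf (\<lambda>k. ennreal (norm (f n x - f (r k) x) powr p)) \<partial>M)"
    proof (rule nn_integral_cong_AE, use lim in eventually_elim)
      case (elim x)
      have "(\<lambda>k. ennreal (norm (f n x - f (r k) x) powr p)) \<longlonglongrightarrow> ennreal (norm (f n x - g x) powr p)"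
        using p by (intro tendsto_ennrealI tendsto_powr' tendsto_norm tendsto_diff tendsto_const elim) auto
      then show ?case using lim_imp_Liminf[OF sequentially_bot] by metis
    qed
    also have "\<dots> \<le> liminf (\<lambda>k. \<integral>\<^sup>+x. ennreal (norm (f n x - f (r k) x) powr p) \<partial>M)"
      by (rule nn_integral_liminf) measurable
    also have "\<dots> = liminf (\<lambda>k. ennreal (LP_int M p (\<lambda>x. f n x - f (r k) x)))"
      unfolding LP_int_def using p f
      by (subst nn_integral_eq_integral) (auto intro!: LP_integrable[of "\<lambda>x. f _ x - f _ x"] LP_diff)
    also have "\<dots> \<le> limsup (\<lambda>k. ennreal (LP_int M p (\<lambda>x. f n x - f (r k) x)))"
      by (rule Liminf_le_Limsup) simp
    also have "\<dots> \<le> ennreal c"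
    proof (rule Limsup_bounded)
      show "\<forall>\<^sub>F k in sequentially. ennreal (LP_int M p (\<lambda>x. f n x - f (r k) x)) \<le> ennreal c"
        unfolding eventually_sequentially
        by (rule exI[of _ n]) (auto intro!: ennreal_leI c order_trans[OF _ strict_mono_imp_increasing[OF r]])
    qed
    finally show ?thesis .
  qed
  have small: "\<exists>N. \<forall>n\<ge>N. (\<lambda>x. f n x - g x) \<in> LP M p \<and> LP_int M p (\<lambda>x. f n x - g x) \<le> c" if c: "c > 0" for c
  proof -
    obtain N where N: "\<And>m n. m \<ge> N \<Longrightarrow> n \<ge> N \<Longrightarrow> LP_int M p (\<lambda>x. f m x - f n x) < c" using Cauchy[OF c] by blast
    show ?thesis
    proof (intro exI[of _ N] allI impI)
      fix n assume n: "n \<ge> N"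
      have nn: "(\<integral>\<^sup>+x. ennreal (norm (f n x - g x) powr p) \<partial>M) \<le> ennreal c"
        using N n by (intro Fatou) (auto intro: less_imp_le)
      then have int: "integrable M (\<lambda>x. norm (f n x - g x) powr p)"
        by (intro integrableI_bounded) (auto simp: le_less_trans)
      show "(\<lambda>x. f n x - g x) \<in> LP M p \<and> LP_int M p (\<lambda>x. f n x - g x) \<le> c"
        using int nn c nn_integral_eq_integral[OF int] by (simp add: LP_def LP_int_def)
    qed
  qed
  obtain n where "(\<lambda>x. f n x - g x) \<in> LP M p" using small[of 1] by auto
  then have "g \<in> LP M p" using LP_diff(1)[OF _ f[of n], of "\<lambda>x. f n x - g x"] p by simp
  moreover have "(\<lambda>n. LP_int M p (\<lambda>x. f n x - g x)) \<longlonglongrightarrow> 0"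
  proof (rule LIMSEQ_I)
    fix c :: real assume "c > 0"
    then obtain N where "\<forall>n\<ge>N. LP_int M p (\<lambda>x. f n x - g x) \<le> c / 2" using small[of "c / 2"] by auto
    then show "\<exists>N. \<forall>n\<ge>N. norm (LP_int M p (\<lambda>x. f n x - g x) - 0) < c"
      using \<open>c > 0\<close> by (intro exI[of _ N]) (auto simp: abs_of_nonneg[OF LP_int_nonneg] intro: le_less_trans[of _ "c / 2"])
  qed
  ultimately show ?thesis using that by blast
qed

text \<open>Along a subsequence the differences have an integrable majorant, so dominated
  convergence applies to a continuous \<Phi> of growth \<open>p\<close>; the finite measure pays for
  the constant in the growth bound. The limit is the same for all subsequences.\<close>

lemma (in finite_measure) LP_Nemytskii:
  fixes f :: "nat \<Rightarrow> 'a \<Rightarrow> 'b::euclidean_space"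
  assumes p: "p > 0" and f: "\<And>k. f k \<in> LP M p" and g: "g \<in> LP M p"
    and lim: "(\<lambda>k. LP_int M p (\<lambda>x. f k x - g x)) \<longlonglongrightarrow> 0"
    and cont: "continuous_on UNIV (\<Phi> :: 'b \<Rightarrow> real)" and growth: "\<And>y. \<bar>\<Phi> y\<bar> \<le> C * (1 + norm y powr p)"
  shows "(\<lambda>k. \<integral>x. \<Phi> (f k x) \<partial>M) \<longlonglongrightarrow> (\<integral>x. \<Phi> (g x) \<partial>M)"
proof (rule tendsto_if_subseq_tendsto)
  fix r :: "nat \<Rightarrow> nat" assume r: "strict_mono r"
  have [measurable]: "\<Phi> \<in> borel_measurable borel" by (rule borel_measurable_continuous_onI[OF cont])
  note [measurable] = LP_measurable[OF f] LP_measurable[OF g]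
  have diff: "(\<lambda>x. f (r k) x - g x) \<in> LP M p" for k using p f g by (intro LP_diff) auto
  have C: "C \<ge> 0" using growth[of 0] by simp
  have limr: "(\<lambda>k. LP_int M p (\<lambda>x. f (r k) x - g x)) \<longlonglongrightarrow> 0"
    using LIMSEQ_subseq_LIMSEQ[OF lim r] by (simp add: o_def)
  obtain r' W where r': "strict_mono (r' :: nat \<Rightarrow> nat)" and W: "integrable M W"
    and dom: "AE x in M. \<forall>k. norm (f (r (r' k)) x - g x) powr p \<le> W x"
    and pt: "AE x in M. (\<lambda>k. f (r (r' k)) x - g x) \<longlonglongrightarrow> 0"
    by (rule LP_null_subseq[OF p diff limr])
  have "(\<lambda>k. \<integral>x. \<Phi> (f (r (r' k)) x) \<partial>M) \<longlonglongrightarrow> (\<integral>x. \<Phi> (g x) \<partial>M)"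
  proof (rule integral_dominated_convergence)
    show "integrable M (\<lambda>x. C * (1 + 2 powr p * (norm (g x) powr p + W x)))"
      using W LP_integrable[OF g] by auto
    show "AE x in M. (\<lambda>k. \<Phi> (f (r (r' k)) x)) \<longlonglongrightarrow> \<Phi> (g x)"
      using pt
    proof eventually_elim
      case (elim x)
      then have "(\<lambda>k. f (r (r' k)) x) \<longlonglongrightarrow> g x" by (simp add: LIM_zero_iff)
      then show ?case using continuous_on_tendsto_compose[OF cont] by simp
    qed
    show "AE x in M. norm (\<Phi> (f (r (r' k)) x)) \<le> C * (1 + 2 powr p * (norm (g x) powr p + W x))" for k
      using dom
    proof eventually_elim
      case (elim x)
      have "norm (f (r (r' k)) x) powr p \<le> 2 powr p * (norm (g x) powr p + norm (f (r (r' k)) x - g x) powr p)"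
        using norm_add_powr_le[of p "g x" "f (r (r' k)) x - g x"] p by simp
      also have "\<dots> \<le> 2 powr p * (norm (g x) powr p + W x)" using elim by (intro mult_left_mono) auto
      finally have "norm (f (r (r' k)) x) powr p \<le> 2 powr p * (norm (g x) powr p + W x)" .
      then have "C * (1 + norm (f (r (r' k)) x) powr p) \<le> C * (1 + 2 powr p * (norm (g x) powr p + W x))"
        using C by (intro mult_left_mono) auto
      then show ?case using growth[of "f (r (r' k)) x"] by simp
    qed
  qed measurable
  then show "\<exists>r'. strict_mono r' \<and> (\<lambda>n. \<integral>x. \<Phi> (f (r (r' n)) x) \<partial>M) \<longlonglongrightarrow> (\<integral>x. \<Phi> (g x) \<partial>M)"
    using r' by blast
qed

lemma (in finite_measure) LP_growth_integrable:
  fixes g :: "'a \<Rightarrow> 'b::euclidean_space"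
  assumes g: "g \<in> LP M p" and cont: "continuous_on UNIV (\<Phi> :: 'b \<Rightarrow> real)"
    and growth: "\<And>y. \<bar>\<Phi> y\<bar> \<le> C * (1 + norm y powr p)"
  shows "integrable M (\<lambda>x. \<Phi> (g x))"
proof (rule Bochner_Integration.integrable_bound)
  have [measurable]: "\<Phi> \<in> borel_measurable borel" by (rule borel_measurable_continuous_onI[OF cont])
  note [measurable] = LP_measurable[OF g]
  show "integrable M (\<lambda>x. C * (1 + norm (g x) powr p))" using LP_integrable[OF g] by auto
  show "(\<lambda>x. \<Phi> (g x)) \<in> borel_measurable M" by measurable
  show "AE x in M. norm (\<Phi> (g x)) \<le> norm (C * (1 + norm (g x) powr p))"
    by (intro AE_I2) (use growth in \<open>simp add: order_trans[OF _ abs_ge_self]\<close>)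
qed

section \<open>Smaller exponents on a finite measure space\<close>

lemma powr_le_1_plus: "r \<le> s \<Longrightarrow> 0 \<le> r \<Longrightarrow> 0 \<le> (t::real) \<Longrightarrow> t powr r \<le> 1 + t powr s"
proof (cases "t \<le> 1")
  case True
  assume "0 \<le> r" "0 \<le> t"
  then have "t powr r \<le> 1" using True by (intro powr_le1) auto
  then show ?thesis by (simp add: add_increasing2)
next
  case False
  assume "r \<le> s"
  then have "t powr r \<le> t powr s" using False by (intro powr_mono) auto
  then show ?thesis by linarith
qed

lemma continuous_norm_powr: "p > 0 \<Longrightarrow> continuous_on UNIV (\<lambda>y::'b::real_normed_vector. norm y powr p)"
  by (intro continuous_on_powr' continuous_intros) auto

lemma (in finite_measure) LP_mono:
  fixes g :: "'a \<Rightarrow> 'b::euclidean_space"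
  assumes "0 < r" "r \<le> s" "g \<in> LP M s"
  shows "g \<in> LP M r"
proof -
  have "\<bar>norm y powr r\<bar> \<le> 1 * (1 + norm y powr s)" for y :: 'b
    using powr_le_1_plus[of r s "norm y"] assms by simp
  from LP_growth_integrable[OF assms(3) continuous_norm_powr[OF assms(1)] this] LP_measurable[OF assms(3)]
  show ?thesis by (simp add: LP_def)
qed

text \<open>The differences tend to \<open>0\<close> in the exponent \<open>s\<close>, and
  \<open>norm y powr r\<close> has growth \<open>s\<close>. Nemytskii continuity at the zero
  function takes the place of Hoelder's inequality.\<close>

lemma (in finite_measure) LP_lim_mono:
  fixes f :: "nat \<Rightarrow> 'a \<Rightarrow> 'b::euclidean_space"
  assumes rs: "0 < r" "r \<le> s" and f: "\<And>k. f k \<in> LP M s" and g: "g \<in> LP M s"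
    and lim: "(\<lambda>k. LP_int M s (\<lambda>x. f k x - g x)) \<longlonglongrightarrow> 0"
  shows "(\<lambda>k. LP_int M r (\<lambda>x. f k x - g x)) \<longlonglongrightarrow> 0"
proof -
  have s: "s > 0" using rs by simp
  have d: "(\<lambda>x. f k x - g x) \<in> LP M s" for k using s f g by (intro LP_diff) auto
  have z: "(\<lambda>x. 0) \<in> LP M s" by (simp add: LP_def)
  have g1: "\<bar>norm y powr r\<bar> \<le> 1 * (1 + norm y powr s)" for y :: 'b
    using powr_le_1_plus[of r s "norm y"] rs by simp
  have "(\<lambda>k. \<integral>x. norm (f k x - g x) powr r \<partial>M) \<longlonglongrightarrow> (\<integral>x. norm (0::'b) powr r \<partial>M)"
    using LP_Nemytskii[OF s d z _ continuous_norm_powr[OF rs(1)] g1] lim by simp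
  then show ?thesis by (simp add: LP_int_def)
qed

lemma (in finite_measure) LP_int_tendsto:
  assumes "p > 0" "\<And>k. f k \<in> LP M p" "g \<in> LP M p" "(\<lambda>k. LP_int M p (\<lambda>x. f k x - g x)) \<longlonglongrightarrow> 0"
  shows "(\<lambda>k. LP_int M p (f k)) \<longlonglongrightarrow> LP_int M p g"
  using LP_Nemytskii[OF assms continuous_norm_powr[OF assms(1)], of 1] by (simp add: LP_int_def)

section \<open>Averages of compactly supported functions\<close>

text \<open>The tangent inequality at the mean \<open>m\<close> is integrated; its linear term has
  integral \<open>0\<close> on a probability space.\<close>

lemma (in finite_measure) Jensen_powr:
  fixes f :: "'a \<Rightarrow> real"
  assumes mass: "measure M (space M) = 1" and s: "s \<ge> 1" and f: "\<And>x. f x \<ge> 0"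
    and int: "integrable M f" "integrable M (\<lambda>x. f x powr s)"
  shows "(\<integral>x. f x \<partial>M) powr s \<le> (\<integral>x. f x powr s \<partial>M)"
proof -
  define m where "m = (\<integral>x. f x \<partial>M)"
  have m: "m \<ge> 0" unfolding m_def using f by simp
  have "(\<integral>x. m powr s + s * m powr (s - 1) * (f x - m) \<partial>M) \<le> (\<integral>x. f x powr s \<partial>M)"
    using int by (intro integral_mono powr_tangent_le s f m) auto
  also have "(\<integral>x. m powr s + s * m powr (s - 1) * (f x - m) \<partial>M) = m powr s"
    using int mass by (simp add: m_def)
  finally show ?thesis unfolding m_def .
qed

text \<open>Lebesgue measure on the unit interval, kept as a probability measure on all reals so
  that measurability refers to the plain Borel sets in every use of Fubini and Jensen.\<close>

definition unit_interval_measure :: "real measure" where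
  "unit_interval_measure = density lborel (\<lambda>t. ennreal (indicator {0..1} t))"

lemma sets_unit_interval_measure[simp, measurable_cong]: "sets unit_interval_measure = sets borel"
  and space_unit_interval_measure[simp]: "space unit_interval_measure = UNIV"
  by (auto simp: unit_interval_measure_def)

lemma emeasure_unit_interval: "emeasure unit_interval_measure UNIV = 1"
proof -
  have "emeasure unit_interval_measure UNIV = (\<integral>\<^sup>+t. indicator {0..1::real} t \<partial>lborel)"
    unfolding unit_interval_measure_def by (subst emeasure_density) (auto simp: ennreal_indicator)
  then show ?thesis by (subst (asm) nn_integral_indicator) auto
qed

interpretation unit_interval: finite_measure unit_interval_measure
  by (rule finite_measureI) (simp add: emeasure_unit_interval)

lemma measure_unit_interval: "measure unit_interval_measure UNIV = 1"
  by (simp add: measure_def emeasure_unit_interval)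

text \<open>The point \<open>0\<close> has to be left out because powers of \<open>t\<close> are
  inverted in \<open>W_pointwise\<close>.\<close>

lemma AE_unit_interval: "AE t in unit_interval_measure. 0 < t \<and> t \<le> 1"
proof -
  have "AE t in lborel. t \<noteq> (0::real)" by (rule AE_lborel_singleton)
  then show ?thesis
    unfolding unit_interval_measure_def
    by (subst AE_density) (auto simp: indicator_def split: if_splits elim!: eventually_mono)
qed

lemma integral_unit_interval:
  "f \<in> borel_measurable borel \<Longrightarrow> (\<integral>t. f t \<partial>unit_interval_measure) = (\<integral>t. indicator {0..1} t *\<^sub>R (f t :: real) \<partial>lborel)"
  unfolding unit_interval_measure_def by (subst integral_density) auto

section \<open>Translations and dilations of Lebesgue integrals, and differences along paths\<close>

lemma nn_integral_lborel_translate: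
  fixes f :: "'a::euclidean_space \<Rightarrow> ennreal"
  assumes [measurable]: "f \<in> borel_measurable borel"
  shows "(\<integral>\<^sup>+x. f (x + v) \<partial>lborel) = (\<integral>\<^sup>+x. f x \<partial>lborel)"
proof -
  have "(\<integral>\<^sup>+x. f x \<partial>lborel) = (\<integral>\<^sup>+x. f x \<partial>distr lborel borel ((+) v))" by (simp add: lborel_distr_plus)
  also have "\<dots> = (\<integral>\<^sup>+x. f (x + v) \<partial>lborel)" by (subst nn_integral_distr) (auto simp: add.commute)
  finally show ?thesis by simp
qed

lemma nn_integral_lborel_affine:
  fixes f :: "'a::euclidean_space \<Rightarrow> ennreal"
  assumes [measurable]: "f \<in> borel_measurable borel" and c: "c > 0"
  shows "(\<integral>\<^sup>+z. f (x + c *\<^sub>R z) \<partial>lborel) = ennreal (inverse (c ^ DIM('a))) * (\<integral>\<^sup>+x. f x \<partial>lborel)"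
proof -
  have "(\<integral>\<^sup>+x. f x \<partial>lborel) = (\<integral>\<^sup>+z. f z \<partial>density (distr lborel borel (\<lambda>z. x + c *\<^sub>R z)) (\<lambda>_. \<bar>c\<bar> ^ DIM('a)))"
    using lborel_affine[of c x] c by simp
  also have "\<dots> = (\<integral>\<^sup>+z. ennreal (c ^ DIM('a)) * f (x + c *\<^sub>R z) \<partial>lborel)"
    using c by (subst nn_integral_density) (auto simp: nn_integral_distr ennreal_power)
  also have "\<dots> = ennreal (c ^ DIM('a)) * (\<integral>\<^sup>+z. f (x + c *\<^sub>R z) \<partial>lborel)"
    by (rule nn_integral_cmult) measurable
  finally have "ennreal (inverse (c ^ DIM('a))) * (\<integral>\<^sup>+x. f x \<partial>lborel) =
      (ennreal (inverse (c ^ DIM('a))) * ennreal (c ^ DIM('a))) * (\<integral>\<^sup>+z. f (x + c *\<^sub>R z) \<partial>lborel)"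
    by (simp add: mult.assoc)
  also have "ennreal (inverse (c ^ DIM('a))) * ennreal (c ^ DIM('a)) = 1"
    using c by (simp flip: ennreal_mult' add: ennreal_1)
  finally show ?thesis by simp
qed

text \<open>Test functions are instances with \<open>D\<close> the gradient. The locale also admits
  the product of two test functions, with \<open>D\<close> from the product rule, which serves
  integration by parts.\<close>

locale C1_compact_support =
  fixes \<phi> :: "'a::euclidean_space \<Rightarrow> real" and D :: "'a \<Rightarrow> 'a" and K :: "'a set"
  assumes der: "(\<phi> has_derivative (\<lambda>h. D x \<bullet> h)) (at x)"
    and cont_D: "continuous_on UNIV D"
    and compact_K: "compact K"
    and zero_outside: "x \<notin> K \<Longrightarrow> \<phi> x = 0" "x \<notin> K \<Longrightarrow> D x = 0"
begin

lemma cont_\<phi>: "continuous_on UNIV \<phi>"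
  using der has_derivative_continuous continuous_at_imp_continuous_on by blast

lemma borel_\<phi>[measurable]: "\<phi> \<in> borel_measurable borel"
  and borel_D[measurable]: "D \<in> borel_measurable borel"
  by (rule borel_measurable_continuous_onI; rule cont_\<phi> cont_D)+

lemma integrable_if_vanishing:
  fixes g :: "'a \<Rightarrow> 'b::euclidean_space"
  assumes "continuous_on UNIV g" "\<And>x. x \<notin> K \<Longrightarrow> g x = 0"
  shows "integrable lborel g"
proof -
  have "integrable lborel (\<lambda>x. indicator K x *\<^sub>R g x)"
    using compact_K continuous_on_subset[OF assms(1)] by (intro borel_integrable_compact) auto
  moreover have "(\<lambda>x. indicator K x *\<^sub>R g x) = g" using assms(2) by (auto simp: indicator_def)
  ultimately show ?thesis by simp
qed

lemma D_bounded: "\<exists>C\<ge>0. \<forall>x. norm (D x) \<le> C"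
  using continuous_vanishing_bounded[OF compact_K cont_D zero_outside(2)] by blast

definition E :: "real \<Rightarrow> real" where "E p = (\<integral>x. norm (D x) powr p \<partial>lborel)"

lemma E_nonneg: "E p \<ge> 0" unfolding E_def by simp

lemma nn_integral_D_powr:
  assumes "p > 0"
  shows "(\<integral>\<^sup>+x. ennreal (norm (D x) powr p) \<partial>lborel) = ennreal (E p)"
proof -
  have "continuous_on UNIV (\<lambda>x. norm (D x) powr p)"
    using assms by (intro continuous_on_powr' continuous_intros cont_D) auto
  then have "integrable lborel (\<lambda>x. norm (D x) powr p)"
    by (rule integrable_if_vanishing) (simp add: zero_outside)
  then show ?thesis unfolding E_def by (intro nn_integral_eq_integral) auto
qed

text \<open>The path follows \<open>t\<^sup>m v\<close> instead of \<open>t v\<close>: spreading an average over a set shrunk by \<open>t\<^sup>m\<close> costs a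
  negative power of \<open>t\<close>, which for subcritical exponents the speed \<open>m t\<^sup>m\<^sup>-\<^sup>1\<close> absorbs if \<open>m\<close> is large.\<close>

lemma path_difference_le:
  assumes m: "m \<ge> (1::nat)"
  shows "\<bar>\<phi> (x + v) - \<phi> x\<bar> \<le> (\<integral>t. real m * t ^ (m - 1) * (norm v * norm (D (x + t ^ m *\<^sub>R v))) \<partial>unit_interval_measure)"
proof -
  let ?d = "\<lambda>t::real. D (x + t ^ m *\<^sub>R v) \<bullet> ((real m * t ^ (m - 1)) *\<^sub>R v)"
  have cont_d: "continuous_on A ?d" for A
    by (intro continuous_intros continuous_on_compose2[OF cont_D]) auto
  have vd: "((\<lambda>t. \<phi> (x + t ^ m *\<^sub>R v)) has_vector_derivative ?d t) (at t within {0..1})" for t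
  proof -
    have "((\<lambda>t. x + t ^ m *\<^sub>R v) has_derivative (\<lambda>h. h *\<^sub>R ((real m * t ^ (m - 1)) *\<^sub>R v))) (at t within {0..1})"
      by (auto intro!: derivative_eq_intros simp: algebra_simps)
    from has_derivative_compose[OF this der]
    show ?thesis by (simp add: has_vector_derivative_def mult.commute mult.left_commute)
  qed
  have FTC: "(\<integral>t. indicator {0..1} t *\<^sub>R ?d t \<partial>lborel) = \<phi> (x + 1 ^ m *\<^sub>R v) - \<phi> (x + 0 ^ m *\<^sub>R v)"
    by (rule integral_FTC_Icc[OF _ vd cont_d]) auto
  have meas: "?d \<in> borel_measurable borel" by (rule borel_measurable_continuous_onI[OF cont_d])
  have "\<phi> (x + v) - \<phi> x = (\<integral>t. ?d t \<partial>unit_interval_measure)"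
    using FTC m integral_unit_interval[OF meas] by (simp add: power_0_left)
  also have "\<bar>\<dots>\<bar> \<le> (\<integral>t. \<bar>?d t\<bar> \<partial>unit_interval_measure)"
    by (rule integral_abs_bound)
  also have "\<dots> \<le> (\<integral>t. real m * t ^ (m - 1) * (norm v * norm (D (x + t ^ m *\<^sub>R v))) \<partial>unit_interval_measure)"
  proof -
    obtain C where C: "C \<ge> 0" "\<And>x. norm (D x) \<le> C" using D_bounded by blast
    let ?b = "\<lambda>t. real m * t ^ (m - 1) * (norm v * norm (D (x + t ^ m *\<^sub>R v)))"
    have le: "AE t in unit_interval_measure. \<bar>?d t\<bar> \<le> ?b t"
      using AE_unit_interval
    proof eventually_elim
      case (elim t)
      have "\<bar>?d t\<bar> = real m * t ^ (m - 1) * \<bar>D (x + t ^ m *\<^sub>R v) \<bullet> v\<bar>"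
        using elim by (simp add: abs_mult)
      also have "\<dots> \<le> ?b t"
        using elim Cauchy_Schwarz_ineq2[of "D (x + t ^ m *\<^sub>R v)" v]
        by (intro mult_left_mono) (auto simp: mult.commute)
      finally show ?case .
    qed
    have mb: "?b \<in> borel_measurable unit_interval_measure" by measurable
    have "AE t in unit_interval_measure. norm (?b t) \<le> real m * (norm v * C)"
      using AE_unit_interval
    proof eventually_elim
      case (elim t)
      have "real m * t ^ (m - 1) * (norm v * norm (D (x + t ^ m *\<^sub>R v))) \<le> (real m * 1) * (norm v * C)"
        using elim C by (intro mult_mono mult_left_mono power_le_one) auto
      then show ?case using elim by (simp add: abs_mult)
    qed
    then have ib: "integrable unit_interval_measure ?b"
      by (rule unit_interval.integrable_const_bound) (rule mb)
    have "integrable unit_interval_measure (\<lambda>t. \<bar>?d t\<bar>)"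
      by (rule Bochner_Integration.integrable_bound[OF ib]) (use le meas in \<open>auto elim!: eventually_mono\<close>)
    then show ?thesis using ib le by (intro integral_mono_AE)
  qed
  finally show ?thesis .
qed

end

text \<open>\<open>P\<close> will be the uniform distribution on a ball, and \<open>c\<close> the inverse of its volume.\<close>

locale averaging_kernel = P: finite_measure P for P :: "'a::euclidean_space measure" +
  fixes c R :: real
  assumes sets_P[measurable_cong]: "sets P = sets borel"
    and mass: "measure P (space P) = 1"
    and c_nonneg: "c \<ge> 0" and R_nonneg: "R \<ge> 0"
    and dominated: "\<And>f. f \<in> borel_measurable borel \<Longrightarrow> (\<integral>\<^sup>+z. f z \<partial>P) \<le> ennreal c * (\<integral>\<^sup>+z. f z \<partial>lborel)"
    and radius: "AE z in P. norm z \<le> R"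

locale averaging = averaging_kernel P c R + C1_compact_support \<phi> D K
  for P :: "'a::euclidean_space measure" and c R :: real and \<phi> :: "'a \<Rightarrow> real" and D :: "'a \<Rightarrow> 'a" and K :: "'a set"
begin

lemma space_P[simp]: "space P = UNIV"
  using sets_eq_imp_space_eq[OF sets_P] by simp

abbreviation Q :: "real measure" where "Q \<equiv> unit_interval_measure"

sublocale PQ: pair_sigma_finite P Q ..

lemma finite_PQ: "finite_measure (P \<Otimes>\<^sub>M Q)"
  by (rule finite_measure_pair_measure) unfold_locales

lemma integrable_P_bounded:
  "g \<in> borel_measurable borel \<Longrightarrow> (\<And>z. \<bar>g z :: real\<bar> \<le> C) \<Longrightarrow> integrable P g"
  by (rule P.integrable_const_bound[where B=C]) (auto simp: measurable_cong_sets[OF sets_P refl])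

lemma \<phi>_bounded: "\<exists>C\<ge>0. \<forall>x. \<bar>\<phi> x\<bar> \<le> C"
  using continuous_vanishing_bounded[OF compact_K cont_\<phi> zero_outside(1)] unfolding real_norm_def by blast

lemma integrable_P_\<phi>: "integrable P (\<lambda>z. \<phi> (x + z))"
  using \<phi>_bounded by (auto intro!: integrable_P_bounded)

definition avg :: "'a \<Rightarrow> real" where "avg x = (\<integral>z. \<phi> (x + z) \<partial>P)"

lemma borel_avg[measurable]: "avg \<in> borel_measurable borel"
  unfolding avg_def by (rule P.borel_measurable_lebesgue_integral) measurable

text \<open>The average of \<open>norm D powr p\<close> over the kernel shrunk by
  \<open>t ^ m\<close> and moved to \<open>x\<close>. Exponent \<open>1\<close> is what the path
  estimate produces; exponent \<open>p\<close> enters by Jensen's inequality.\<close>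

definition W :: "real \<Rightarrow> nat \<Rightarrow> 'a \<Rightarrow> real \<Rightarrow> real" where
  "W p m x t = (\<integral>z. norm (D (x + t ^ m *\<^sub>R z)) powr p \<partial>P)"

lemma W_measurable[measurable]: "(\<lambda>(x, t). W p m x t) \<in> borel_measurable (borel \<Otimes>\<^sub>M borel)"
  unfolding W_def split_beta' by (rule P.borel_measurable_lebesgue_integral) measurable

lemma integrable_P_D_powr: "p \<ge> 0 \<Longrightarrow> integrable P (\<lambda>z. norm (D (x + t *\<^sub>R z)) powr p)"
proof -
  obtain C where C: "C \<ge> 0" "\<And>x. norm (D x) \<le> C" using D_bounded by blast
  assume "p \<ge> 0"
  then show ?thesis
    using C by (intro integrable_P_bounded[where C="C powr p"]) (auto intro!: powr_mono2)
qed

lemma W_nonneg: "W p m x t \<ge> 0"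
  unfolding W_def by simp

lemma W_bounded: "p \<ge> 0 \<Longrightarrow> \<exists>C\<ge>0. \<forall>m x t. W p m x t \<le> C"
proof -
  assume p: "p \<ge> 0"
  obtain C where C: "C \<ge> 0" "\<And>x. norm (D x) \<le> C" using D_bounded by blast
  have "W p m x t \<le> C powr p" for m x t
  proof -
    have "W p m x t \<le> (\<integral>z. C powr p \<partial>P)"
      unfolding W_def using p C by (intro integral_mono integrable_P_D_powr) (auto intro!: powr_mono2)
    then show ?thesis using mass by simp
  qed
  then show ?thesis by (intro exI[of _ "C powr p"]) auto
qed

text \<open>\<open>P\<close> is dominated by \<open>c\<close> times Lebesgue measure, and the
  substitution \<open>y = x + t ^ m *\<^sub>R z\<close> has the stated Jacobian. The bound is
  uniform in \<open>x\<close> but degenerates as \<open>t\<close> tends to \<open>0\<close>;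
  \<open>nn_integral_W\<close> is its counterpart after integration in \<open>x\<close>.\<close>

lemma W_pointwise:
  assumes p: "p \<ge> 1" and t: "t > 0"
  shows "W p m x t \<le> c * inverse ((t ^ m) ^ DIM('a)) * E p"
proof -
  have "ennreal (W p m x t) = (\<integral>\<^sup>+z. ennreal (norm (D (x + t ^ m *\<^sub>R z)) powr p) \<partial>P)"
    unfolding W_def using p by (intro nn_integral_eq_integral[symmetric] integrable_P_D_powr) auto
  also have "\<dots> \<le> ennreal c * (\<integral>\<^sup>+z. ennreal (norm (D (x + t ^ m *\<^sub>R z)) powr p) \<partial>lborel)"
    by (rule dominated) measurable
  also have "(\<integral>\<^sup>+z. ennreal (norm (D (x + t ^ m *\<^sub>R z)) powr p) \<partial>lborel) =
      ennreal (inverse ((t ^ m) ^ DIM('a))) * ennreal (E p)"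
    using nn_integral_lborel_affine[of "\<lambda>y. ennreal (norm (D y) powr p)" "t ^ m" x] t p
    by (simp add: nn_integral_D_powr)
  also have "ennreal c * (ennreal (inverse ((t ^ m) ^ DIM('a))) * ennreal (E p)) =
      ennreal (c * inverse ((t ^ m) ^ DIM('a)) * E p)"
    using c_nonneg t E_nonneg by (simp add: ennreal_mult mult.assoc)
  finally show ?thesis using c_nonneg t E_nonneg by (subst (asm) ennreal_le_iff) auto
qed

text \<open>The path estimate is averaged over \<open>z\<close>, with \<open>norm z\<close> replaced
  by the radius \<open>R\<close>. Fubini moves the average over \<open>z\<close> inside, where it
  becomes \<open>W\<close>.\<close>

lemma avg_diff_le:
  assumes m: "m \<ge> (1::nat)"
  shows "\<bar>\<phi> x - avg x\<bar> \<le> R * real m * (\<integral>t. t ^ (m - 1) * W 1 m x t \<partial>Q)"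
proof -
  obtain C where C: "C \<ge> 0" "\<And>x. norm (D x) \<le> C" using D_bounded by blast
  let ?h = "\<lambda>z t. real m * t ^ (m - 1) * (R * norm (D (x + t ^ m *\<^sub>R z)))"
  have fin_h: "integrable (P \<Otimes>\<^sub>M Q) (\<lambda>(z, t). ?h z t)"
  proof (rule finite_measure.integrable_const_bound[OF finite_PQ, where B="real m * (R * C)"])
    have "AE w in P \<Otimes>\<^sub>M Q. 0 < snd w \<and> snd w \<le> 1"
    proof (rule PQ.AE_pair_measure)
      show "{w \<in> space (P \<Otimes>\<^sub>M Q). 0 < snd w \<and> snd w \<le> 1} \<in> sets (P \<Otimes>\<^sub>M Q)" by measurable
      show "AE z in P. AE t in Q. 0 < snd (z, t) \<and> snd (z, t) \<le> 1"
        by (rule AE_I2) (use AE_unit_interval in simp)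
    qed
    then show "AE w in P \<Otimes>\<^sub>M Q. norm (case w of (z, t) \<Rightarrow> ?h z t) \<le> real m * (R * C)"
    proof eventually_elim
      case (elim w)
      obtain z t where w: "w = (z, t)" by (cases w)
      have "real m * t ^ (m - 1) * (R * norm (D (x + t ^ m *\<^sub>R z))) \<le> (real m * 1) * (R * C)"
        using elim C R_nonneg w by (intro mult_mono mult_left_mono power_le_one) auto
      then show ?case using elim R_nonneg w by (simp add: abs_mult)
    qed
    show "(\<lambda>(z, t). ?h z t) \<in> borel_measurable (P \<Otimes>\<^sub>M Q)" by measurable
  qed
  have "\<phi> x - avg x = (\<integral>z. \<phi> x - \<phi> (x + z) \<partial>P)"
    unfolding avg_def using mass integrable_P_\<phi> by simp
  also have "\<bar>\<dots>\<bar> \<le> (\<integral>z. \<bar>\<phi> x - \<phi> (x + z)\<bar> \<partial>P)" by (rule integral_abs_bound)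
  also have "\<dots> \<le> (\<integral>z. (\<integral>t. ?h z t \<partial>Q) \<partial>P)"
  proof (rule integral_mono_AE)
    show "integrable P (\<lambda>z. \<bar>\<phi> x - \<phi> (x + z)\<bar>)" using integrable_P_\<phi> by auto
    show "integrable P (\<lambda>z. \<integral>t. ?h z t \<partial>Q)" using PQ.integrable_fst'[OF fin_h] by simp
    have *: "integrable Q (\<lambda>t. real m * t ^ (m - 1) * (r * norm (D (x + t ^ m *\<^sub>R z))))" if "r \<ge> 0" for r z
    proof (rule unit_interval.integrable_const_bound[where B="real m * (r * C)"])
      show "AE t in Q. norm (real m * t ^ (m - 1) * (r * norm (D (x + t ^ m *\<^sub>R z)))) \<le> real m * (r * C)"
        using AE_unit_interval
      proof eventually_elim
        case (elim t)
        have "real m * t ^ (m - 1) * (r * norm (D (x + t ^ m *\<^sub>R z))) \<le> (real m * 1) * (r * C)"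
          using elim C that by (intro mult_mono mult_left_mono power_le_one) auto
        then show ?case using elim that by (simp add: abs_mult)
      qed
    qed measurable
    show "AE z in P. \<bar>\<phi> x - \<phi> (x + z)\<bar> \<le> (\<integral>t. ?h z t \<partial>Q)"
      using radius
    proof eventually_elim
      case (elim z)
      have "\<bar>\<phi> x - \<phi> (x + z)\<bar> \<le> (\<integral>t. real m * t ^ (m - 1) * (norm z * norm (D (x + t ^ m *\<^sub>R z))) \<partial>Q)"
        using path_difference_le[OF m, of x z] by (simp add: abs_minus_commute)
      also have "\<dots> \<le> (\<integral>t. ?h z t \<partial>Q)"
      proof (rule integral_mono_AE[OF * *])
        show "AE t in Q. real m * t ^ (m - 1) * (norm z * norm (D (x + t ^ m *\<^sub>R z))) \<le> ?h z t"
          using AE_unit_interval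
          by eventually_elim (use elim in \<open>auto intro!: mult_left_mono mult_right_mono\<close>)
      qed (use R_nonneg in auto)
      finally show ?case .
    qed
  qed
  also have "\<dots> = (\<integral>t. (\<integral>z. ?h z t \<partial>P) \<partial>Q)" using PQ.Fubini_integral[OF fin_h] by simp
  also have "\<dots> = (\<integral>t. R * real m * (t ^ (m - 1) * W 1 m x t) \<partial>Q)"
    unfolding W_def by (simp add: mult_ac)
  finally show ?thesis by simp
qed

text \<open>With \<open>k = (s - p) / p\<close> one has \<open>s = p * k + p\<close>. Of the power
  \<open>s\<close> of \<open>W 1\<close>, the share \<open>p * k\<close> is estimated uniformly in
  \<open>x\<close>, while the share \<open>p\<close> becomes \<open>W p\<close> and is kept, because
  it can be integrated in \<open>x\<close>.\<close>

lemma avg_diff_powr_le: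
  assumes p: "1 \<le> p" and s: "p \<le> s" and m: "m \<ge> (1::nat)"
    and exponent: "s + real m * real DIM('a) * ((s - p) / p) \<le> real m * s"
  shows "\<bar>\<phi> x - avg x\<bar> powr s \<le> (R * real m) powr s * (c * E p) powr ((s - p) / p) * (\<integral>t. W p m x t \<partial>Q)"
proof -
  let ?k = "(s - p) / p"
  have k: "?k \<ge> 0" using p s by simp
  have s1: "s \<ge> 1" using p s by simp
  have meas_t[measurable]: "(\<lambda>t. W r m x t) \<in> borel_measurable borel" for r
    using measurable_Pair2[OF W_measurable[of r m], of x] by simp
  obtain C where C: "C \<ge> 0" "\<And>m x t. W 1 m x t \<le> C" using W_bounded[of 1] by auto
  obtain C' where C': "C' \<ge> 0" "\<And>m x t. W p m x t \<le> C'" using W_bounded[of p] p by auto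
  let ?g = "\<lambda>t. \<bar>t ^ (m - 1) * W 1 m x t\<bar>"
  have g_bd: "AE t in Q. ?g t \<le> C"
    using AE_unit_interval
  proof eventually_elim
    case (elim t)
    have "t ^ (m - 1) * W 1 m x t \<le> 1 * C"
      using elim C W_nonneg by (intro mult_mono power_le_one) auto
    then show ?case using elim W_nonneg by (simp add: abs_mult)
  qed
  have int_g: "integrable Q ?g"
    by (rule unit_interval.integrable_const_bound[where B=C]) (use g_bd in auto)
  have int_gs: "integrable Q (\<lambda>t. ?g t powr s)"
    by (rule unit_interval.integrable_const_bound[where B="C powr s"])
      (use g_bd s1 in \<open>auto elim!: eventually_mono intro!: powr_mono2\<close>)
  have int_W: "integrable Q (\<lambda>t. W p m x t)"
    by (rule unit_interval.integrable_const_bound[where B=C']) (use C' W_nonneg in \<open>auto intro!: AE_I2\<close>)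
  have key: "AE t in Q. ?g t powr s \<le> (c * E p) powr ?k * W p m x t"
    using AE_unit_interval
  proof eventually_elim
    case (elim t)
    then have t: "0 < t" "t \<le> 1" by auto
    have J: "W 1 m x t powr p \<le> W p m x t"
      using P.Jensen_powr[OF mass p, of "\<lambda>z. norm (D (x + t ^ m *\<^sub>R z))"]
        integrable_P_D_powr[of 1] integrable_P_D_powr[of p] p by (simp add: W_def)
    have "W 1 m x t powr s = (W 1 m x t powr p) powr ?k * W 1 m x t powr p"
    proof (cases "W 1 m x t = 0")
      case False
      then have "W 1 m x t powr s = W 1 m x t powr (p * ?k + p)" using p by simp
      then show ?thesis by (simp add: powr_add powr_powr)
    qed auto
    also have "\<dots> \<le> (c * inverse ((t ^ m) ^ DIM('a)) * E p) powr ?k * W p m x t"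
      by (intro mult_mono powr_mono2 order_trans[OF J W_pointwise] J k p t) auto
    also have "(c * inverse ((t ^ m) ^ DIM('a)) * E p) powr ?k = (c * E p) powr ?k * t powr (- (real m * real DIM('a) * ?k))"
    proof -
      have eq: "c * inverse ((t ^ m) ^ DIM('a)) * E p = (c * E p) * t powr (- (real m * real DIM('a)))"
        using t by (simp add: powr_minus powr_realpow[symmetric] powr_powr power_mult[symmetric])
      show ?thesis unfolding eq powr_mult powr_powr by simp
    qed
    finally have 1: "W 1 m x t powr s \<le> (c * E p) powr ?k * t powr (- (real m * real DIM('a) * ?k)) * W p m x t" .
    have "?g t powr s = t powr ((real m - 1) * s) * W 1 m x t powr s"
      using t W_nonneg[of 1 m x t] m
      by (simp add: abs_mult powr_mult powr_realpow[symmetric] powr_powr of_nat_diff)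
    also have "\<dots> \<le> t powr ((real m - 1) * s) * ((c * E p) powr ?k * t powr (- (real m * real DIM('a) * ?k)) * W p m x t)"
      using 1 by (intro mult_left_mono) auto
    also have "\<dots> = t powr ((real m - 1) * s - real m * real DIM('a) * ?k) * ((c * E p) powr ?k * W p m x t)"
      using t by (simp add: powr_diff powr_minus divide_inverse)
    \<comment> \<open>The assumption \<open>exponent\<close> says that this power of
      \<open>t\<close> is nonnegative: the slow start of the path outweighs the negative powers from
      \<open>W_pointwise\<close>.\<close>
    also have "\<dots> \<le> 1 * ((c * E p) powr ?k * W p m x t)"
      using t exponent W_nonneg by (intro mult_right_mono powr_le1) (auto simp: algebra_simps)
    finally show ?case by simp
  qed
  have "\<bar>\<phi> x - avg x\<bar> \<le> R * real m * (\<integral>t. t ^ (m - 1) * W 1 m x t \<partial>Q)" by (rule avg_diff_le[OF m])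
  also have "\<dots> \<le> R * real m * (\<integral>t. ?g t \<partial>Q)"
  proof (intro mult_left_mono integral_mono)
    show "integrable Q (\<lambda>t. t ^ (m - 1) * W 1 m x t)"
      by (rule Bochner_Integration.integrable_bound[OF int_g]) auto
  qed (use int_g R_nonneg in auto)
  finally have "\<bar>\<phi> x - avg x\<bar> powr s \<le> (R * real m * (\<integral>t. ?g t \<partial>Q)) powr s"
    using s1 by (intro powr_mono2) auto
  also have "\<dots> = (R * real m) powr s * (\<integral>t. ?g t \<partial>Q) powr s"
    using R_nonneg by (simp add: powr_mult)
  also have "\<dots> \<le> (R * real m) powr s * (\<integral>t. ?g t powr s \<partial>Q)"
    by (intro mult_left_mono unit_interval.Jensen_powr int_g int_gs s1) (auto simp: measure_unit_interval)
  also have "\<dots> \<le> (R * real m) powr s * (\<integral>t. (c * E p) powr ?k * W p m x t \<partial>Q)"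
    by (intro mult_left_mono integral_mono_AE int_gs key) (use int_W in auto)
  finally show ?thesis by (simp add: mult.assoc)
qed

text \<open>Lebesgue measure is invariant under translation by \<open>t ^ m *\<^sub>R z\<close>, so
  integration in \<open>x\<close> removes \<open>t\<close> and \<open>z\<close> from the integrand,
  and the two remaining measures have mass \<open>1\<close>.\<close>

lemma nn_integral_W:
  assumes p: "p \<ge> 1"
  shows "(\<integral>\<^sup>+x. ennreal (\<integral>t. W p m x t \<partial>Q) \<partial>lborel) = ennreal (E p)"
proof -
  obtain C where C: "C \<ge> 0" "\<And>m x t. W p m x t \<le> C" using W_bounded[of p] p by auto
  have meas_t[measurable]: "(\<lambda>t. W r m x t) \<in> borel_measurable borel" for r x
    using measurable_Pair2[OF W_measurable[of r m], of x] by simp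
  have int_W: "integrable Q (\<lambda>t. W p m x t)" for x
    by (rule unit_interval.integrable_const_bound[where B=C]) (use C W_nonneg in \<open>auto intro!: AE_I2\<close>)
  interpret LQ: pair_sigma_finite lborel Q ..
  interpret LP: pair_sigma_finite lborel P ..
  have "(\<integral>\<^sup>+x. ennreal (\<integral>t. W p m x t \<partial>Q) \<partial>lborel) = (\<integral>\<^sup>+x. \<integral>\<^sup>+t. ennreal (W p m x t) \<partial>Q \<partial>lborel)"
    by (subst nn_integral_eq_integral[OF int_W]) (auto simp: W_nonneg)
  also have "\<dots> = (\<integral>\<^sup>+t. \<integral>\<^sup>+x. ennreal (W p m x t) \<partial>lborel \<partial>Q)"
    by (rule LQ.Fubini'[symmetric]) measurable
  also have "\<dots> = (\<integral>\<^sup>+t. ennreal (E p) \<partial>Q)"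
  proof (rule nn_integral_cong)
    fix t
    have "(\<integral>\<^sup>+x. ennreal (W p m x t) \<partial>lborel) = (\<integral>\<^sup>+x. \<integral>\<^sup>+z. ennreal (norm (D (x + t ^ m *\<^sub>R z)) powr p) \<partial>P \<partial>lborel)"
      unfolding W_def using p by (subst nn_integral_eq_integral[OF integrable_P_D_powr]) auto
    also have "\<dots> = (\<integral>\<^sup>+z. \<integral>\<^sup>+x. ennreal (norm (D (x + t ^ m *\<^sub>R z)) powr p) \<partial>lborel \<partial>P)"
      by (rule LP.Fubini'[symmetric]) measurable
    also have "\<dots> = (\<integral>\<^sup>+z. ennreal (E p) \<partial>P)"
      using p by (subst nn_integral_lborel_translate[of "\<lambda>x. ennreal (norm (D x) powr p)"]) (auto simp: nn_integral_D_powr)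
    also have "\<dots> = ennreal (E p)" using mass by (simp add: P.emeasure_eq_measure)
    finally show "(\<integral>\<^sup>+x. ennreal (W p m x t) \<partial>lborel) = ennreal (E p)" .
  qed
  also have "\<dots> = ennreal (E p)" by (simp add: emeasure_unit_interval)
  finally show ?thesis .
qed

text \<open>The uniform factor gives \<open>E p\<close> to the power \<open>(s - p) / p\<close> and
  the integrated factor gives \<open>E p\<close> once more, together \<open>s / p\<close>. For a
  ball of radius \<open>h\<close> about the origin, in dimension \<open>n\<close>, the constant is
  of order \<open>h\<close> to the power \<open>s - n * (s - p) / p\<close>.\<close>

theorem avg_approximation:
  assumes p: "1 \<le> p" and s: "p \<le> s" and m: "m \<ge> (1::nat)"
    and exponent: "s + real m * real DIM('a) * ((s - p) / p) \<le> real m * s"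
  shows "(\<integral>\<^sup>+x. ennreal (\<bar>\<phi> x - avg x\<bar> powr s) \<partial>lborel)
    \<le> ennreal ((R * real m) powr s * c powr ((s - p) / p) * E p powr (s / p))"
proof -
  let ?k = "(s - p) / p"
  have meas: "(\<lambda>x. \<integral>t. W p m x t \<partial>Q) \<in> borel_measurable borel"
    by (rule unit_interval.borel_measurable_lebesgue_integral) measurable
  have "(\<integral>\<^sup>+x. ennreal (\<bar>\<phi> x - avg x\<bar> powr s) \<partial>lborel)
      \<le> (\<integral>\<^sup>+x. ennreal ((R * real m) powr s * (c * E p) powr ?k) * ennreal (\<integral>t. W p m x t \<partial>Q) \<partial>lborel)"
    by (intro nn_integral_mono)
      (use avg_diff_powr_le[OF assms] in \<open>auto simp flip: ennreal_mult' intro!: ennreal_leI\<close>)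
  also have "\<dots> = ennreal ((R * real m) powr s * (c * E p) powr ?k) * ennreal (E p)"
    using meas nn_integral_W[OF p, of m] by (subst nn_integral_cmult) auto
  also have "\<dots> = ennreal ((R * real m) powr s * (c * E p) powr ?k * E p)"
    by (simp add: ennreal_mult' E_nonneg)
  also have "(c * E p) powr ?k * E p = c powr ?k * E p powr (s / p)"
  proof (cases "E p = 0")
    case False
    then have "E p powr (?k + 1) = E p powr ?k * E p" using E_nonneg[of p] by (simp add: powr_add)
    moreover have "?k + 1 = s / p" using p by (simp add: field_simps)
    ultimately show ?thesis using c_nonneg E_nonneg by (simp add: powr_mult)
  qed auto
  then have "(R * real m) powr s * (c * E p) powr ?k * E p = (R * real m) powr s * c powr ?k * E p powr (s / p)"
    by (simp add: mult.assoc)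
  finally show ?thesis .
qed

text \<open>Here the kernel keeps its size along the path, so the straight segment with
  \<open>m = 1\<close> suffices. Domination by Lebesgue measure turns the average of
  \<open>norm D\<close> at each point of the segment into \<open>c\<close> times its full
  integral.\<close>

lemma avg_Lipschitz: "\<bar>avg x - avg y\<bar> \<le> c * E 1 * norm (x - y)"
proof -
  let ?v = "x - y"
  have "ennreal \<bar>avg x - avg y\<bar> = ennreal \<bar>\<integral>z. \<phi> (x + z) - \<phi> (y + z) \<partial>P\<bar>"
    unfolding avg_def using integrable_P_\<phi> by simp
  also have "\<dots> \<le> ennreal (\<integral>z. \<bar>\<phi> (x + z) - \<phi> (y + z)\<bar> \<partial>P)" by (intro ennreal_leI integral_abs_bound)
  also have "\<dots> = (\<integral>\<^sup>+z. ennreal \<bar>\<phi> (x + z) - \<phi> (y + z)\<bar> \<partial>P)"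
    using integrable_P_\<phi> by (intro nn_integral_eq_integral[symmetric]) auto
  also have "\<dots> \<le> (\<integral>\<^sup>+z. \<integral>\<^sup>+t. ennreal (norm ?v * norm (D (y + z + t *\<^sub>R ?v))) \<partial>Q \<partial>P)"
  proof (rule nn_integral_mono)
    fix z
    obtain C where C: "C \<ge> 0" "\<And>x. norm (D x) \<le> C" using D_bounded by blast
    have "\<bar>\<phi> (x + z) - \<phi> (y + z)\<bar> \<le> (\<integral>t. norm ?v * norm (D (y + z + t *\<^sub>R ?v)) \<partial>Q)"
      using path_difference_le[of 1 "y + z" ?v] by (simp add: add_ac)
    also have "ennreal \<dots> = (\<integral>\<^sup>+t. ennreal (norm ?v * norm (D (y + z + t *\<^sub>R ?v))) \<partial>Q)"
      by (intro nn_integral_eq_integral[symmetric] unit_interval.integrable_const_bound[where B="norm ?v * C"])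
        (use C in \<open>auto intro!: AE_I2 mult_left_mono\<close>)
    finally show "ennreal \<bar>\<phi> (x + z) - \<phi> (y + z)\<bar> \<le> \<dots>" by (simp add: ennreal_leI)
  qed
  also have "\<dots> = (\<integral>\<^sup>+t. \<integral>\<^sup>+z. ennreal (norm ?v * norm (D (y + z + t *\<^sub>R ?v))) \<partial>P \<partial>Q)"
    by (rule PQ.Fubini'[symmetric]) measurable
  also have "\<dots> \<le> (\<integral>\<^sup>+t. ennreal (c * E 1 * norm ?v) \<partial>Q)"
  proof (rule nn_integral_mono)
    fix t
    have "(\<integral>\<^sup>+z. ennreal (norm ?v * norm (D (y + z + t *\<^sub>R ?v))) \<partial>P)
        \<le> ennreal c * (\<integral>\<^sup>+z. ennreal (norm ?v * norm (D (y + z + t *\<^sub>R ?v))) \<partial>lborel)"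
      by (rule dominated) measurable
    also have "(\<integral>\<^sup>+z. ennreal (norm ?v * norm (D (y + z + t *\<^sub>R ?v))) \<partial>lborel)
        = ennreal (norm ?v) * (\<integral>\<^sup>+z. ennreal (norm (D (z + (y + t *\<^sub>R ?v)))) \<partial>lborel)"
      by (subst nn_integral_cmult[symmetric]) (auto simp: ennreal_mult' add_ac)
    also have "(\<integral>\<^sup>+z. ennreal (norm (D (z + (y + t *\<^sub>R ?v)))) \<partial>lborel) = ennreal (E 1)"
      using nn_integral_D_powr[of 1] by (subst nn_integral_lborel_translate[of "\<lambda>x. ennreal (norm (D x))"]) auto
    also have "ennreal c * (ennreal (norm ?v) * ennreal (E 1)) = ennreal (c * E 1 * norm ?v)"
      using c_nonneg E_nonneg by (simp flip: ennreal_mult' ennreal_mult add: mult_ac)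
    finally show "(\<integral>\<^sup>+z. ennreal (norm ?v * norm (D (y + z + t *\<^sub>R ?v))) \<partial>P) \<le> ennreal (c * E 1 * norm ?v)" .
  qed
  also have "\<dots> = ennreal (c * E 1 * norm ?v)" by (simp add: emeasure_unit_interval)
  finally show ?thesis using c_nonneg E_nonneg by (subst (asm) ennreal_le_iff) auto
qed

end

section \<open>Sobolev inequality and compactness for test functions\<close>

lemma averaging_kernel_ball:
  fixes z0 :: "'a::euclidean_space"
  assumes h: "h > 0"
  shows "averaging_kernel (uniform_measure lborel (ball z0 h))
    (1 / (unit_ball_vol (real DIM('a)) * h ^ DIM('a))) (norm z0 + h)"
proof -
  let ?B = "ball z0 h" and ?v = "unit_ball_vol (real DIM('a)) * h ^ DIM('a)"
  have v: "emeasure lborel ?B = ennreal ?v" using emeasure_ball[of h z0] h by simp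
  have vpos: "?v > 0" using h by simp
  have ne: "emeasure lborel ?B \<noteq> 0" "emeasure lborel ?B \<noteq> \<infinity>"
    unfolding v by (simp only: ennreal_eq_0_iff not_le, rule vpos, simp)
  have 1: "emeasure (uniform_measure lborel ?B) UNIV = 1"
    using ne by (subst emeasure_uniform_measure) (auto simp: v ennreal_divide_self)
  interpret finite_measure "uniform_measure lborel ?B"
    by (rule finite_measureI) (use 1 in simp)
  show ?thesis
  proof unfold_locales
    show "measure (uniform_measure lborel ?B) (space (uniform_measure lborel ?B)) = 1"
      using 1 by (simp add: measure_def)
    show "(\<integral>\<^sup>+z. f z \<partial>uniform_measure lborel ?B) \<le> ennreal (1 / ?v) * (\<integral>\<^sup>+z. f z \<partial>lborel)"
      if [measurable]: "f \<in> borel_measurable borel" for f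
    proof -
      have "(\<integral>\<^sup>+z. f z \<partial>uniform_measure lborel ?B) = (\<integral>\<^sup>+z. f z * indicator ?B z \<partial>lborel) / ennreal ?v"
        using v by (subst nn_integral_uniform_measure) auto
      also have "\<dots> \<le> (\<integral>\<^sup>+z. f z \<partial>lborel) / ennreal ?v"
        by (intro divide_right_mono_ennreal nn_integral_mono) (auto simp: indicator_def)
      also have "\<dots> = ennreal (1 / ?v) * (\<integral>\<^sup>+z. f z \<partial>lborel)"
        using vpos by (simp add: divide_ennreal_def inverse_ennreal mult.commute inverse_eq_divide)
      finally show ?thesis .
    qed
    show "AE z in uniform_measure lborel ?B. norm z \<le> norm z0 + h"
    proof (rule AE_uniform_measureI)
      show "AE z in lborel. z \<in> ?B \<longrightarrow> norm z \<le> norm z0 + h"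
      proof (intro AE_I2 impI)
        fix z assume "z \<in> ?B"
        then show "norm z \<le> norm z0 + h"
          using norm_triangle_sub[of z z0] by (simp add: dist_norm norm_minus_commute)
      qed
    qed auto
  qed (use h vpos in auto)
qed

text \<open>The last condition is the inequality \<open>s * (n - p) < n * p\<close> in dimension
  \<open>n\<close>. It says that \<open>s\<close> is below the Sobolev conjugate if
  \<open>p < n\<close>, and it holds for every \<open>s\<close> otherwise, so one formula covers
  both cases.\<close>

locale subcritical_domain =
  fixes \<Omega> :: "'a::euclidean_space set" and p s :: real
  assumes open_\<Omega>: "open \<Omega>" and bounded_\<Omega>: "bounded \<Omega>"
    and p2: "2 \<le> p" and ps: "p \<le> s" and subcritical: "real DIM('a) * ((s - p) / p) < s"
begin

abbreviation M :: "'a measure" where "M \<equiv> lebesgue_on \<Omega>"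

lemma \<Omega>_sets: "\<Omega> \<in> sets lebesgue" "\<Omega> \<in> sets borel" "\<Omega> \<in> lmeasurable"
  using fmeasurableD[OF lmeasurable_open[OF bounded_\<Omega> open_\<Omega>]] borel_open[OF open_\<Omega>]
    lmeasurable_open[OF bounded_\<Omega> open_\<Omega>] by blast+

sublocale finite_measure M
  by (rule finite_measure_lebesgue_on[OF \<Omega>_sets(3)])

lemma p_pos: "p > 0" "p \<ge> 1" "p \<ge> 0" and s_pos: "s > 0" "s \<ge> 1" "s \<ge> 0"
  using p2 ps by auto

lemma borel_measurable_M: "g \<in> borel_measurable borel \<Longrightarrow> g \<in> borel_measurable M"
  by (intro measurable_restrict_space1 measurable_completion) (simp add: measurable_lborel1)

lemma integral_M_eq_lborel:
  fixes g :: "'a \<Rightarrow> 'b::euclidean_space"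
  assumes g: "g \<in> borel_measurable borel" and zero: "\<And>x. x \<notin> \<Omega> \<Longrightarrow> g x = 0"
  shows "integrable M g \<longleftrightarrow> integrable lborel g" "(\<integral>x. g x \<partial>M) = (\<integral>x. g x \<partial>lborel)"
proof -
  have eq: "(\<lambda>x. indicator \<Omega> x *\<^sub>R g x) = g" using zero by (auto simp: indicator_def)
  show "integrable M g \<longleftrightarrow> integrable lborel g"
    using \<Omega>_sets(1) g integrable_completion[of g lborel] by (subst integrable_restrict_space) (simp_all add: eq)
  show "(\<integral>x. g x \<partial>M) = (\<integral>x. g x \<partial>lborel)"
    using \<Omega>_sets(1) g integral_completion[of g lborel] by (subst integral_restrict_space) (simp_all add: eq)
qed

lemma integral_M_le:
  fixes g :: "'a \<Rightarrow> real"
  assumes g: "g \<in> borel_measurable borel" and nonneg: "\<And>x. g x \<ge> 0" and C: "C \<ge> 0"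
    and le: "(\<integral>\<^sup>+x. ennreal (g x) \<partial>lborel) \<le> ennreal C"
  shows "integrable M g" "(\<integral>x. g x \<partial>M) \<le> C"
proof -
  have "(\<integral>\<^sup>+x. ennreal (g x) \<partial>M) = (\<integral>\<^sup>+x. ennreal (g x) * indicator \<Omega> x \<partial>lborel)"
    using \<Omega>_sets by (subst nn_integral_restrict_space) (auto simp: nn_integral_completion)
  also have "\<dots> \<le> (\<integral>\<^sup>+x. ennreal (g x) \<partial>lborel)" by (intro nn_integral_mono) (auto simp: indicator_def)
  finally have nn: "(\<integral>\<^sup>+x. ennreal (g x) \<partial>M) \<le> ennreal C" using le by simp
  show int: "integrable M g"
    using le_less_trans[OF nn ennreal_less_top] nonneg borel_measurable_M[OF g] by (intro integrableI_bounded) simp_all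
  show "(\<integral>x. g x \<partial>M) \<le> C"
    using nn nn_integral_eq_integral[OF int] nonneg C by simp
qed

lemma test_C1_compact_support:
  assumes "\<phi> \<in> test_functions \<Omega>"
  obtains K where "K \<subseteq> \<Omega>" "C1_compact_support \<phi> (grad \<phi>) K"
proof -
  obtain K where K: "compact K" "K \<subseteq> \<Omega>" "\<And>x. x \<notin> K \<Longrightarrow> \<phi> x = 0 \<and> grad \<phi> x = 0"
    using test_support[OF assms] by blast
  moreover have "C1_compact_support \<phi> (grad \<phi>) K"
    using K test_has_derivative[OF assms] test_grad_continuous[OF assms] by unfold_locales auto
  ultimately show ?thesis using that by blast
qed

lemma continuous_vanishing_LP:
  fixes g :: "'a \<Rightarrow> 'b::euclidean_space"
  assumes r: "r > 0" and cont: "continuous_on UNIV g" and K: "compact K" "\<And>x. x \<notin> K \<Longrightarrow> g x = 0"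
  shows "g \<in> LP M r"
proof -
  have [measurable]: "g \<in> borel_measurable borel" by (rule borel_measurable_continuous_onI[OF cont])
  obtain C where C: "C \<ge> 0" "\<And>x. norm (g x) \<le> C" using continuous_vanishing_bounded[OF K(1) cont K(2)] by blast
  have "integrable M (\<lambda>x. norm (g x) powr r)"
    using r C by (intro integrable_const_bound[where B="C powr r"])
      (auto intro!: AE_I2 powr_mono2 borel_measurable_M)
  then show ?thesis by (simp add: LP_def borel_measurable_M)
qed

lemma test_LP:
  assumes "\<phi> \<in> test_functions \<Omega>" "r > 0"
  shows "\<phi> \<in> LP M r" "grad \<phi> \<in> LP M r"
  using test_support[OF assms(1)] continuous_vanishing_LP[OF assms(2)]
    test_continuous[OF assms(1)] test_grad_continuous[OF assms(1)] by metis+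

lemma test_energy_eq:
  assumes "C1_compact_support \<phi> (grad \<phi>) K" "K \<subseteq> \<Omega>" "r > 0"
  shows "C1_compact_support.E (grad \<phi>) r = LP_int M r (grad \<phi>)"
proof -
  interpret C1_compact_support \<phi> "grad \<phi>" K by fact
  show ?thesis
    unfolding E_def LP_int_def
  proof (rule integral_M_eq_lborel(2)[symmetric])
    show "norm (grad \<phi> x) powr r = 0" if "x \<notin> \<Omega>" for x
      using zero_outside(2)[of x] assms(2) that by auto
  qed measurable
qed

text \<open>The condition reads \<open>s \<le> m * d\<close> with
  \<open>d = s - n * ((s - p) / p)\<close>, and \<open>d\<close> is positive in the subcritical
  range; any large \<open>m\<close> will do.\<close>

lemma exists_path_order: "\<exists>m::nat. m \<ge> 1 \<and> s + real m * real DIM('a) * ((s - p) / p) \<le> real m * s"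
proof -
  let ?d = "s - real DIM('a) * ((s - p) / p)"
  have d: "?d > 0" using subcritical by simp
  obtain m :: nat where m: "s / ?d \<le> real m" using real_arch_simple by blast
  have "s \<le> real m * ?d" using m d by (simp add: pos_divide_le_eq)
  moreover have "real m > 0" using m divide_pos_pos[OF s_pos(1) d] by linarith
  ultimately show ?thesis by (intro exI[of _ m]) (simp add: algebra_simps)
qed

definition path_order :: nat where
  "path_order = (SOME m. m \<ge> 1 \<and> s + real m * real DIM('a) * ((s - p) / p) \<le> real m * s)"

lemma path_order: "path_order \<ge> 1"
  "s + real path_order * real DIM('a) * ((s - p) / p) \<le> real path_order * s"
  using someI_ex[OF exists_path_order] unfolding path_order_def by auto

definition ball_avg :: "'a \<Rightarrow> real \<Rightarrow> ('a \<Rightarrow> real) \<Rightarrow> 'a \<Rightarrow> real" where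
  "ball_avg z0 h \<phi> x = (\<integral>z. \<phi> (x + z) \<partial>uniform_measure lborel (ball z0 h))"

definition ball_const :: "real \<Rightarrow> real" where
  "ball_const h = 1 / (unit_ball_vol (real DIM('a)) * h ^ DIM('a))"

lemma ball_averaging:
  assumes "C1_compact_support \<phi> (grad \<phi>) K" "h > 0"
  shows "averaging (uniform_measure lborel (ball z0 h)) (ball_const h) (norm z0 + h) \<phi> (grad \<phi>) K"
    "averaging.avg (uniform_measure lborel (ball z0 h)) \<phi> = ball_avg z0 h \<phi>"
proof -
  show *: "averaging (uniform_measure lborel (ball z0 h)) (ball_const h) (norm z0 + h) \<phi> (grad \<phi>) K"
    unfolding averaging_def ball_const_def using averaging_kernel_ball[OF assms(2)] assms(1) by blast
  show "averaging.avg (uniform_measure lborel (ball z0 h)) \<phi> = ball_avg z0 h \<phi>"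
    unfolding averaging.avg_def[OF *] ball_avg_def ..
qed

lemma ball_avg_approximation:
  assumes \<phi>: "\<phi> \<in> test_functions \<Omega>" and h: "h > 0"
  shows "(\<lambda>x. \<phi> x - ball_avg z0 h \<phi> x) \<in> LP M s"
    "LP_int M s (\<lambda>x. \<phi> x - ball_avg z0 h \<phi> x)
      \<le> ((norm z0 + h) * real path_order) powr s * ball_const h powr ((s - p) / p) * LP_int M p (grad \<phi>) powr (s / p)"
    "ball_avg z0 h \<phi> \<in> borel_measurable borel"
proof -
  obtain K where K: "K \<subseteq> \<Omega>" and C1: "C1_compact_support \<phi> (grad \<phi>) K"
    using test_C1_compact_support[OF \<phi>] by blast
  interpret A: averaging "uniform_measure lborel (ball z0 h)" "ball_const h" "norm z0 + h" \<phi> "grad \<phi>" K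
    by (rule ball_averaging(1)[OF C1 h])
  note avg = ball_averaging(2)[OF C1 h, of z0]
  show [measurable]: "ball_avg z0 h \<phi> \<in> borel_measurable borel" using A.borel_avg unfolding avg .
  note E = test_energy_eq[OF C1 K p_pos(1)]
  have "(\<integral>\<^sup>+x. ennreal (\<bar>\<phi> x - ball_avg z0 h \<phi> x\<bar> powr s) \<partial>lborel)
      \<le> ennreal (((norm z0 + h) * real path_order) powr s * ball_const h powr ((s - p) / p) * LP_int M p (grad \<phi>) powr (s / p))"
    using A.avg_approximation[OF p_pos(2) ps path_order] unfolding avg E .
  then have *: "integrable M (\<lambda>x. \<bar>\<phi> x - ball_avg z0 h \<phi> x\<bar> powr s)"
    "(\<integral>x. \<bar>\<phi> x - ball_avg z0 h \<phi> x\<bar> powr s \<partial>M)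
      \<le> ((norm z0 + h) * real path_order) powr s * ball_const h powr ((s - p) / p) * LP_int M p (grad \<phi>) powr (s / p)"
    by (rule integral_M_le[rotated 3]; simp)+
  then show "(\<lambda>x. \<phi> x - ball_avg z0 h \<phi> x) \<in> LP M s"
    "LP_int M s (\<lambda>x. \<phi> x - ball_avg z0 h \<phi> x)
      \<le> ((norm z0 + h) * real path_order) powr s * ball_const h powr ((s - p) / p) * LP_int M p (grad \<phi>) powr (s / p)"
    by (auto simp: LP_def LP_int_def borel_measurable_M)
qed

lemma ball_avg_zero:
  assumes "\<phi> \<in> test_functions \<Omega>" "h > 0" "\<And>z. z \<in> ball z0 h \<Longrightarrow> x + z \<notin> \<Omega>"
  shows "ball_avg z0 h \<phi> x = 0"
proof -
  have zero: "\<phi> y = 0" if "y \<notin> \<Omega>" for y using test_support[OF assms(1)] that by blast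
  have "AE z in uniform_measure lborel (ball z0 h). \<phi> (x + z) = 0"
    using assms(3) zero by (intro AE_uniform_measureI) (auto intro!: AE_I2)
  then have "ball_avg z0 h \<phi> x = (\<integral>z. 0 \<partial>uniform_measure lborel (ball z0 h))"
    unfolding ball_avg_def
  proof (rule integral_cong_AE[rotated 2])
    have "\<phi> \<in> borel_measurable borel" by (rule borel_measurable_continuous_onI[OF test_continuous[OF assms(1)]])
    then show "(\<lambda>z. \<phi> (x + z)) \<in> borel_measurable (uniform_measure lborel (ball z0 h))" by measurable
  qed simp
  then show ?thesis by simp
qed

lemma exists_far_vector: "\<exists>v::'a. \<forall>h\<in>{0<..1}. \<forall>x\<in>\<Omega>. \<forall>z\<in>ball v h. x + z \<notin> \<Omega>"
proof -
  obtain L where L: "L > 0" "\<And>x. x \<in> \<Omega> \<Longrightarrow> norm x < L" using bounded_\<Omega> bounded_pos_less by metis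
  \<comment> \<open>If \<open>x\<close> and \<open>x + z\<close> both lay in \<Omega>, then
    \<open>v = (v - z) + (x + z) - x\<close> would have norm below \<open>1 + L + L\<close>.\<close>
  obtain v :: 'a where v: "norm v = 2 * L + 1" using vector_choose_size[of "2 * L + 1"] L(1) by auto
  have "x + z \<notin> \<Omega>" if "h \<le> 1" "x \<in> \<Omega>" "z \<in> ball v h" for h x z
  proof
    assume "x + z \<in> \<Omega>"
    then have 1: "norm (x + z) < L" "norm x < L" "norm (v - z) < 1" using L(2) that by (auto simp: dist_norm)
    have "norm v \<le> norm (v - z) + norm (x + z) + norm x"
      using norm_triangle_ineq[of "v - z" "(x + z) - x"] norm_triangle_ineq4[of "x + z" x] by simp
    then show False using 1 v by simp
  qed
  then show ?thesis by (intro exI[of _ v]) auto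
qed

lemma Sobolev_test: "\<exists>C\<ge>0. \<forall>\<phi>\<in>test_functions \<Omega>. LP_int M s \<phi> \<le> C * LP_int M p (grad \<phi>) powr (s / p)"
proof -
  obtain v :: 'a where v: "\<And>h x z. h \<in> {0<..1} \<Longrightarrow> x \<in> \<Omega> \<Longrightarrow> z \<in> ball v h \<Longrightarrow> x + z \<notin> \<Omega>"
    using exists_far_vector by blast
  let ?C = "((norm v + 1) * real path_order) powr s * ball_const 1 powr ((s - p) / p)"
  have "LP_int M s \<phi> \<le> ?C * LP_int M p (grad \<phi>) powr (s / p)" if \<phi>: "\<phi> \<in> test_functions \<Omega>" for \<phi>
  proof -
    have "ball_avg v 1 \<phi> x = 0" if "x \<in> \<Omega>" for x
      by (rule ball_avg_zero[OF \<phi>]) (use v[of 1 x] that in auto)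
    then have "LP_int M s \<phi> = LP_int M s (\<lambda>x. \<phi> x - ball_avg v 1 \<phi> x)"
      unfolding LP_int_def by (intro Bochner_Integration.integral_cong) auto
    then show ?thesis using ball_avg_approximation(2)[OF \<phi>, of 1 v] by simp
  qed
  then show ?thesis by (intro exI[of _ ?C]) auto
qed

text \<open>For a ball centred at the origin the radius of the kernel is \<open>h\<close> itself, so
  the constant is a multiple of \<open>h powr ?d\<close> with \<open>?d > 0\<close>.\<close>

lemma ball_avg_approximation_small:
  assumes B: "B \<ge> 0" and e: "e > 0"
  shows "\<exists>h\<in>{0<..1}. \<forall>\<phi>\<in>test_functions \<Omega>. LP_int M p (grad \<phi>) \<le> B \<longrightarrow>
    LP_int M s (\<lambda>x. \<phi> x - ball_avg 0 h \<phi> x) \<le> e"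
proof -
  let ?k = "(s - p) / p" and ?w = "unit_ball_vol (real DIM('a))"
  let ?c = "real path_order powr s * (1 / ?w) powr ?k * B powr (s / p)"
  let ?d = "s - real DIM('a) * ?k"
  have d: "?d > 0" using subcritical by simp
  have eq: "(h * real path_order) powr s * ball_const h powr ?k = real path_order powr s * (1 / ?w) powr ?k * h powr ?d"
    if "h > 0" for h
  proof -
    have "ball_const h = (1 / ?w) * h powr (- real DIM('a))"
      using that by (simp add: ball_const_def powr_minus powr_realpow divide_inverse)
    then have "ball_const h powr ?k = (1 / ?w) powr ?k * h powr (- real DIM('a) * ?k)"
      using that by (simp only: powr_mult powr_powr)
    then show ?thesis using that by (simp add: powr_mult powr_diff powr_minus divide_inverse)
  qed
  have "((\<lambda>h. ?c * h powr ?d) \<longlongrightarrow> ?c * 0 powr ?d) (at_right 0)"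
    using d by (intro tendsto_intros tendsto_powr') (auto simp: eventually_at_filter)
  then have "((\<lambda>h. ?c * h powr ?d) \<longlongrightarrow> 0) (at_right 0)" by simp
  then have "\<forall>\<^sub>F h in at_right 0. ?c * h powr ?d < e" using e by (rule order_tendstoD(2))
  moreover have "\<forall>\<^sub>F h in at_right (0::real). h \<in> {0<..<1}" using eventually_at_right_real[of 0 1] by (auto elim!: eventually_mono)
  ultimately have "\<forall>\<^sub>F h in at_right 0. ?c * h powr ?d < e \<and> h \<in> {0<..<1}" by (rule eventually_conj)
  then obtain h where h: "?c * h powr ?d < e" "h \<in> {0<..<1}"
    using eventually_happens'[OF trivial_limit_at_right_real] by blast
  have "LP_int M s (\<lambda>x. \<phi> x - ball_avg 0 h \<phi> x) \<le> e"
    if \<phi>: "\<phi> \<in> test_functions \<Omega>" "LP_int M p (grad \<phi>) \<le> B" for \<phi>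
  proof -
    have "LP_int M s (\<lambda>x. \<phi> x - ball_avg 0 h \<phi> x)
        \<le> ((norm (0::'a) + h) * real path_order) powr s * ball_const h powr ?k * LP_int M p (grad \<phi>) powr (s / p)"
      using h by (intro ball_avg_approximation(2)[OF \<phi>(1)]) auto
    also have "\<dots> = (real path_order powr s * (1 / ?w) powr ?k * h powr ?d) * LP_int M p (grad \<phi>) powr (s / p)"
      using h eq[of h] by simp
    also have "\<dots> \<le> (real path_order powr s * (1 / ?w) powr ?k * h powr ?d) * B powr (s / p)"
      using \<phi>(2) p_pos s_pos LP_int_nonneg by (intro mult_left_mono powr_mono2) auto
    also have "\<dots> \<le> e" using h by (simp add: mult_ac)
    finally show ?thesis .
  qed
  then show ?thesis using h by (intro bexI[of _ h]) auto
qed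

section \<open>Equicontinuity of the averages and compactness for test functions\<close>

lemma ball_avg_Lipschitz:
  assumes \<phi>: "\<phi> \<in> test_functions \<Omega>" and h: "h > 0"
  shows "\<bar>ball_avg z0 h \<phi> x - ball_avg z0 h \<phi> y\<bar>
    \<le> ball_const h * (measure M \<Omega> + LP_int M p (grad \<phi>)) * norm (x - y)"
proof -
  obtain K where K: "K \<subseteq> \<Omega>" and C1: "C1_compact_support \<phi> (grad \<phi>) K"
    using test_C1_compact_support[OF \<phi>] by blast
  interpret A: averaging "uniform_measure lborel (ball z0 h)" "ball_const h" "norm z0 + h" \<phi> "grad \<phi>" K
    by (rule ball_averaging(1)[OF C1 h])
  note avg = ball_averaging(2)[OF C1 h, of z0]
  \<comment> \<open>The Lipschitz constant contains the integral of the norm of the gradient;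
    \<open>t \<le> 1 + t powr p\<close> bounds it by the energy plus the volume of \<Omega>.\<close>
  have "A.E 1 = LP_int M 1 (grad \<phi>)" by (rule test_energy_eq[OF C1 K]) simp
  also have "\<dots> \<le> (\<integral>x. 1 + norm (grad \<phi> x) powr p \<partial>M)"
    unfolding LP_int_def
  proof (rule integral_mono)
    show "integrable M (\<lambda>x. norm (grad \<phi> x) powr 1)" by (rule LP_integrable[OF test_LP(2)[OF \<phi>]]) simp
    show "integrable M (\<lambda>x. 1 + norm (grad \<phi> x) powr p)"
      using LP_integrable[OF test_LP(2)[OF \<phi> p_pos(1)]] by simp
    show "norm (grad \<phi> x) powr 1 \<le> 1 + norm (grad \<phi> x) powr p" for x
      using p_pos by (intro powr_le_1_plus) auto
  qed
  also have "\<dots> = measure M \<Omega> + LP_int M p (grad \<phi>)"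
    unfolding LP_int_def using LP_integrable[OF test_LP(2)[OF \<phi> p_pos(1)]] by (subst Bochner_Integration.integral_add) auto
  finally have "A.E 1 \<le> measure M \<Omega> + LP_int M p (grad \<phi>)" .
  then have "ball_const h * A.E 1 * norm (x - y) \<le> ball_const h * (measure M \<Omega> + LP_int M p (grad \<phi>)) * norm (x - y)"
    using A.c_nonneg by (intro mult_right_mono mult_left_mono) auto
  then show ?thesis using A.avg_Lipschitz[of x y] unfolding avg by linarith
qed

text \<open>After a translation by a vector \<open>v\<close> that carries the ball away from
  \<Omega>, the average is \<open>0\<close>; the Lipschitz bound along \<open>v\<close> then
  controls the average at \<open>x\<close>.\<close>

lemma ball_avg_bounded:
  "\<exists>C\<ge>0. \<forall>\<phi>\<in>test_functions \<Omega>. \<forall>x\<in>\<Omega>. \<forall>h\<in>{0<..1}.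
    \<bar>ball_avg 0 h \<phi> x\<bar> \<le> C * (ball_const h * (measure M \<Omega> + LP_int M p (grad \<phi>)))"
proof -
  obtain v :: 'a where v: "\<And>h x z. h \<in> {0<..1} \<Longrightarrow> x \<in> \<Omega> \<Longrightarrow> z \<in> ball v h \<Longrightarrow> x + z \<notin> \<Omega>"
    using exists_far_vector by blast
  have "\<bar>ball_avg 0 h \<phi> x\<bar> \<le> norm v * (ball_const h * (measure M \<Omega> + LP_int M p (grad \<phi>)))"
    if "\<phi> \<in> test_functions \<Omega>" "x \<in> \<Omega>" "h \<in> {0<..1}" for \<phi> x h
  proof -
    have "ball_avg 0 h \<phi> (x + v) = 0"
    proof (rule ball_avg_zero[OF that(1)])
      show "x + v + z \<notin> \<Omega>" if z: "z \<in> ball 0 h" for z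
        using v[OF \<open>h \<in> {0<..1}\<close> \<open>x \<in> \<Omega>\<close>, of "v + z"] z by (simp add: dist_norm add.assoc)
    qed (use that in auto)
    then show ?thesis
      using ball_avg_Lipschitz[OF that(1), of h 0 x "x + v"] that(3) by (simp add: mult.commute)
  qed
  then show ?thesis by (intro exI[of _ "norm v"]) auto
qed

lemma LP_int_midpoint:
  fixes f g h :: "'a \<Rightarrow> 'b::euclidean_space"
  assumes "1 \<le> r" "f \<in> LP M r" "g \<in> LP M r" "h \<in> LP M r"
  shows "LP_int M r (\<lambda>x. ((1/2) *\<^sub>R f x + (1/2) *\<^sub>R g x) - h x)
    \<le> (LP_int M r (\<lambda>x. f x - h x) + LP_int M r (\<lambda>x. g x - h x)) / 2"
proof -
  have r: "r \<ge> 0" using assms by simp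
  have fh: "(\<lambda>x. f x - h x) \<in> LP M r" and gh: "(\<lambda>x. g x - h x) \<in> LP M r"
    using LP_diff[OF r] assms by blast+
  have eq: "((1/2) *\<^sub>R f x + (1/2) *\<^sub>R g x) - h x = (1/2) *\<^sub>R ((f x - h x) + (g x - h x))" for x
  proof -
    have "(1/2) *\<^sub>R ((f x - h x) + (g x - h x)) = (1/2) *\<^sub>R f x + (1/2) *\<^sub>R g x - (1/2) *\<^sub>R (h x + h x)"
      unfolding scaleR_add_right scaleR_diff_right by (rule add_diff_add[symmetric])
    then show ?thesis unfolding scaleR_half_double by (rule sym)
  qed
  have "LP_int M r (\<lambda>x. ((1/2) *\<^sub>R f x + (1/2) *\<^sub>R g x) - h x)
      \<le> (\<integral>x. (norm (f x - h x) powr r + norm (g x - h x) powr r) / 2 \<partial>M)"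
    unfolding LP_int_def eq
  proof (rule integral_mono)
    show "integrable M (\<lambda>x. norm ((1/2) *\<^sub>R ((f x - h x) + (g x - h x))) powr r)"
      by (rule LP_integrable[OF LP_scaleR[OF LP_add(1)[OF r fh gh]]])
    show "integrable M (\<lambda>x. (norm (f x - h x) powr r + norm (g x - h x) powr r) / 2)"
      using LP_integrable[OF fh] LP_integrable[OF gh] by simp
    show "norm ((1/2) *\<^sub>R ((f x - h x) + (g x - h x))) powr r \<le> (norm (f x - h x) powr r + norm (g x - h x) powr r) / 2" for x
      by (rule norm_powr_midpoint_le[OF assms(1)])
  qed
  also have "\<dots> = (LP_int M r (\<lambda>x. f x - h x) + LP_int M r (\<lambda>x. g x - h x)) / 2"
    unfolding LP_int_def using LP_integrable[OF fh] LP_integrable[OF gh] by simp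
  finally show ?thesis .
qed

text \<open>The Arzela-Ascoli argument in pointwise form: a diagonal sequence for a countable dense
  set and all scales \<open>h j\<close> at once, with equicontinuity reaching the other points.
  Pointwise convergence suffices, since the averages at each scale are bounded.\<close>

lemma test_ball_avg_convergent:
  assumes \<phi>: "\<And>k. \<phi> k \<in> test_functions \<Omega>" and B: "\<And>k. LP_int M p (grad (\<phi> k)) \<le> B"
    and h: "\<And>j::nat. h j \<in> {0<..1}"
  obtains r :: "nat \<Rightarrow> nat" where "strict_mono r"
    "\<And>j x. x \<in> \<Omega> \<Longrightarrow> convergent (\<lambda>k. ball_avg 0 (h j) (\<phi> (r k)) x)"
proof -
  let ?A = "\<lambda>j k x. ball_avg 0 (h j) (\<phi> k) x"
  obtain C where C: "C \<ge> 0" "\<And>\<phi> x h. \<phi> \<in> test_functions \<Omega> \<Longrightarrow> x \<in> \<Omega> \<Longrightarrow> h \<in> {0<..1} \<Longrightarrow>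
      \<bar>ball_avg 0 h \<phi> x\<bar> \<le> C * (ball_const h * (measure M \<Omega> + LP_int M p (grad \<phi>)))"
    using ball_avg_bounded by blast
  have bc: "ball_const (h j) \<ge> 0" for j using h[of j] by (simp add: ball_const_def)
  define L where "L j = ball_const (h j) * (measure M \<Omega> + B)" for j
  have B0: "B \<ge> 0" using LP_int_nonneg order_trans B by blast
  have L0: "L j \<ge> 0" for j unfolding L_def using bc B0 by simp
  have Lip: "\<bar>?A j k x - ?A j k y\<bar> \<le> L j * norm (x - y)" for j k x y
  proof -
    have "\<bar>?A j k x - ?A j k y\<bar> \<le> ball_const (h j) * (measure M \<Omega> + LP_int M p (grad (\<phi> k))) * norm (x - y)"
      using h[of j] by (intro ball_avg_Lipschitz \<phi>) auto
    also have "\<dots> \<le> L j * norm (x - y)"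
      unfolding L_def using bc B by (intro mult_right_mono mult_left_mono) auto
    finally show ?thesis .
  qed
  have bd: "\<bar>?A j k x\<bar> \<le> C * L j" if "x \<in> \<Omega>" for j k x
  proof -
    have "\<bar>?A j k x\<bar> \<le> C * (ball_const (h j) * (measure M \<Omega> + LP_int M p (grad (\<phi> k))))"
      by (rule C(2)[OF \<phi> that h])
    also have "\<dots> \<le> C * L j"
      unfolding L_def using bc B C(1) by (intro mult_left_mono) auto
    finally show ?thesis .
  qed
  obtain T where T: "countable T" "T \<subseteq> \<Omega>" "\<Omega> \<subseteq> closure T" by (rule separable)
  have pos: "C * L j + 1 > 0" for j using C(1) L0[of j] by (simp add: add_nonneg_pos)
  \<comment> \<open>Division by \<open>C * L j + 1\<close> brings all scales under the common bound
    \<open>1\<close>; the added \<open>1\<close> keeps the divisor positive.\<close>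
  define f where "f k y = (case y of (x, j) \<Rightarrow> ?A j k x / (C * L j + 1))" for k y
  have f1: "norm (f k y) \<le> 1" if yT: "y \<in> T \<times> (UNIV :: nat set)" for k y
  proof -
    obtain x j where y: "y = (x, j)" "x \<in> \<Omega>" using yT T(2) by auto
    show ?thesis using bd[OF y(2), of j k] pos[of j] by (simp add: y f_def abs_divide)
  qed
  have cT: "countable (T \<times> (UNIV :: nat set))" using T(1) by auto
  obtain r where r: "strict_mono (r :: nat \<Rightarrow> nat)"
    "\<And>y. y \<in> T \<times> (UNIV :: nat set) \<Longrightarrow> \<exists>l. (\<lambda>n. f (r n) y) \<longlonglongrightarrow> l"
    using function_convergent_subsequence[where f=f and S="T \<times> (UNIV :: nat set)" and M=1, OF cT f1] by blast
  have conv_T: "convergent (\<lambda>n. ?A j (r n) x)" if xT: "x \<in> T" for x j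
  proof -
    obtain l where "(\<lambda>n. ?A j (r n) x / (C * L j + 1)) \<longlonglongrightarrow> l" using r(2)[of "(x, j)"] xT by (auto simp: f_def)
    then have "(\<lambda>n. (C * L j + 1) * (?A j (r n) x / (C * L j + 1))) \<longlonglongrightarrow> (C * L j + 1) * l"
      by (intro tendsto_intros)
    then show ?thesis using pos[of j] by (auto simp: convergent_def)
  qed
  have "convergent (\<lambda>n. ?A j (r n) x)" if x: "x \<in> \<Omega>" for x j
  proof (rule Cauchy_convergent, rule metric_CauchyI)
    fix e :: real assume e: "e > 0"
    have L1: "L j + 1 > 0" using L0[of j] by linarith
    define d where "d = (e / 3) / (L j + 1)"
    have d: "d > 0" using e L1 by (simp add: d_def)
    obtain y where y: "y \<in> T" "dist y x < d" using T(3) x d closure_approachable by blast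
    have "L j * norm (x - y) \<le> (L j + 1) * d"
      using y L0[of j] by (intro mult_mono) (auto simp: dist_norm norm_minus_commute)
    also have "\<dots> = e / 3" using L1 unfolding d_def by (metis less_irrefl nonzero_mult_div_cancel_left times_divide_eq_right)
    finally have Lxy: "\<bar>?A j k x - ?A j k y\<bar> \<le> e / 3" for k using Lip[of j k x y] by linarith
    have "Cauchy (\<lambda>n. ?A j (r n) y)" using conv_T[OF y(1)] by (rule convergent_Cauchy)
    then obtain N where N: "\<And>m n. m \<ge> N \<Longrightarrow> n \<ge> N \<Longrightarrow> \<bar>?A j (r m) y - ?A j (r n) y\<bar> < e / 3"
      using metric_CauchyD[of "\<lambda>n. ?A j (r n) y" "e / 3"] e unfolding dist_real_def by (meson divide_pos_pos zero_less_numeral)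
    have "dist (?A j (r m) x) (?A j (r n) x) < e" if "m \<ge> N" "n \<ge> N" for m n
      unfolding dist_real_def using N[OF that] Lxy[of "r m"] Lxy[of "r n"] by linarith
    then show "\<exists>N. \<forall>m\<ge>N. \<forall>n\<ge>N. dist (?A j (r m) x) (?A j (r n) x) < e" by blast
  qed
  with r(1) show ?thesis using that by blast
qed

lemma ball_avg_LP:
  assumes "\<phi> \<in> test_functions \<Omega>" "h > 0"
  shows "ball_avg z0 h \<phi> \<in> LP M s"
  using LP_diff(1)[OF s_pos(3) test_LP(1)[OF assms(1) s_pos(1)] ball_avg_approximation(1)[OF assms, of z0]] by simp

text \<open>At a fixed scale the averages converge by dominated convergence, and as the scale
  shrinks they approximate the functions uniformly in \<open>k\<close>. Hence the functions
  themselves form a Cauchy sequence.\<close>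

lemma test_compactness:
  assumes \<phi>: "\<And>k. \<phi> k \<in> test_functions \<Omega>" and B: "\<And>k. LP_int M p (grad (\<phi> k)) \<le> B"
  obtains r :: "nat \<Rightarrow> nat" where "strict_mono r"
    "\<And>e. e > 0 \<Longrightarrow> \<exists>N. \<forall>m\<ge>N. \<forall>n\<ge>N. LP_int M s (\<lambda>x. \<phi> (r m) x - \<phi> (r n) x) < e"
proof -
  have B0: "B \<ge> 0" using LP_int_nonneg order_trans B by blast
  have "\<forall>j::nat. \<exists>h. h \<in> {0<..1} \<and> (\<forall>\<phi>\<in>test_functions \<Omega>. LP_int M p (grad \<phi>) \<le> B \<longrightarrow>
      LP_int M s (\<lambda>x. \<phi> x - ball_avg 0 h \<phi> x) \<le> inverse (real (Suc j)))"
  proof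
    fix j :: nat
    have "inverse (real (Suc j)) > 0" by simp
    from ball_avg_approximation_small[OF B0 this]
    show "\<exists>h. h \<in> {0<..1} \<and> (\<forall>\<phi>\<in>test_functions \<Omega>. LP_int M p (grad \<phi>) \<le> B \<longrightarrow>
      LP_int M s (\<lambda>x. \<phi> x - ball_avg 0 h \<phi> x) \<le> inverse (real (Suc j)))" unfolding Bex_def .
  qed
  from choice[OF this] obtain h where hh: "\<And>j. h j \<in> {0<..1} \<and> (\<forall>\<phi>\<in>test_functions \<Omega>. LP_int M p (grad \<phi>) \<le> B \<longrightarrow>
      LP_int M s (\<lambda>x. \<phi> x - ball_avg 0 (h j) \<phi> x) \<le> inverse (real (Suc j)))"
    by blast
  have h: "h j \<in> {0<..1}" for j using hh by blast
  have approx: "LP_int M s (\<lambda>x. \<phi> k x - ball_avg 0 (h j) (\<phi> k) x) \<le> inverse (real (Suc j))" for j k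
    using conjunct2[OF hh[of j]] \<phi>[of k] B[of k] by blast
  have hpos: "h j > 0" for j using h[of j] by simp
  obtain r :: "nat \<Rightarrow> nat" where r: "strict_mono r"
    and conv: "\<And>j x. x \<in> \<Omega> \<Longrightarrow> convergent (\<lambda>k. ball_avg 0 (h j) (\<phi> (r k)) x)"
    using test_ball_avg_convergent[where \<phi>=\<phi> and B=B and h=h, OF \<phi> B h] by blast
  let ?A = "\<lambda>j k. ball_avg 0 (h j) (\<phi> (r k))"
  have A_LP: "?A j k \<in> LP M s" for j k by (rule ball_avg_LP[OF \<phi> hpos])
  have lim: "\<exists>g. g \<in> LP M s \<and> (\<lambda>k. LP_int M s (\<lambda>x. ?A j k x - g x)) \<longlonglongrightarrow> 0" for j
  proof -
    note [measurable] = LP_measurable[OF A_LP]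
    define g where "g x = lim (\<lambda>k. ?A j k x)" for x
    have g[measurable]: "g \<in> borel_measurable M" unfolding g_def by measurable
    have gl: "(\<lambda>k. ?A j k x) \<longlonglongrightarrow> g x" if "x \<in> \<Omega>" for x
      unfolding g_def using conv[OF that] by (simp add: convergent_LIMSEQ_iff)
    obtain C where C: "C \<ge> 0" "\<And>\<phi> x h. \<phi> \<in> test_functions \<Omega> \<Longrightarrow> x \<in> \<Omega> \<Longrightarrow> h \<in> {0<..1} \<Longrightarrow>
        \<bar>ball_avg 0 h \<phi> x\<bar> \<le> C * (ball_const h * (measure M \<Omega> + LP_int M p (grad \<phi>)))"
      using ball_avg_bounded by blast
    let ?b = "C * (ball_const (h j) * (measure M \<Omega> + B))"
    have bc: "ball_const (h j) \<ge> 0" using hpos[of j] by (simp add: ball_const_def)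
    have bd: "\<bar>?A j k x\<bar> \<le> ?b" if "x \<in> \<Omega>" for k x
    proof -
      have "\<bar>?A j k x\<bar> \<le> C * (ball_const (h j) * (measure M \<Omega> + LP_int M p (grad (\<phi> (r k)))))"
        by (rule C(2)[OF \<phi> that h])
      also have "\<dots> \<le> ?b" using bc B C(1) by (intro mult_left_mono add_left_mono) auto
      finally show ?thesis .
    qed
    have gb: "\<bar>g x\<bar> \<le> ?b" if "x \<in> \<Omega>" for x
      by (rule LIMSEQ_le_const2[OF tendsto_rabs[OF gl[OF that]]]) (use bd[OF that] in blast)
    have gLP: "g \<in> LP M s"
    proof -
      have "integrable M (\<lambda>x. norm (g x) powr s)"
        by (rule integrable_const_bound[where B="?b powr s"])
          (use gb s_pos in \<open>auto intro!: AE_I2 powr_mono2\<close>)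
      then show ?thesis by (simp add: LP_def)
    qed
    have "(\<lambda>k. \<integral>x. norm (?A j k x - g x) powr s \<partial>M) \<longlonglongrightarrow> (\<integral>x. 0 \<partial>M)"
    proof (rule integral_dominated_convergence[where w="\<lambda>x. (2 * ?b) powr s"])
      show "AE x in M. (\<lambda>k. norm (?A j k x - g x) powr s) \<longlonglongrightarrow> 0"
      proof (rule AE_I2)
        fix x assume "x \<in> space M"
        then have "(\<lambda>k. norm (?A j k x - g x) powr s) \<longlonglongrightarrow> norm (g x - g x) powr s"
          using s_pos by (intro tendsto_powr' tendsto_norm tendsto_diff tendsto_const gl) auto
        then show "(\<lambda>k. norm (?A j k x - g x) powr s) \<longlonglongrightarrow> 0" by simp
      qed
      show "AE x in M. norm (norm (?A j k x - g x) powr s) \<le> (2 * ?b) powr s" for k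
      proof (rule AE_I2)
        fix x assume "x \<in> space M"
        then have "\<bar>?A j k x\<bar> \<le> ?b" "\<bar>g x\<bar> \<le> ?b" using bd gb by auto
        then have "norm (?A j k x - g x) \<le> 2 * ?b" unfolding real_norm_def by linarith
        then show "norm (norm (?A j k x - g x) powr s) \<le> (2 * ?b) powr s"
          using s_pos by (simp add: powr_mono2)
      qed
    qed measurable
    then show ?thesis using gLP by (intro exI[of _ g] conjI) (simp_all add: LP_int_def)
  qed
  have "\<exists>N. \<forall>m\<ge>N. \<forall>n\<ge>N. LP_int M s (\<lambda>x. \<phi> (r m) x - \<phi> (r n) x) < e" if e: "e > 0" for e
  proof -
    \<comment> \<open>The constant arises from two nested triangle inequalities, one through
      \<open>g\<close> and one through the averages, each with factor
      \<open>2 powr s\<close>.\<close>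
    define c where "c = 2 powr s * (2 powr s * 2 + 2 powr s * 2)"
    define d where "d = e / (c + 1)"
    have c: "c > 0" unfolding c_def by (intro mult_pos_pos add_pos_pos) auto
    have d: "d > 0" using e c by (simp add: d_def)
    obtain j where j: "inverse (real (Suc j)) < d" using reals_Archimedean[OF d] by blast
    obtain g where g: "g \<in> LP M s" "(\<lambda>k. LP_int M s (\<lambda>x. ?A j k x - g x)) \<longlonglongrightarrow> 0" using lim by blast
    obtain N where N: "\<And>k. k \<ge> N \<Longrightarrow> LP_int M s (\<lambda>x. ?A j k x - g x) < d"
      using order_tendstoD(2)[OF g(2) d] by (auto simp: eventually_sequentially)
    note \<phi>LP = test_LP(1)[OF \<phi> s_pos(1)]
    have one: "LP_int M s (\<lambda>x. \<phi> (r m) x - g x) \<le> 2 powr s * (d + d)" if "m \<ge> N" for m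
    proof -
      have "LP_int M s (\<lambda>x. \<phi> (r m) x - g x)
          \<le> 2 powr s * (LP_int M s (\<lambda>x. \<phi> (r m) x - ?A j m x) + LP_int M s (\<lambda>x. ?A j m x - g x))"
        by (rule LP_triangle[OF s_pos(3) \<phi>LP A_LP g(1)])
      also have "\<dots> \<le> 2 powr s * (d + d)"
        using approx[of "r m" j] j N[OF that] by (intro mult_left_mono add_mono) auto
      finally show ?thesis .
    qed
    have "LP_int M s (\<lambda>x. \<phi> (r m) x - \<phi> (r n) x) < e" if "m \<ge> N" "n \<ge> N" for m n
    proof -
      have "LP_int M s (\<lambda>x. \<phi> (r m) x - \<phi> (r n) x)
          \<le> 2 powr s * (LP_int M s (\<lambda>x. \<phi> (r m) x - g x) + LP_int M s (\<lambda>x. g x - \<phi> (r n) x))"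
        by (rule LP_triangle[OF s_pos(3) \<phi>LP g(1) \<phi>LP])
      also have "\<dots> \<le> 2 powr s * (2 powr s * (d + d) + 2 powr s * (d + d))"
        using one that LP_int_minus_commute[of M s g] by (intro mult_left_mono add_mono) auto
      also have "\<dots> = c * d" by (simp add: c_def algebra_simps)
      also have "\<dots> < (c + 1) * d" using d by simp
      also have "\<dots> = e" using c by (simp add: d_def)
      finally show ?thesis .
    qed
    then show ?thesis by blast
  qed
  with r show ?thesis using that by blast
qed

section \<open>The space \<open>W\<^sub>0\<^sup>1\<^sup>,\<^sup>p\<close> as the closure of the graph of the gradient\<close>

text \<open>The gradient is a second component, not a choice depending on \<open>u\<close>: linear
  combinations, limits and energies can then be computed on pairs before anything is known about
  weak derivatives.\<close>

definition W0 :: "('a \<Rightarrow> real) \<Rightarrow> ('a \<Rightarrow> 'a) \<Rightarrow> bool" where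
  "W0 u G \<longleftrightarrow> u \<in> LP M p \<and> G \<in> LP M p \<and> (\<exists>\<phi>. (\<forall>k::nat. \<phi> k \<in> test_functions \<Omega>) \<and>
     (\<lambda>k. LP_int M p (\<lambda>x. \<phi> k x - u x)) \<longlonglongrightarrow> 0 \<and> (\<lambda>k. LP_int M p (\<lambda>x. grad (\<phi> k) x - G x)) \<longlonglongrightarrow> 0)"

lemma W0_LP: "W0 u G \<Longrightarrow> u \<in> LP M p" "W0 u G \<Longrightarrow> G \<in> LP M p"
  unfolding W0_def by auto

lemma W0_approx:
  assumes "W0 u G" "e > 0"
  obtains \<phi> where "\<phi> \<in> test_functions \<Omega>" "LP_int M p (\<lambda>x. \<phi> x - u x) < e" "LP_int M p (\<lambda>x. grad \<phi> x - G x) < e"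
proof -
  obtain \<phi> where \<phi>: "\<And>k::nat. \<phi> k \<in> test_functions \<Omega>" "(\<lambda>k. LP_int M p (\<lambda>x. \<phi> k x - u x)) \<longlonglongrightarrow> 0"
    "(\<lambda>k. LP_int M p (\<lambda>x. grad (\<phi> k) x - G x)) \<longlonglongrightarrow> 0"
    using assms(1) unfolding W0_def by blast
  have "\<forall>\<^sub>F k in sequentially. LP_int M p (\<lambda>x. \<phi> k x - u x) < e \<and> LP_int M p (\<lambda>x. grad (\<phi> k) x - G x) < e"
    using order_tendstoD(2)[OF \<phi>(2) assms(2)] order_tendstoD(2)[OF \<phi>(3) assms(2)] by (rule eventually_conj)
  then show ?thesis using that \<phi>(1) by (auto simp: eventually_sequentially)
qed

lemma W0I:
  assumes "u \<in> LP M p" "G \<in> LP M p"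
    and "\<And>e. e > 0 \<Longrightarrow> \<exists>\<phi>\<in>test_functions \<Omega>. LP_int M p (\<lambda>x. \<phi> x - u x) < e \<and> LP_int M p (\<lambda>x. grad \<phi> x - G x) < e"
  shows "W0 u G"
proof -
  have "\<forall>k::nat. \<exists>\<phi>\<in>test_functions \<Omega>. LP_int M p (\<lambda>x. \<phi> x - u x) < inverse (real (Suc k)) \<and>
      LP_int M p (\<lambda>x. grad \<phi> x - G x) < inverse (real (Suc k))"
    using assms(3) by simp
  then obtain \<phi> where \<phi>: "\<And>k. \<phi> k \<in> test_functions \<Omega>" "\<And>k. LP_int M p (\<lambda>x. \<phi> k x - u x) < inverse (real (Suc k))"
    "\<And>k. LP_int M p (\<lambda>x. grad (\<phi> k) x - G x) < inverse (real (Suc k))"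
    by metis
  have null: "a \<longlonglongrightarrow> 0" if "\<And>k. 0 \<le> a k" "\<And>k. a k < inverse (real (Suc k))" for a :: "nat \<Rightarrow> real"
    by (rule tendsto_sandwich[OF _ _ tendsto_const LIMSEQ_inverse_real_of_nat])
      (use that less_imp_le in \<open>blast intro: always_eventually\<close>)+
  have "(\<lambda>k. LP_int M p (\<lambda>x. \<phi> k x - u x)) \<longlonglongrightarrow> 0" "(\<lambda>k. LP_int M p (\<lambda>x. grad (\<phi> k) x - G x)) \<longlonglongrightarrow> 0"
    by (rule null, rule LP_int_nonneg, rule \<phi>)+
  then show ?thesis unfolding W0_def using assms(1,2) \<phi>(1) by blast
qed

lemma W0_test: "\<phi> \<in> test_functions \<Omega> \<Longrightarrow> W0 \<phi> (grad \<phi>)"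
  using test_LP[of \<phi> p] p_pos by (intro W0I) (auto simp: LP_int_def intro!: bexI[of _ \<phi>])

lemma LP_lincomb:
  fixes f g :: "'a \<Rightarrow> 'b::euclidean_space"
  assumes "r \<ge> 0" "f \<in> LP M r" "g \<in> LP M r"
  shows "(\<lambda>x. c *\<^sub>R f x + d *\<^sub>R g x) \<in> LP M r"
  using LP_add(1)[OF assms(1) LP_scaleR[OF assms(2)] LP_scaleR[OF assms(3)]] .

lemma LP_int_lincomb:
  fixes f g :: "'a \<Rightarrow> 'b::euclidean_space"
  assumes "r \<ge> 0" "f \<in> LP M r" "g \<in> LP M r" "f' \<in> LP M r" "g' \<in> LP M r"
  shows "LP_int M r (\<lambda>x. (c *\<^sub>R f x + d *\<^sub>R g x) - (c *\<^sub>R f' x + d *\<^sub>R g' x))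
    \<le> 2 powr r * (\<bar>c\<bar> powr r * LP_int M r (\<lambda>x. f x - f' x) + \<bar>d\<bar> powr r * LP_int M r (\<lambda>x. g x - g' x))"
proof -
  have eq: "(c *\<^sub>R f x + d *\<^sub>R g x) - (c *\<^sub>R f' x + d *\<^sub>R g' x) = c *\<^sub>R (f x - f' x) + d *\<^sub>R (g x - g' x)" for x
    by (simp add: scaleR_diff_right)
  show ?thesis
    unfolding eq LP_int_scaleR[symmetric] using assms by (intro LP_add LP_scaleR LP_diff)
qed

lemma W0_lincomb:
  assumes u: "W0 u G" and v: "W0 v H"
  shows "W0 (\<lambda>x. c * u x + d * v x) (\<lambda>x. c *\<^sub>R G x + d *\<^sub>R H x)"
proof (rule W0I)
  note LPs = W0_LP[OF u] W0_LP[OF v]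
  show "(\<lambda>x. c * u x + d * v x) \<in> LP M p" "(\<lambda>x. c *\<^sub>R G x + d *\<^sub>R H x) \<in> LP M p"
    using LP_lincomb[OF p_pos(3) LPs(1,3), of c d] LP_lincomb[OF p_pos(3) LPs(2,4), of c d] by auto
  fix e :: real assume e: "e > 0"
  define K where "K = 2 powr p * (\<bar>c\<bar> powr p + \<bar>d\<bar> powr p)"
  have K: "K \<ge> 0" unfolding K_def by simp
  define e' where "e' = e / (K + 1)"
  have e': "e' > 0" using e K by (simp add: e'_def)
  have Ke: "K * e' < e"
  proof -
    have "K * e' < (K + 1) * e'" using e' by simp
    also have "\<dots> = e" using K by (simp add: e'_def)
    finally show ?thesis .
  qed
  obtain \<phi> where \<phi>: "\<phi> \<in> test_functions \<Omega>" "LP_int M p (\<lambda>x. \<phi> x - u x) < e'" "LP_int M p (\<lambda>x. grad \<phi> x - G x) < e'"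
    using W0_approx[OF u e'] by blast
  obtain \<psi> where \<psi>: "\<psi> \<in> test_functions \<Omega>" "LP_int M p (\<lambda>x. \<psi> x - v x) < e'" "LP_int M p (\<lambda>x. grad \<psi> x - H x) < e'"
    using W0_approx[OF v e'] by blast
  note T = test_LP[OF \<phi>(1) p_pos(1)] test_LP[OF \<psi>(1) p_pos(1)]
  have *: "2 powr p * (\<bar>c\<bar> powr p * X + \<bar>d\<bar> powr p * Y) < e" if "X < e'" "Y < e'" for X Y
  proof -
    have "2 powr p * (\<bar>c\<bar> powr p * X + \<bar>d\<bar> powr p * Y) \<le> 2 powr p * (\<bar>c\<bar> powr p * e' + \<bar>d\<bar> powr p * e')"
      using that by (intro mult_left_mono add_mono) auto
    also have "\<dots> = K * e'" by (simp add: K_def algebra_simps)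
    finally show ?thesis using Ke by simp
  qed
  show "\<exists>\<phi>\<in>test_functions \<Omega>. LP_int M p (\<lambda>x. \<phi> x - (c * u x + d * v x)) < e \<and>
      LP_int M p (\<lambda>x. grad \<phi> x - (c *\<^sub>R G x + d *\<^sub>R H x)) < e"
  proof (intro bexI conjI)
    show "(\<lambda>x. c * \<phi> x + d * \<psi> x) \<in> test_functions \<Omega>"
      by (rule test_functions_lincomb(1)[OF \<phi>(1) \<psi>(1)])
    show "LP_int M p (\<lambda>x. (c * \<phi> x + d * \<psi> x) - (c * u x + d * v x)) < e"
      using LP_int_lincomb[OF p_pos(3) T(1,3) LPs(1,3), of c d] *[OF \<phi>(2) \<psi>(2)] by simp
    show "LP_int M p (\<lambda>x. grad (\<lambda>x. c * \<phi> x + d * \<psi> x) x - (c *\<^sub>R G x + d *\<^sub>R H x)) < e"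
      using LP_int_lincomb[OF p_pos(3) T(2,4) LPs(2,4), of c d] *[OF \<phi>(3) \<psi>(3)]
      unfolding test_functions_lincomb(2)[OF \<phi>(1) \<psi>(1)] by simp
  qed
qed

lemma W0_closed:
  assumes W: "\<And>k::nat. W0 (u k) (G k)" and v: "v \<in> LP M p" "H \<in> LP M p"
    and lim: "(\<lambda>k. LP_int M p (\<lambda>x. u k x - v x)) \<longlonglongrightarrow> 0" "(\<lambda>k. LP_int M p (\<lambda>x. G k x - H x)) \<longlonglongrightarrow> 0"
  shows "W0 v H"
proof (rule W0I[OF v])
  fix e :: real assume e: "e > 0"
  define e' where "e' = e / (2 powr p * 2)"
  have e': "e' > 0" using e by (simp add: e'_def)
  have "\<forall>\<^sub>F k in sequentially. LP_int M p (\<lambda>x. u k x - v x) < e' \<and> LP_int M p (\<lambda>x. G k x - H x) < e'"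
    using order_tendstoD(2)[OF lim(1) e'] order_tendstoD(2)[OF lim(2) e'] by (rule eventually_conj)
  then obtain k where k: "LP_int M p (\<lambda>x. u k x - v x) < e'" "LP_int M p (\<lambda>x. G k x - H x) < e'"
    by (auto simp: eventually_sequentially)
  obtain \<phi> where \<phi>: "\<phi> \<in> test_functions \<Omega>" "LP_int M p (\<lambda>x. \<phi> x - u k x) < e'" "LP_int M p (\<lambda>x. grad \<phi> x - G k x) < e'"
    using W0_approx[OF W e'] by blast
  note T = test_LP[OF \<phi>(1) p_pos(1)]
  have *: "2 powr p * (X + Y) < e" if "X < e'" "Y < e'" for X Y
  proof -
    have "2 powr p * (X + Y) < 2 powr p * (e' + e')" using that by (intro mult_strict_left_mono) auto
    also have "\<dots> = e" by (simp add: e'_def)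
    finally show ?thesis .
  qed
  show "\<exists>\<phi>\<in>test_functions \<Omega>. LP_int M p (\<lambda>x. \<phi> x - v x) < e \<and> LP_int M p (\<lambda>x. grad \<phi> x - H x) < e"
    using LP_triangle[OF p_pos(3) T(1) W0_LP(1)[OF W] v(1), of k] *[OF \<phi>(2) k(1)]
      LP_triangle[OF p_pos(3) T(2) W0_LP(2)[OF W] v(2), of k] *[OF \<phi>(3) k(2)] \<phi>(1)
    by (intro bexI[of _ \<phi>]) auto
qed

lemma LP_int_eq_0_AE:
  assumes "f \<in> LP M r" "LP_int M r f = 0"
  shows "AE x in M. f x = 0"
proof -
  have "AE x in M. norm (f x) powr r = 0"
    using integral_nonneg_eq_0_iff_AE[OF LP_integrable[OF assms(1)]] assms(2) by (simp add: LP_int_def)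
  then show ?thesis by eventually_elim simp
qed

lemma LP_lim_unique:
  fixes f :: "nat \<Rightarrow> 'a \<Rightarrow> 'b::euclidean_space"
  assumes r: "r \<ge> 0" and LPs: "\<And>k. f k \<in> LP M r" "g \<in> LP M r" "h \<in> LP M r"
    and lim: "(\<lambda>k. LP_int M r (\<lambda>x. f k x - g x)) \<longlonglongrightarrow> 0" "(\<lambda>k. LP_int M r (\<lambda>x. f k x - h x)) \<longlonglongrightarrow> 0"
  shows "AE x in M. g x = h x"
proof -
  have 1: "(\<lambda>k. 2 powr r * (LP_int M r (\<lambda>x. f k x - g x) + LP_int M r (\<lambda>x. f k x - h x))) \<longlonglongrightarrow> 2 powr r * (0 + 0)"
    by (intro tendsto_intros lim)
  have 2: "LP_int M r (\<lambda>x. g x - h x) \<le> 2 powr r * (LP_int M r (\<lambda>x. f k x - g x) + LP_int M r (\<lambda>x. f k x - h x))" for k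
    using LP_triangle[OF r LPs(2) LPs(1) LPs(3), of k] LP_int_minus_commute[of M r g "f k"] by simp
  have "LP_int M r (\<lambda>x. g x - h x) \<le> 2 powr r * (0 + 0)"
    by (rule LIMSEQ_le_const[OF 1]) (use 2 in blast)
  then have "LP_int M r (\<lambda>x. g x - h x) = 0" using LP_int_nonneg[of M r "\<lambda>x. g x - h x"] by simp
  then have "AE x in M. g x - h x = 0" by (rule LP_int_eq_0_AE[OF LP_diff(1)[OF r LPs(2,3)]])
  then show ?thesis by simp
qed

lemma LP_cong_AE:
  assumes "AE x in M. f x = g x" "f \<in> LP M r" "g \<in> borel_measurable M"
  shows "g \<in> LP M r"
proof -
  have "integrable M (\<lambda>x. norm (g x) powr r) \<longleftrightarrow> integrable M (\<lambda>x. norm (f x) powr r)"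
    using assms(1) LP_measurable[OF assms(2)] assms(3) by (intro integrable_cong_AE) (auto elim!: eventually_mono)
  then show ?thesis using assms by (simp add: LP_def)
qed

lemma LP_int_cong_AE:
  assumes "AE x in M. f x = g x" "f \<in> borel_measurable M" "g \<in> borel_measurable M"
  shows "LP_int M r f = LP_int M r g"
  unfolding LP_int_def using assms by (intro integral_cong_AE) (auto elim!: eventually_mono)

section \<open>Sobolev embedding and Rellich compactness on the closure\<close>

lemma LP_convergent_Cauchy:
  fixes f :: "nat \<Rightarrow> 'a \<Rightarrow> 'b::euclidean_space"
  assumes r: "r \<ge> 0" and LPs: "\<And>k. f k \<in> LP M r" "g \<in> LP M r"
    and lim: "(\<lambda>k. LP_int M r (\<lambda>x. f k x - g x)) \<longlonglongrightarrow> 0" and e: "e > 0"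
  shows "\<exists>N. \<forall>m\<ge>N. \<forall>n\<ge>N. LP_int M r (\<lambda>x. f m x - f n x) < e"
proof -
  define e' where "e' = e / (2 powr r * 2)"
  have e': "e' > 0" using e by (simp add: e'_def)
  obtain N where N: "\<And>k. k \<ge> N \<Longrightarrow> LP_int M r (\<lambda>x. f k x - g x) < e'"
    using order_tendstoD(2)[OF lim e'] by (auto simp: eventually_sequentially)
  have "LP_int M r (\<lambda>x. f m x - f n x) < e" if "m \<ge> N" "n \<ge> N" for m n
  proof -
    have "LP_int M r (\<lambda>x. f m x - f n x) \<le> 2 powr r * (LP_int M r (\<lambda>x. f m x - g x) + LP_int M r (\<lambda>x. f n x - g x))"
      using LP_triangle[OF r LPs(1) LPs(2) LPs(1), of m n] LP_int_minus_commute[of M r g "f n"] by simp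
    also have "\<dots> < 2 powr r * (e' + e')" using N that by (intro mult_strict_left_mono add_strict_mono) auto
    also have "\<dots> = e" by (simp add: e'_def)
    finally show ?thesis .
  qed
  then show ?thesis by blast
qed

text \<open>The Sobolev inequality for differences of test functions turns the Cauchy property of
  the gradients into one in the exponent \<open>s\<close>. The limit found there is also a limit in
  the exponent \<open>p\<close>, hence equals \<open>u\<close> almost everywhere.\<close>

lemma W0_Sobolev_approx:
  assumes u: "u \<in> LP M p" "G \<in> LP M p" and \<phi>: "\<And>k::nat. \<phi> k \<in> test_functions \<Omega>"
    and lim: "(\<lambda>k. LP_int M p (\<lambda>x. \<phi> k x - u x)) \<longlonglongrightarrow> 0" "(\<lambda>k. LP_int M p (\<lambda>x. grad (\<phi> k) x - G x)) \<longlonglongrightarrow> 0"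
  shows "u \<in> LP M s" "(\<lambda>k. LP_int M s (\<lambda>x. \<phi> k x - u x)) \<longlonglongrightarrow> 0"
proof -
  obtain C where C: "C \<ge> 0" "\<And>\<phi>. \<phi> \<in> test_functions \<Omega> \<Longrightarrow> LP_int M s \<phi> \<le> C * LP_int M p (grad \<phi>) powr (s / p)"
    using Sobolev_test by blast
  note T = test_LP[OF \<phi>]
  have Cauchy: "\<exists>N. \<forall>m\<ge>N. \<forall>n\<ge>N. LP_int M s (\<lambda>x. \<phi> m x - \<phi> n x) < e" if e: "e > 0" for e
  proof -
    \<comment> \<open>Chosen so that \<open>C * d powr (s / p)\<close> equals
      \<open>C * (e / (C + 1))\<close>, which is below \<open>e\<close> also when
      \<open>C = 0\<close>.\<close>
    define d where "d = (e / (C + 1)) powr (p / s)"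
    have d: "d > 0" using e C(1) by (simp add: d_def)
    obtain N where N: "\<And>m n. m \<ge> N \<Longrightarrow> n \<ge> N \<Longrightarrow> LP_int M p (\<lambda>x. grad (\<phi> m) x - grad (\<phi> n) x) < d"
      using LP_convergent_Cauchy[where f="\<lambda>k. grad (\<phi> k)" and g=G, OF p_pos(3) T(2)[OF p_pos(1)] u(2) lim(2) d] by blast
    have "LP_int M s (\<lambda>x. \<phi> m x - \<phi> n x) < e" if "m \<ge> N" "n \<ge> N" for m n
    proof -
      have t: "(\<lambda>x. \<phi> m x - \<phi> n x) \<in> test_functions \<Omega>"
        "grad (\<lambda>x. \<phi> m x - \<phi> n x) = (\<lambda>x. grad (\<phi> m) x - grad (\<phi> n) x)"
        using test_functions_lincomb[OF \<phi> \<phi>, of 1 m "-1" n] by auto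
      have "LP_int M s (\<lambda>x. \<phi> m x - \<phi> n x) \<le> C * LP_int M p (\<lambda>x. grad (\<phi> m) x - grad (\<phi> n) x) powr (s / p)"
        using C(2)[OF t(1)] unfolding t(2) .
      also have "\<dots> \<le> C * d powr (s / p)"
        using C(1) N[OF that] p_pos s_pos LP_int_nonneg by (intro mult_left_mono powr_mono2) (auto intro: less_imp_le)
      also have "d powr (s / p) = e / (C + 1)" using e C(1) p_pos s_pos by (simp add: d_def powr_powr)
      also have "C * (e / (C + 1)) < e" using e C(1) by (simp add: field_simps)
      finally show ?thesis .
    qed
    then show ?thesis by blast
  qed
  obtain v where v: "v \<in> LP M s" "(\<lambda>k. LP_int M s (\<lambda>x. \<phi> k x - v x)) \<longlonglongrightarrow> 0"
    using LP_complete[where f=\<phi>, OF s_pos(1) T(1)[OF s_pos(1)] Cauchy] by blast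
  have vp: "v \<in> LP M p" by (rule LP_mono[OF p_pos(1) ps v(1)])
  have "(\<lambda>k. LP_int M p (\<lambda>x. \<phi> k x - v x)) \<longlonglongrightarrow> 0"
    by (rule LP_lim_mono[OF p_pos(1) ps T(1)[OF s_pos(1)] v])
  then have uv: "AE x in M. v x = u x"
    by (rule LP_lim_unique[OF p_pos(3) T(1)[OF p_pos(1)] vp u(1) _ lim(1)])
  note [measurable] = LP_measurable[OF u(1)] LP_measurable[OF vp] LP_measurable[OF T(1)[OF p_pos(1)]]
  show "u \<in> LP M s" by (rule LP_cong_AE[OF uv v(1)]) measurable
  have "LP_int M s (\<lambda>x. \<phi> k x - v x) = LP_int M s (\<lambda>x. \<phi> k x - u x)" for k
    using uv by (intro LP_int_cong_AE) (auto elim!: eventually_mono)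
  then show "(\<lambda>k. LP_int M s (\<lambda>x. \<phi> k x - u x)) \<longlonglongrightarrow> 0" using v(2) by simp
qed

lemma W0_Sobolev: "\<exists>C>0. \<forall>u G. W0 u G \<longrightarrow> u \<in> LP M s \<and> LP_int M s u \<le> C * LP_int M p G powr (s / p)"
proof -
  obtain C where C: "C \<ge> 0" "\<And>\<phi>. \<phi> \<in> test_functions \<Omega> \<Longrightarrow> LP_int M s \<phi> \<le> C * LP_int M p (grad \<phi>) powr (s / p)"
    using Sobolev_test by blast
  have "u \<in> LP M s \<and> LP_int M s u \<le> (C + 1) * LP_int M p G powr (s / p)" if W: "W0 u G" for u G
  proof -
    obtain \<phi> where \<phi>: "\<And>k::nat. \<phi> k \<in> test_functions \<Omega>" "(\<lambda>k. LP_int M p (\<lambda>x. \<phi> k x - u x)) \<longlonglongrightarrow> 0"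
      "(\<lambda>k. LP_int M p (\<lambda>x. grad (\<phi> k) x - G x)) \<longlonglongrightarrow> 0"
      using W unfolding W0_def by blast
    note approx = W0_Sobolev_approx[OF W0_LP[OF W] \<phi>]
    have 1: "(\<lambda>k. LP_int M s (\<phi> k)) \<longlonglongrightarrow> LP_int M s u"
      by (rule LP_int_tendsto[OF s_pos(1) test_LP(1)[OF \<phi>(1) s_pos(1)] approx])
    have "(\<lambda>k. LP_int M p (grad (\<phi> k))) \<longlonglongrightarrow> LP_int M p G"
      by (rule LP_int_tendsto[OF p_pos(1) test_LP(2)[OF \<phi>(1) p_pos(1)] W0_LP(2)[OF W] \<phi>(3)])
    then have 2: "(\<lambda>k. C * LP_int M p (grad (\<phi> k)) powr (s / p)) \<longlonglongrightarrow> C * LP_int M p G powr (s / p)"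
      using p_pos s_pos by (intro tendsto_intros tendsto_powr') (auto intro!: always_eventually simp: LP_int_nonneg)
    have "LP_int M s u \<le> C * LP_int M p G powr (s / p)"
      by (rule LIMSEQ_le[OF 1 2]) (use C(2) \<phi>(1) in auto)
    \<comment> \<open>The enlarged constant is strictly positive, as needed when it is divided by
      later.\<close>
    also have "\<dots> \<le> (C + 1) * LP_int M p G powr (s / p)" by (intro mult_right_mono) auto
    finally show ?thesis using approx(1) by simp
  qed
  then show ?thesis using C(1) by (intro exI[of _ "C + 1"]) auto
qed

text \<open>Each \<open>u k\<close> is replaced by a test function whose gradient is at bounded
  distance and whose distance in the exponent \<open>s\<close> tends to \<open>0\<close>.
  Compactness for test functions then transfers, because the two sequences have the same
  limit.\<close>

lemma W0_Rellich:
  assumes W: "\<And>k::nat. W0 (u k) (G k)" and B: "\<And>k. LP_int M p (G k) \<le> B"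
  obtains r v where "strict_mono (r :: nat \<Rightarrow> nat)" "v \<in> LP M s" "(\<lambda>k. LP_int M s (\<lambda>x. u (r k) x - v x)) \<longlonglongrightarrow> 0"
proof -
  have "\<exists>\<phi>\<in>test_functions \<Omega>. LP_int M p (\<lambda>x. grad \<phi> x - G k x) \<le> 1 \<and> LP_int M s (\<lambda>x. \<phi> x - u k x) \<le> inverse (real (Suc k))" for k
  proof -
    obtain \<phi> where \<phi>: "\<And>k::nat. \<phi> k \<in> test_functions \<Omega>" "(\<lambda>j. LP_int M p (\<lambda>x. \<phi> j x - u k x)) \<longlonglongrightarrow> 0"
      "(\<lambda>j. LP_int M p (\<lambda>x. grad (\<phi> j) x - G k x)) \<longlonglongrightarrow> 0"
      using W[of k] unfolding W0_def by blast
    note approx = W0_Sobolev_approx(2)[OF W0_LP[OF W[of k]] \<phi>]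
    have "\<forall>\<^sub>F j in sequentially. LP_int M p (\<lambda>x. grad (\<phi> j) x - G k x) < 1 \<and> LP_int M s (\<lambda>x. \<phi> j x - u k x) < inverse (real (Suc k))"
      by (intro eventually_conj order_tendstoD(2)[OF \<phi>(3)] order_tendstoD(2)[OF approx]) auto
    then show ?thesis using \<phi>(1) by (auto simp: eventually_sequentially intro: less_imp_le)
  qed
  then obtain \<phi> where \<phi>: "\<And>k. \<phi> k \<in> test_functions \<Omega>" "\<And>k. LP_int M p (\<lambda>x. grad (\<phi> k) x - G k x) \<le> 1"
    "\<And>k. LP_int M s (\<lambda>x. \<phi> k x - u k x) \<le> inverse (real (Suc k))"
    by metis
  have "LP_int M p (grad (\<phi> k)) \<le> 2 powr p * (1 + B)" for k
  proof -
    have "LP_int M p (grad (\<phi> k)) \<le> 2 powr p * (LP_int M p (\<lambda>x. grad (\<phi> k) x - G k x) + LP_int M p (G k))"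
      using LP_add(2)[OF p_pos(3) LP_diff(1)[OF p_pos(3) test_LP(2)[OF \<phi>(1) p_pos(1)] W0_LP(2)[OF W]] W0_LP(2)[OF W], of k k k] by simp
    also have "\<dots> \<le> 2 powr p * (1 + B)" using \<phi>(2) B by (intro mult_left_mono add_mono) auto
    finally show ?thesis .
  qed
  then obtain r :: "nat \<Rightarrow> nat" where r: "strict_mono r"
    and Cauchy: "\<And>e. e > 0 \<Longrightarrow> \<exists>N. \<forall>m\<ge>N. \<forall>n\<ge>N. LP_int M s (\<lambda>x. \<phi> (r m) x - \<phi> (r n) x) < e"
    using test_compactness[where \<phi>=\<phi>, OF \<phi>(1)] by blast
  note T = test_LP(1)[OF \<phi>(1) s_pos(1)]
  obtain v where v: "v \<in> LP M s" "(\<lambda>k. LP_int M s (\<lambda>x. \<phi> (r k) x - v x)) \<longlonglongrightarrow> 0"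
    using LP_complete[where f="\<lambda>k. \<phi> (r k)", OF s_pos(1) T Cauchy] by blast
  have us: "u k \<in> LP M s" for k using W0_Sobolev W by blast
  have "(\<lambda>k. LP_int M s (\<lambda>x. \<phi> k x - u k x)) \<longlonglongrightarrow> 0"
    by (rule tendsto_sandwich[OF _ _ tendsto_const LIMSEQ_inverse_real_of_nat])
      (use \<phi>(3) LP_int_nonneg in \<open>auto intro!: always_eventually\<close>)
  from LIMSEQ_subseq_LIMSEQ[OF this r]
  have lim: "(\<lambda>k. LP_int M s (\<lambda>x. \<phi> (r k) x - u (r k) x)) \<longlonglongrightarrow> 0" by (simp add: o_def)
  have "(\<lambda>k. LP_int M s (\<lambda>x. u (r k) x - v x)) \<longlonglongrightarrow> 0"
  proof (rule tendsto_sandwich[OF _ _ tendsto_const])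
    show "(\<lambda>k. 2 powr s * (LP_int M s (\<lambda>x. \<phi> (r k) x - u (r k) x) + LP_int M s (\<lambda>x. \<phi> (r k) x - v x))) \<longlonglongrightarrow> 0"
      using tendsto_mult_left[OF tendsto_add[OF lim v(2)], of "2 powr s"] by simp
    show "\<forall>\<^sub>F k in sequentially. LP_int M s (\<lambda>x. u (r k) x - v x)
        \<le> 2 powr s * (LP_int M s (\<lambda>x. \<phi> (r k) x - u (r k) x) + LP_int M s (\<lambda>x. \<phi> (r k) x - v x))"
    proof (rule always_eventually, rule allI)
      fix k
      show "LP_int M s (\<lambda>x. u (r k) x - v x) \<le> 2 powr s * (LP_int M s (\<lambda>x. \<phi> (r k) x - u (r k) x) + LP_int M s (\<lambda>x. \<phi> (r k) x - v x))"
        using LP_triangle[OF s_pos(3) us T v(1), of "r k" "r k"] LP_int_minus_commute[of M s "u (r k)" "\<phi> (r k)"] by simp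
    qed
  qed (simp add: LP_int_nonneg)
  with r v(1) show ?thesis using that by blast
qed

section \<open>Uniform convexity and lower semicontinuity of the energy\<close>

lemma LP_int_Clarkson:
  fixes f g :: "'a \<Rightarrow> 'b::euclidean_space"
  assumes "f \<in> LP M p" "g \<in> LP M p"
  shows "LP_int M p (\<lambda>x. f x - g x)
    \<le> 2 powr p * ((LP_int M p f + LP_int M p g) / 2 - LP_int M p (\<lambda>x. (1/2) *\<^sub>R f x + (1/2) *\<^sub>R g x))"
proof -
  have sum: "(\<lambda>x. (1/2) *\<^sub>R (f x + g x)) \<in> LP M p" and diff: "(\<lambda>x. (1/2) *\<^sub>R (f x - g x)) \<in> LP M p"
    using LP_scaleR[OF LP_add(1)[OF p_pos(3) assms]] LP_scaleR[OF LP_diff(1)[OF p_pos(3) assms]] by blast+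
  have "LP_int M p (\<lambda>x. (1/2) *\<^sub>R (f x + g x)) + LP_int M p (\<lambda>x. (1/2) *\<^sub>R (f x - g x))
      = (\<integral>x. norm ((1/2) *\<^sub>R (f x + g x)) powr p + norm ((1/2) *\<^sub>R (f x - g x)) powr p \<partial>M)"
    unfolding LP_int_def by (rule Bochner_Integration.integral_add[symmetric, OF LP_integrable[OF sum] LP_integrable[OF diff]])
  also have "\<dots> \<le> (\<integral>x. (norm (f x) powr p + norm (g x) powr p) / 2 \<partial>M)"
  proof (rule integral_mono)
    show "integrable M (\<lambda>x. norm ((1/2) *\<^sub>R (f x + g x)) powr p + norm ((1/2) *\<^sub>R (f x - g x)) powr p)"
      by (rule Bochner_Integration.integrable_add[OF LP_integrable[OF sum] LP_integrable[OF diff]])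
    show "integrable M (\<lambda>x. (norm (f x) powr p + norm (g x) powr p) / 2)"
      using LP_integrable[OF assms(1)] LP_integrable[OF assms(2)] by simp
  qed (rule Clarkson_pointwise[OF p2])
  also have "\<dots> = (LP_int M p f + LP_int M p g) / 2"
    unfolding LP_int_def using LP_integrable[OF assms(1)] LP_integrable[OF assms(2)] by simp
  also have "LP_int M p (\<lambda>x. (1/2) *\<^sub>R (f x - g x)) = (1/2) powr p * LP_int M p (\<lambda>x. f x - g x)"
    using LP_int_scaleR[of M p "1/2" "\<lambda>x. f x - g x"] by simp
  finally have "(1/2) powr p * LP_int M p (\<lambda>x. f x - g x)
      \<le> (LP_int M p f + LP_int M p g) / 2 - LP_int M p (\<lambda>x. (1/2) *\<^sub>R f x + (1/2) *\<^sub>R g x)"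
    unfolding scaleR_add_right by argo
  from mult_left_mono[OF this, of "2 powr p"]
  show ?thesis by (simp add: powr_divide)
qed

text \<open>The role of weak compactness is played by uniform convexity: elements of almost minimal energy
  among those that are \<open>L\<^sup>s\<close>-close to \<open>v\<close> have a gradient that is Cauchy by Clarkson's inequality.\<close>

lemma W0_lower_semicontinuous:
  assumes W: "\<And>k::nat. W0 (u k) (G k)" and v: "v \<in> LP M s" and lim: "(\<lambda>k. LP_int M s (\<lambda>x. u k x - v x)) \<longlonglongrightarrow> 0"
    and en: "(\<lambda>k. LP_int M p (G k)) \<longlonglongrightarrow> e"
  obtains H where "W0 v H" "LP_int M p H \<le> e"
proof -
  have W_LPs: "w \<in> LP M s" if "W0 w H" for w H using W0_Sobolev that by blast
  \<comment> \<open>Shrinking neighbourhoods of \<open>v\<close> within the closure. Their infimal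
    energies \<open>m n\<close> increase with \<open>n\<close> and stay below \<open>e\<close>, so
    they converge.\<close>
  define S where "S n = {(w, H). W0 w H \<and> LP_int M s (\<lambda>x. w x - v x) \<le> inverse (real (Suc n))}" for n
  define m where "m n = (INF wH\<in>S n. LP_int M p (snd wH))" for n
  have bdd: "bdd_below ((\<lambda>wH. LP_int M p (snd wH)) ` S n)" for n
    by (rule bdd_belowI2[of _ 0]) (rule LP_int_nonneg)
  have ne: "\<exists>wH\<in>S n. LP_int M p (snd wH) < e + d" if d: "d > 0" for n d
  proof -
    have "\<forall>\<^sub>F k in sequentially. LP_int M s (\<lambda>x. u k x - v x) < inverse (real (Suc n)) \<and> LP_int M p (G k) < e + d"
      using d by (intro eventually_conj order_tendstoD(2)[OF lim] order_tendstoD(2)[OF en]) auto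
    then obtain k where "LP_int M s (\<lambda>x. u k x - v x) < inverse (real (Suc n))" "LP_int M p (G k) < e + d"
      by (auto simp: eventually_sequentially)
    then show ?thesis using W[of k] by (intro bexI[of _ "(u k, G k)"]) (auto simp: S_def)
  qed
  have nonempty: "S n \<noteq> {}" for n using ne[of 1 n] by auto
  have m_le: "m n \<le> e" for n
  proof (rule field_le_epsilon)
    fix d :: real assume "d > 0"
    then obtain wH where "wH \<in> S n" "LP_int M p (snd wH) < e + d" using ne by blast
    then show "m n \<le> e + d" unfolding m_def using cINF_lower[OF bdd[of n], of wH] by linarith
  qed
  have S_mono: "S k \<subseteq> S n" if "n \<le> k" for n k
  proof -
    have "inverse (real (Suc k)) \<le> inverse (real (Suc n))" using that by (intro le_imp_inverse_le) auto
    then show ?thesis unfolding S_def by (auto simp del: of_nat_Suc elim: order_trans)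
  qed
  have m_mono: "m n \<le> m k" if "n \<le> k" for n k
    unfolding m_def by (rule cINF_superset_mono[OF nonempty bdd S_mono[OF that]]) simp
  obtain ml where ml: "m \<longlonglongrightarrow> ml" and m_le_ml: "\<And>n. m n \<le> ml"
    using incseq_convergent[of m e] m_mono m_le by (auto simp: incseq_def)
  have "\<exists>wH\<in>S n. LP_int M p (snd wH) < m n + inverse (real (Suc n))" for n
    unfolding m_def using nonempty bdd by (subst cINF_less_iff[symmetric]) auto
  then obtain wH where wH: "\<And>n. wH n \<in> S n" "\<And>n. LP_int M p (snd (wH n)) < m n + inverse (real (Suc n))"
    by metis
  define w where "w n = fst (wH n)" for n
  define H where "H n = snd (wH n)" for n
  have wW: "W0 (w n) (H n)" and wv: "LP_int M s (\<lambda>x. w n x - v x) \<le> inverse (real (Suc n))" for n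
    using wH(1)[of n] by (auto simp: S_def w_def H_def split: prod.splits)
  have H_small: "LP_int M p (H n) < m n + inverse (real (Suc n))" for n using wH(2) by (simp add: H_def)
  have Cauchy: "\<exists>N. \<forall>k\<ge>N. \<forall>l\<ge>N. LP_int M p (\<lambda>x. H k x - H l x) < d" if d: "d > 0" for d
  proof -
    have "(\<lambda>n. 2 powr p * (ml + inverse (real (Suc n)) - m n)) \<longlonglongrightarrow> 2 powr p * (ml + 0 - ml)"
      by (intro tendsto_intros ml LIMSEQ_inverse_real_of_nat)
    then have "(\<lambda>n. 2 powr p * (ml + inverse (real (Suc n)) - m n)) \<longlonglongrightarrow> 0" by simp
    from order_tendstoD(2)[OF this d] obtain N where N: "2 powr p * (ml + inverse (real (Suc N)) - m N) < d"
      by (auto simp: eventually_sequentially)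
    have "LP_int M p (\<lambda>x. H k x - H l x) < d" if kl: "k \<ge> N" "l \<ge> N" for k l
    proof -
      have inv: "inverse (real (Suc k)) \<le> inverse (real (Suc N))" "inverse (real (Suc l)) \<le> inverse (real (Suc N))"
        using kl by (intro le_imp_inverse_le; simp)+
      \<comment> \<open>The midpoint of two members of \<open>S N\<close> remains in
        \<open>S N\<close>, so its energy is at least \<open>m N\<close>. Clarkson's inequality then
        bounds the distance of the two gradients by their excess over \<open>m N\<close>.\<close>
      have "LP_int M s (\<lambda>x. ((1/2) *\<^sub>R w k x + (1/2) *\<^sub>R w l x) - v x) \<le> inverse (real (Suc N))"
      proof (rule order_trans[OF LP_int_midpoint[OF s_pos(2) W_LPs[OF wW] W_LPs[OF wW] v, of k l]])
        have mid: "(A + B) / 2 \<le> C" if "A \<le> C" "B \<le> C" for A B C :: real using that by simp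
        show "(LP_int M s (\<lambda>x. w k x - v x) + LP_int M s (\<lambda>x. w l x - v x)) / 2 \<le> inverse (real (Suc N))"
          by (rule mid; rule order_trans[OF wv]; rule inv)
      qed
      then have "((\<lambda>x. (1/2) * w k x + (1/2) * w l x), (\<lambda>x. (1/2) *\<^sub>R H k x + (1/2) *\<^sub>R H l x)) \<in> S N"
        unfolding S_def using W0_lincomb[OF wW wW, of "1/2" k "1/2" l] by simp
      then have mN: "m N \<le> LP_int M p (\<lambda>x. (1/2) *\<^sub>R H k x + (1/2) *\<^sub>R H l x)"
        unfolding m_def using cINF_lower[OF bdd[of N]] by fastforce
      have "LP_int M p (\<lambda>x. H k x - H l x)
          \<le> 2 powr p * ((LP_int M p (H k) + LP_int M p (H l)) / 2 - LP_int M p (\<lambda>x. (1/2) *\<^sub>R H k x + (1/2) *\<^sub>R H l x))"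
        by (rule LP_int_Clarkson[OF W0_LP(2)[OF wW] W0_LP(2)[OF wW]])
      also have "\<dots> \<le> 2 powr p * (ml + inverse (real (Suc N)) - m N)"
        using H_small[of k] H_small[of l] m_le_ml[of k] m_le_ml[of l] inv mN
        by (intro mult_left_mono) (argo, simp)
      finally show ?thesis using N by linarith
    qed
    then show ?thesis by blast
  qed
  obtain F where F: "F \<in> LP M p" "(\<lambda>n. LP_int M p (\<lambda>x. H n x - F x)) \<longlonglongrightarrow> 0"
    using LP_complete[where f=H, OF p_pos(1) W0_LP(2)[OF wW] Cauchy] by blast
  have "(\<lambda>n. LP_int M s (\<lambda>x. w n x - v x)) \<longlonglongrightarrow> 0"
    by (rule tendsto_sandwich[OF _ _ tendsto_const LIMSEQ_inverse_real_of_nat])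
      (use wv LP_int_nonneg in \<open>auto intro!: always_eventually\<close>)
  then have "(\<lambda>n. LP_int M p (\<lambda>x. w n x - v x)) \<longlonglongrightarrow> 0"
    by (rule LP_lim_mono[OF p_pos(1) ps W_LPs[OF wW] v])
  then have "W0 v F" by (rule W0_closed[OF wW LP_mono[OF p_pos(1) ps v] F(1) _ F(2)])
  moreover have "LP_int M p F \<le> e"
  proof (rule LIMSEQ_le)
    show "(\<lambda>n. LP_int M p (H n)) \<longlonglongrightarrow> LP_int M p F"
      by (rule LP_int_tendsto[OF p_pos(1) W0_LP(2)[OF wW] F])
    have "(\<lambda>n. e + inverse (real (Suc n))) \<longlonglongrightarrow> e + 0"
      by (intro tendsto_intros LIMSEQ_inverse_real_of_nat)
    then show "(\<lambda>n. e + inverse (real (Suc n))) \<longlonglongrightarrow> e" by simp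
    show "\<exists>N. \<forall>n\<ge>N. LP_int M p (H n) \<le> e + inverse (real (Suc n))"
      using H_small m_le by (meson add_right_mono less_imp_le order_trans)
  qed
  ultimately show ?thesis using that by blast
qed

end

section \<open>Weak gradients\<close>

text \<open>Difference quotients have integral \<open>0\<close> by translation invariance, and they
  converge to the partial derivative under a common bound given by the Lipschitz constant on a fixed
  ball.\<close>

lemma (in C1_compact_support) integral_partial_derivative: "(\<integral>x. D x \<bullet> i \<partial>lborel) = 0"
proof -
  obtain C where C: "C \<ge> 0" "\<And>x. norm (D x) \<le> C" using D_bounded by blast
  obtain L where L: "\<And>x. x \<in> K \<Longrightarrow> norm x \<le> L" using compact_imp_bounded[OF compact_K] by (auto simp: bounded_iff)
  \<comment> \<open>The steps \<open>e k *\<^sub>R i\<close> have length at most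
    \<open>norm i\<close>, so all difference quotients vanish outside this ball.\<close>
  define B where "B = cball (0::'a) (L + norm i)"
  define e where "e k = inverse (real (Suc k))" for k
  have e: "e k > 0" "e k \<le> 1" for k by (auto simp: e_def inverse_le_1_iff)
  let ?q = "\<lambda>k x. (\<phi> (x + e k *\<^sub>R i) - \<phi> x) / e k"
  have Lip: "\<bar>\<phi> x - \<phi> y\<bar> \<le> C * norm (x - y)" for x y
  proof -
    have "norm (\<phi> x - \<phi> y) \<le> C * norm (x - y)"
    proof (rule differentiable_bound[where S=UNIV and f'="\<lambda>x h. D x \<bullet> h"])
      show "onorm (\<lambda>h. D x \<bullet> h) \<le> C" for x
      proof (rule onorm_le)
        show "norm (D x \<bullet> h) \<le> C * norm h" for h
          using Cauchy_Schwarz_ineq2[of "D x" h] mult_right_mono[OF C(2)[of x], of "norm h"] by simp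
      qed
    qed (auto intro: der)
    then show ?thesis by simp
  qed
  have int_\<phi>: "integrable lborel (\<lambda>x. \<phi> (x + v))" "(\<integral>x. \<phi> (x + v) \<partial>lborel) = (\<integral>x. \<phi> x \<partial>lborel)" for v
  proof -
    have "integrable lborel \<phi>" by (rule integrable_if_vanishing[OF cont_\<phi>]) (rule zero_outside)
    then have "integrable (distr lborel borel ((+) v)) \<phi>" by (simp add: lborel_distr_plus)
    then show "integrable lborel (\<lambda>x. \<phi> (x + v))"
      by (subst (asm) integrable_distr_eq) (auto simp: add.commute)
    have "(\<integral>x. \<phi> x \<partial>lborel) = (\<integral>x. \<phi> x \<partial>distr lborel borel ((+) v))" by (simp add: lborel_distr_plus)
    also have "\<dots> = (\<integral>x. \<phi> (x + v) \<partial>lborel)" by (subst integral_distr) (auto simp: add.commute)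
    finally show "(\<integral>x. \<phi> (x + v) \<partial>lborel) = (\<integral>x. \<phi> x \<partial>lborel)" by simp
  qed
  have "(\<integral>x. ?q k x \<partial>lborel) = 0" for k
    using int_\<phi>[of "e k *\<^sub>R i"] int_\<phi>(1)[of 0] by simp
  moreover have "(\<lambda>k. \<integral>x. ?q k x \<partial>lborel) \<longlonglongrightarrow> (\<integral>x. D x \<bullet> i \<partial>lborel)"
  proof (rule integral_dominated_convergence[where w="\<lambda>x. indicator B x * (C * norm i)"])
    have "emeasure lborel B < \<infinity>" unfolding B_def by (rule emeasure_bounded_finite) simp
    then show "integrable lborel (\<lambda>x. indicator B x * (C * norm i))" by (simp add: B_def)
    show "AE x in lborel. (\<lambda>k. ?q k x) \<longlonglongrightarrow> D x \<bullet> i"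
    proof (rule AE_I2)
      fix x :: 'a
      have d0: "(\<phi> has_derivative (\<lambda>h. D x \<bullet> h)) (at (x + 0 *\<^sub>R i))" using der[of x] by simp
      have "((\<lambda>t::real. x + t *\<^sub>R i) has_derivative (\<lambda>h. h *\<^sub>R i)) (at 0)"
        by (auto intro!: derivative_eq_intros)
      from has_derivative_compose[OF this d0]
      have "((\<lambda>t. \<phi> (x + t *\<^sub>R i)) has_real_derivative D x \<bullet> i) (at 0)"
        by (simp add: has_field_derivative_def mult.commute[of _ "D x \<bullet> i"] fun_eq_iff)
      then have lim: "((\<lambda>h. (\<phi> (x + h *\<^sub>R i) - \<phi> x) / h) \<longlongrightarrow> D x \<bullet> i) (at 0)" by (simp add: DERIV_def)
      have "filterlim e (at 0) sequentially"
        unfolding filterlim_at e_def using LIMSEQ_inverse_real_of_nat by auto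
      from filterlim_compose[OF lim this] show "(\<lambda>k. ?q k x) \<longlonglongrightarrow> D x \<bullet> i" .
    qed
    show "AE x in lborel. norm (?q k x) \<le> indicator B x * (C * norm i)" for k
    proof (rule AE_I2)
      fix x :: 'a
      show "norm (?q k x) \<le> indicator B x * (C * norm i)"
      proof (cases "x \<in> B")
        case True
        have "\<bar>\<phi> (x + e k *\<^sub>R i) - \<phi> x\<bar> \<le> e k * (C * norm i)"
          using Lip[of "x + e k *\<^sub>R i" x] e[of k] by (simp add: mult_ac)
        then show ?thesis using True e(1)[of k] by (simp add: pos_divide_le_eq mult.commute)
      next
        case False
        then have nx: "norm x > L + norm i" by (simp add: B_def)
        have "norm x \<le> norm (x + e k *\<^sub>R i) + e k * norm i"
          using norm_triangle_ineq4[of "x + e k *\<^sub>R i" "e k *\<^sub>R i"] e[of k] by simp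
        moreover have "e k * norm i \<le> norm i" using e(2)[of k] by (simp add: mult_left_le_one_le e(1)[THEN less_imp_le])
        ultimately have "norm (x + e k *\<^sub>R i) > L" using nx by linarith
        moreover have "norm x > L" using nx norm_ge_zero[of i] by linarith
        ultimately have "x + e k *\<^sub>R i \<notin> K" "x \<notin> K" using L leD by blast+
        then show ?thesis using zero_outside(1) C(1) by simp
      qed
    qed
  qed measurable
  ultimately have "(\<lambda>k. 0::real) \<longlonglongrightarrow> (\<integral>x. D x \<bullet> i \<partial>lborel)" by (simp only:)
  then show ?thesis by (simp add: LIMSEQ_const_iff)
qed

lemma integrable_lebesgue_on_iff:
  fixes f :: "'a::euclidean_space \<Rightarrow> 'b::euclidean_space"
  shows "S \<in> sets lebesgue \<Longrightarrow> integrable (lebesgue_on S) f \<longleftrightarrow> integrable lebesgue (\<lambda>x. indicator S x *\<^sub>R f x)"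
  by (rule integrable_restrict_space) simp

lemma integrable_lebesgue_on_subset:
  fixes f :: "'a::euclidean_space \<Rightarrow> 'b::euclidean_space"
  assumes "integrable (lebesgue_on S) f" "T \<subseteq> S" "S \<in> sets lebesgue" "T \<in> sets lebesgue"
  shows "integrable (lebesgue_on T) f" "integrable (lebesgue_on S) (\<lambda>x. indicator T x *\<^sub>R f x)"
proof -
  have 1: "integrable lebesgue (\<lambda>x. indicator S x *\<^sub>R f x)"
    using assms(1) by (simp only: integrable_lebesgue_on_iff[OF assms(3)])
  have 2: "integrable lebesgue (\<lambda>x. indicator T x *\<^sub>R (indicator S x *\<^sub>R f x))"
    by (rule integrable_mult_indicator[OF assms(4) 1])
  have eq: "(\<lambda>x. indicator T x *\<^sub>R (indicator S x *\<^sub>R f x)) = (\<lambda>x. indicator T x *\<^sub>R f x)"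
    "(\<lambda>x. indicator S x *\<^sub>R (indicator T x *\<^sub>R f x)) = (\<lambda>x. indicator T x *\<^sub>R f x)"
    using assms(2) by (auto simp: indicator_def fun_eq_iff)
  show "integrable (lebesgue_on T) f"
    using 2 by (simp only: integrable_lebesgue_on_iff[OF assms(4)] eq)
  show "integrable (lebesgue_on S) (\<lambda>x. indicator T x *\<^sub>R f x)"
    using 2 by (simp only: integrable_lebesgue_on_iff[OF assms(3)] eq)
qed

lemma integrable_lebesgue_on_supset:
  fixes f :: "'a::euclidean_space \<Rightarrow> 'b::euclidean_space"
  assumes "integrable (lebesgue_on T) f" "T \<subseteq> S" "S \<in> sets lebesgue" "T \<in> sets lebesgue"
  shows "integrable (lebesgue_on S) (\<lambda>x. indicator T x *\<^sub>R f x)"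
proof -
  have eq: "(\<lambda>x. indicator S x *\<^sub>R (indicator T x *\<^sub>R f x)) = (\<lambda>x. indicator T x *\<^sub>R f x)"
    using assms(2) by (auto simp: indicator_def fun_eq_iff)
  have "integrable lebesgue (\<lambda>x. indicator T x *\<^sub>R f x)"
    using assms(1) by (simp only: integrable_lebesgue_on_iff[OF assms(4)])
  then show ?thesis by (simp only: integrable_lebesgue_on_iff[OF assms(3)] eq)
qed

context subcritical_domain
begin

section \<open>The fundamental lemma of the calculus of variations\<close>

lemma locally_integrable_times_test:
  fixes f :: "'a \<Rightarrow> real"
  assumes f: "locally_integrable \<Omega> f" and K: "compact K" "K \<subseteq> \<Omega>"
    and g: "continuous_on UNIV (g :: 'a \<Rightarrow> real)" "\<And>x. x \<notin> K \<Longrightarrow> g x = 0"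
  shows "integrable M (\<lambda>x. f x * g x)"
proof -
  have Ks: "K \<in> sets lebesgue" using K(1) by (simp add: borel_compact)
  have fK: "integrable (lebesgue_on K) f" using f K by (auto simp: locally_integrable_def)
  have 1: "integrable M (\<lambda>x. indicator K x *\<^sub>R f x)"
    by (rule integrable_lebesgue_on_supset[OF fK K(2) \<Omega>_sets(1) Ks])
  obtain C where C: "C \<ge> 0" "\<And>x. \<bar>g x\<bar> \<le> C" using continuous_vanishing_bounded[OF K(1) g] unfolding real_norm_def by blast
  have gm: "g \<in> borel_measurable M" by (rule borel_measurable_M[OF borel_measurable_continuous_onI[OF g(1)]])
  have eq: "f x * g x = (indicator K x *\<^sub>R f x) * g x" for x using g(2)[of x] by (auto simp: indicator_def)
  have "integrable M (\<lambda>x. C * (indicator K x *\<^sub>R f x))" by (rule integrable_mult_right[OF 1])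
  then show ?thesis
  proof (rule Bochner_Integration.integrable_bound)
    show "(\<lambda>x. f x * g x) \<in> borel_measurable M"
      unfolding eq by (rule borel_measurable_times[OF borel_measurable_integrable[OF 1] gm])
    show "AE x in M. norm (f x * g x) \<le> norm (C * (indicator K x *\<^sub>R f x))"
    proof (rule AE_I2)
      fix x
      have "norm (f x * g x) = \<bar>indicator K x *\<^sub>R f x\<bar> * \<bar>g x\<bar>" unfolding eq by (simp add: abs_mult)
      also have "\<dots> \<le> \<bar>indicator K x *\<^sub>R f x\<bar> * C" using C(2) by (intro mult_left_mono) auto
      also have "\<dots> = norm (C * (indicator K x *\<^sub>R f x))" using C(1) by (simp add: abs_mult)
      finally show "norm (f x * g x) \<le> norm (C * (indicator K x *\<^sub>R f x))" .
    qed
  qed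
qed

text \<open>The box bumps converge to the indicator of the open box, and the products are dominated
  by \<open>f\<close> on the closed box; the boundary of the box carries no mass.\<close>

lemma fundamental_lemma_box:
  fixes f :: "'a \<Rightarrow> real"
  assumes f: "locally_integrable \<Omega> f" and zero: "\<And>\<psi>. \<psi> \<in> test_functions \<Omega> \<Longrightarrow> (\<integral>x. f x * \<psi> x \<partial>M) = 0"
    and sub: "cbox u v \<subseteq> \<Omega>"
  shows "integral (cbox u v) f = 0"
proof -
  have fK: "integrable (lebesgue_on (cbox u v)) f" using f sub by (auto simp: locally_integrable_def)
  have K: "cbox u v \<in> sets lebesgue" "box u v \<in> sets lebesgue" by auto
  let ?g = "\<lambda>x. indicator (cbox u v) x *\<^sub>R f x"
  have g: "integrable M ?g" by (rule integrable_lebesgue_on_supset[OF fK sub \<Omega>_sets(1) K(1)])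
  note [measurable] = borel_measurable_integrable[OF g]
  have bump_meas[measurable]: "box_bump u v (Suc k) \<in> borel_measurable M" for k
    by (intro borel_measurable_M borel_measurable_continuous_onI test_continuous[OF box_bump_test[OF _ sub]]) simp
  have ind[measurable]: "(indicator (box u v) :: 'a \<Rightarrow> real) \<in> borel_measurable M"
    by (intro borel_measurable_M) measurable
  have eq: "f x * box_bump u v (Suc k) x = ?g x * box_bump u v (Suc k) x" for k x
    using box_bump_pos_iff[of "Suc k" u v x] box_subset_cbox[of u v] by (auto simp: indicator_def)
  have "(\<lambda>k. \<integral>x. ?g x * box_bump u v (Suc k) x \<partial>M) \<longlonglongrightarrow> (\<integral>x. ?g x * indicator (box u v) x \<partial>M)"
  proof (rule integral_dominated_convergence[where w="\<lambda>x. norm (?g x)"])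
    show "integrable M (\<lambda>x. norm (?g x))" using g by (rule integrable_norm)
    show "AE x in M. (\<lambda>k. ?g x * box_bump u v (Suc k) x) \<longlonglongrightarrow> ?g x * indicator (box u v) x"
      by (intro AE_I2 tendsto_mult tendsto_const box_bump_tendsto)
    show "AE x in M. norm (?g x * box_bump u v (Suc k) x) \<le> norm (?g x)" for k
      using box_bump_bounds[of u v "Suc k"] by (intro AE_I2) (simp add: abs_mult mult_left_le)
  qed measurable
  moreover have "(\<integral>x. ?g x * box_bump u v (Suc k) x \<partial>M) = 0" for k
    using zero[OF box_bump_test[OF _ sub], of "Suc k"] unfolding eq by simp
  ultimately have 0: "(\<integral>x. ?g x * indicator (box u v) x \<partial>M) = 0"
    by (simp add: LIMSEQ_const_iff)
  have fB: "integrable (lebesgue_on (box u v)) f"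
    by (rule integrable_lebesgue_on_subset(1)[OF fK box_subset_cbox K])
  have eq2: "indicator \<Omega> x *\<^sub>R (?g x * indicator (box u v) x) = indicator (box u v) x *\<^sub>R f x" for x
    using sub box_subset_cbox[of u v] by (auto simp: indicator_def)
  have "(\<integral>x. ?g x * indicator (box u v) x \<partial>M) = (\<integral>x. indicator (box u v) x *\<^sub>R f x \<partial>lebesgue)"
    using \<Omega>_sets(1) by (subst integral_restrict_space) (simp, simp only: eq2)
  also have "\<dots> = (\<integral>x. f x \<partial>lebesgue_on (box u v))"
    using K(2) by (subst integral_restrict_space) simp_all
  also have "\<dots> = integral (box u v) f" by (rule lebesgue_integral_eq_integral[OF fB K(2)])
  also have "\<dots> = integral (cbox u v) f" by (rule integral_open_interval)
  finally show ?thesis using 0 by simp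
qed

text \<open>All integrals over small cubes vanish, so Lebesgue differentiation gives
  \<open>f x = 0\<close> at almost every point of each box in \<Omega>. Countably many boxes cover
  \<Omega>.\<close>

lemma fundamental_lemma:
  fixes f :: "'a \<Rightarrow> real"
  assumes f: "locally_integrable \<Omega> f" and zero: "\<And>\<psi>. \<psi> \<in> test_functions \<Omega> \<Longrightarrow> (\<integral>x. f x * \<psi> x \<partial>M) = 0"
  shows "AE x in M. f x = 0"
proof -
  have local: "negligible {x \<in> cbox a b. f x \<noteq> 0}" if ab: "cbox a b \<subseteq> \<Omega>" for a b
  proof -
    \<comment> \<open>Extension by \<open>0\<close> makes the function integrable on every box, as
      the differentiation theorem asks.\<close>
    let ?g = "\<lambda>x. if x \<in> cbox a b then f x else 0"
    have "integrable (lebesgue_on (cbox a b)) f" using f ab by (auto simp: locally_integrable_def)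
    then have "f integrable_on cbox a b" by (rule integrable_on_lebesgue_on) auto
    then have "?g integrable_on UNIV" by (simp only: integrable_restrict_UNIV)
    then have gi: "?g integrable_on cbox u v" for u v by (rule integrable_on_subcbox) simp
    obtain N where N: "negligible N"
      "\<And>x e. \<lbrakk>x \<notin> N; 0 < e\<rbrakk> \<Longrightarrow> \<exists>d>0. \<forall>h. 0 < h \<and> h < d \<longrightarrow>
          norm (integral (cbox x (x + h *\<^sub>R One)) ?g /\<^sub>R h ^ DIM('a) - ?g x) < e"
      using integrable_ccontinuous_explicit[where f="?g", OF gi] by blast
    have "f x = 0" if x: "x \<in> box a b" "x \<notin> N" for x
    proof (rule ccontr)
      assume "f x \<noteq> 0"
      then have "\<bar>f x\<bar> > 0" by simp
      from N(2)[OF x(2) this] obtain d where d: "d > 0"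
        "\<And>h. 0 < h \<Longrightarrow> h < d \<Longrightarrow> norm (integral (cbox x (x + h *\<^sub>R One)) ?g /\<^sub>R h ^ DIM('a) - ?g x) < \<bar>f x\<bar>"
        by blast
      obtain r where r: "r > 0" "ball x r \<subseteq> box a b" using x(1) open_box openE by blast
      \<comment> \<open>The \<open>l^1\<close> norm bounds the distance from the corner
        \<open>x\<close> by \<open>DIM('a) * h\<close>, so this choice keeps the cube inside the
        ball of radius \<open>r\<close>.\<close>
      define h where "h = min (d / 2) (r / (2 * real DIM('a)))"
      have h: "0 < h" "h < d" "real DIM('a) * h < r"
      proof -
        show "0 < h" "h < d" using d(1) r(1) by (auto simp: h_def)
        have "real DIM('a) * h \<le> real DIM('a) * (r / (2 * real DIM('a)))" by (intro mult_left_mono) (auto simp: h_def)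
        also have "\<dots> < r" using r(1) by simp
        finally show "real DIM('a) * h < r" .
      qed
      have sub: "cbox x (x + h *\<^sub>R One) \<subseteq> ball x r"
      proof
        fix y assume y: "y \<in> cbox x (x + h *\<^sub>R One)"
        have "norm (y - x) \<le> (\<Sum>i\<in>Basis. \<bar>(y - x) \<bullet> i\<bar>)" by (rule norm_le_l1)
        also have "\<dots> \<le> (\<Sum>i\<in>(Basis::'a set). h)"
          using y by (intro sum_mono) (auto simp: mem_box inner_diff_left inner_add_left abs_le_iff)
        also have "\<dots> < r" using h(3) by simp
        finally show "y \<in> ball x r" by (simp add: dist_norm norm_minus_commute)
      qed
      then have subab: "cbox x (x + h *\<^sub>R One) \<subseteq> cbox a b" using r(2) box_subset_cbox by blast
      have "integral (cbox x (x + h *\<^sub>R One)) ?g = integral (cbox x (x + h *\<^sub>R One)) f"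
        using subab by (intro integral_cong) auto
      also have "\<dots> = 0" using subab ab by (intro fundamental_lemma_box[OF f zero]) auto
      finally have "norm (?g x) < \<bar>f x\<bar>" using d(2)[OF h(1,2)] by simp
      moreover have "?g x = f x" using x(1) box_subset_cbox by auto
      ultimately show False by simp
    qed
    then have "{x \<in> cbox a b. f x \<noteq> 0} \<subseteq> N \<union> (cbox a b - box a b)" by blast
    then show ?thesis
      using N(1) negligible_frontier_interval[of a b] negligible_Un negligible_subset by blast
  qed
  obtain \<D> where D: "countable \<D>" "\<D> \<subseteq> Pow \<Omega>" "\<And>X. X \<in> \<D> \<Longrightarrow> \<exists>a b. X = cbox a b" "\<Union>\<D> = \<Omega>"
    using open_countable_Union_open_cbox[OF open_\<Omega>] by blast
  have "negligible (\<Union>X\<in>\<D>. {x \<in> X. f x \<noteq> 0})"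
  proof (rule negligible_countable_Union[of "(\<lambda>X. {x \<in> X. f x \<noteq> 0}) ` \<D>"])
    show "countable ((\<lambda>X. {x \<in> X. f x \<noteq> 0}) ` \<D>)" using D(1) by simp
    show "negligible S" if S: "S \<in> (\<lambda>X. {x \<in> X. f x \<noteq> 0}) ` \<D>" for S
    proof -
      obtain X where X: "X \<in> \<D>" "S = {x \<in> X. f x \<noteq> 0}" using S by blast
      obtain a b where "X = cbox a b" using D(3)[OF X(1)] by blast
      then show ?thesis using local[of a b] D(2) X by auto
    qed
  qed
  moreover have "(\<Union>X\<in>\<D>. {x \<in> X. f x \<noteq> 0}) = {x \<in> \<Omega>. f x \<noteq> 0}" using D(4) by blast
  ultimately have "{x \<in> \<Omega>. f x \<noteq> 0} \<in> null_sets lebesgue" by (simp add: negligible_iff_null_sets)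
  then have "AE x in lebesgue. x \<notin> {x \<in> \<Omega>. f x \<noteq> 0}" by (rule AE_not_in)
  then show ?thesis
    using \<Omega>_sets(1) by (subst AE_restrict_space_iff) (auto elim!: eventually_mono)
qed

section \<open>Integration by parts, uniqueness and linearity of weak gradients\<close>

lemma LP_1_integrable:
  fixes f :: "'a \<Rightarrow> 'b::euclidean_space"
  assumes "f \<in> LP M 1"
  shows "integrable M f"
  using integrable_norm_iff[OF LP_measurable[OF assms]] LP_integrable[OF assms] by simp

lemma is_weak_gradient_weak_gradient:
  "is_weak_gradient \<Omega> u G \<Longrightarrow> is_weak_gradient \<Omega> u (weak_gradient \<Omega> u)"
  unfolding weak_gradient_def by (rule someI[of "is_weak_gradient \<Omega> u"])

text \<open>The product of the two test functions is C^1 with compact support, so the integral of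
  its partial derivative is \<open>0\<close>; the product rule splits it into the two sides.\<close>

lemma is_weak_gradient_grad:
  assumes \<phi>: "\<phi> \<in> test_functions \<Omega>"
  shows "is_weak_gradient \<Omega> \<phi> (grad \<phi>)"
proof -
  have cont_int: "integrable (lebesgue_on K) g" if "compact K" "continuous_on UNIV g" for K and g :: "'a \<Rightarrow> 'b::euclidean_space"
  proof -
    have K: "K \<in> sets lebesgue" using that(1) by (simp add: borel_compact)
    have b: "integrable lborel (\<lambda>x. indicator K x *\<^sub>R g x)"
      using that continuous_on_subset by (intro borel_integrable_compact) auto
    then have "integrable lebesgue (\<lambda>x. indicator K x *\<^sub>R g x)"
      by (subst integrable_completion) (auto dest: borel_measurable_integrable)
    then show ?thesis using integrable_lebesgue_on_iff[OF K] by blast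
  qed
  have "(\<integral>x. \<phi> x * frechet_derivative \<psi> (at x) i \<partial>M) = - (\<integral>x. (grad \<phi> x \<bullet> i) * \<psi> x \<partial>M)"
    if \<psi>: "\<psi> \<in> test_functions \<Omega>" and i: "i \<in> Basis" for \<psi> i
  proof -
    obtain K where K: "compact K" "K \<subseteq> \<Omega>" "\<And>x. x \<notin> K \<Longrightarrow> \<phi> x = 0 \<and> grad \<phi> x = 0"
      using test_support[OF \<phi>] by blast
    let ?D = "\<lambda>x. \<phi> x *\<^sub>R grad \<psi> x + \<psi> x *\<^sub>R grad \<phi> x"
    have C1: "C1_compact_support (\<lambda>x. \<phi> x * \<psi> x) ?D K"
    proof
      show "((\<lambda>x. \<phi> x * \<psi> x) has_derivative (\<lambda>h. ?D x \<bullet> h)) (at x)" for x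
        by (rule has_derivative_eq_rhs[OF has_derivative_mult[OF test_has_derivative[OF \<phi>] test_has_derivative[OF \<psi>]]])
          (simp add: inner_left_distrib mult.commute fun_eq_iff)
      show "continuous_on UNIV ?D"
        by (intro continuous_intros test_continuous[OF \<phi>] test_continuous[OF \<psi>] test_grad_continuous[OF \<phi>] test_grad_continuous[OF \<psi>])
    qed (use K in auto)
    interpret C1_compact_support "\<lambda>x. \<phi> x * \<psi> x" ?D K by (rule C1)
    have D0: "(\<integral>x. ?D x \<bullet> i \<partial>M) = 0"
    proof -
      have "(\<integral>x. ?D x \<bullet> i \<partial>M) = (\<integral>x. ?D x \<bullet> i \<partial>lborel)"
      proof (rule integral_M_eq_lborel(2))
        show "?D x \<bullet> i = 0" if x: "x \<notin> \<Omega>" for x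
        proof -
          have "x \<notin> K" using K(2) x by blast
          from zero_outside(2)[OF this] show ?thesis by (rule ssubst) (rule inner_zero_left)
        qed
      qed measurable
      then show ?thesis using integral_partial_derivative[of i] by simp
    qed
    have c: "continuous_on UNIV (\<lambda>x. \<phi> x * (grad \<psi> x \<bullet> i))" "continuous_on UNIV (\<lambda>x. (grad \<phi> x \<bullet> i) * \<psi> x)"
      by (intro continuous_intros test_continuous[OF \<phi>] test_continuous[OF \<psi>] test_grad_continuous[OF \<phi>] test_grad_continuous[OF \<psi>])+
    have "(\<lambda>x. \<phi> x * (grad \<psi> x \<bullet> i)) \<in> LP M 1" "(\<lambda>x. (grad \<phi> x \<bullet> i) * \<psi> x) \<in> LP M 1"
      by (rule continuous_vanishing_LP[OF zero_less_one c(1) K(1)], simp add: K(3))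
        (rule continuous_vanishing_LP[OF zero_less_one c(2) K(1)], simp add: K(3))
    then have ints: "integrable M (\<lambda>x. \<phi> x * (grad \<psi> x \<bullet> i))" "integrable M (\<lambda>x. (grad \<phi> x \<bullet> i) * \<psi> x)"
      by (blast intro: LP_1_integrable)+
    have "(\<integral>x. ?D x \<bullet> i \<partial>M) = (\<integral>x. \<phi> x * (grad \<psi> x \<bullet> i) + (grad \<phi> x \<bullet> i) * \<psi> x \<partial>M)"
      by (simp add: inner_left_distrib mult.commute)
    also have "\<dots> = (\<integral>x. \<phi> x * (grad \<psi> x \<bullet> i) \<partial>M) + (\<integral>x. (grad \<phi> x \<bullet> i) * \<psi> x \<partial>M)"
      by (rule Bochner_Integration.integral_add[OF ints])
    finally show ?thesis using D0 by (simp add: grad_inner_Basis[OF i])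
  qed
  then show ?thesis
    unfolding is_weak_gradient_def locally_integrable_def
    by (intro conjI ballI allI impI cont_int test_continuous[OF \<phi>] test_grad_continuous[OF \<phi>]) auto
qed

lemma weak_gradient_unique:
  assumes G: "is_weak_gradient \<Omega> u G" and H: "is_weak_gradient \<Omega> u H"
  shows "AE x in M. G x = H x"
proof -
  have loc: "locally_integrable \<Omega> (\<lambda>x. G x \<bullet> i)" "locally_integrable \<Omega> (\<lambda>x. H x \<bullet> i)" for i
    using G H by (auto simp: is_weak_gradient_def locally_integrable_def)
  have "AE x in M. (G x \<bullet> i - H x \<bullet> i) = 0" if i: "i \<in> Basis" for i
  proof (rule fundamental_lemma)
    show "locally_integrable \<Omega> (\<lambda>x. G x \<bullet> i - H x \<bullet> i)" using loc by (auto simp: locally_integrable_def)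
    fix \<psi> assume \<psi>: "\<psi> \<in> test_functions \<Omega>"
    obtain K where K: "compact K" "K \<subseteq> \<Omega>" "\<And>x. x \<notin> K \<Longrightarrow> \<psi> x = 0 \<and> grad \<psi> x = 0"
      using test_support[OF \<psi>] by blast
    have "(\<integral>x. (G x \<bullet> i) * \<psi> x \<partial>M) = (\<integral>x. (H x \<bullet> i) * \<psi> x \<partial>M)"
    proof -
      have "(\<integral>x. u x * frechet_derivative \<psi> (at x) i \<partial>M) = - (\<integral>x. (G x \<bullet> i) * \<psi> x \<partial>M)"
        "(\<integral>x. u x * frechet_derivative \<psi> (at x) i \<partial>M) = - (\<integral>x. (H x \<bullet> i) * \<psi> x \<partial>M)"
        using G H \<psi> i unfolding is_weak_gradient_def by blast+
      then show ?thesis by linarith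
    qed
    moreover have pc: "\<And>x. x \<notin> K \<Longrightarrow> \<psi> x = 0" using K(3) by blast
    ultimately show "(\<integral>x. (G x \<bullet> i - H x \<bullet> i) * \<psi> x \<partial>M) = 0"
      using locally_integrable_times_test[OF loc(1) K(1,2) test_continuous[OF \<psi>] pc]
        locally_integrable_times_test[OF loc(2) K(1,2) test_continuous[OF \<psi>] pc] by (simp add: left_diff_distrib)
  qed
  then have "AE x in M. \<forall>i\<in>Basis. (G x \<bullet> i - H x \<bullet> i) = 0"
    by (intro AE_finite_allI finite_Basis) auto
  then show ?thesis by eventually_elim (auto intro: euclidean_eqI)
qed

lemma is_weak_gradient_lincomb:
  assumes u: "is_weak_gradient \<Omega> u G" and v: "is_weak_gradient \<Omega> v H"
  shows "is_weak_gradient \<Omega> (\<lambda>x. c * u x + d * v x) (\<lambda>x. c *\<^sub>R G x + d *\<^sub>R H x)"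
  unfolding is_weak_gradient_def
proof (intro conjI ballI)
  show "locally_integrable \<Omega> (\<lambda>x. c * u x + d * v x)" "locally_integrable \<Omega> (\<lambda>x. c *\<^sub>R G x + d *\<^sub>R H x)"
    using u v by (auto simp: is_weak_gradient_def locally_integrable_def)
  have lu: "locally_integrable \<Omega> u" "locally_integrable \<Omega> v" using u v by (auto simp: is_weak_gradient_def)
  have lG: "locally_integrable \<Omega> (\<lambda>x. G x \<bullet> i)" "locally_integrable \<Omega> (\<lambda>x. H x \<bullet> i)" for i
    using u v by (auto simp: is_weak_gradient_def locally_integrable_def)
  fix \<phi> i assume \<phi>: "\<phi> \<in> test_functions \<Omega>" and i: "i \<in> (Basis :: 'a set)"
  obtain K where K: "compact K" "K \<subseteq> \<Omega>" "\<And>x. x \<notin> K \<Longrightarrow> \<phi> x = 0 \<and> grad \<phi> x = 0"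
    using test_support[OF \<phi>] by blast
  let ?f = "\<lambda>x. frechet_derivative \<phi> (at x) i"
  have fc: "continuous_on UNIV ?f" "\<And>x. x \<notin> K \<Longrightarrow> ?f x = 0"
    unfolding grad_inner_Basis[OF i, symmetric] using K(3)
    by (auto intro!: continuous_intros test_grad_continuous[OF \<phi>])
  have pc: "\<And>x. x \<notin> K \<Longrightarrow> \<phi> x = 0" using K(3) by blast
  note I1 = locally_integrable_times_test[OF lu(1) K(1,2) fc] locally_integrable_times_test[OF lu(2) K(1,2) fc]
  note I2 = locally_integrable_times_test[OF lG(1) K(1,2) test_continuous[OF \<phi>] pc]
    locally_integrable_times_test[OF lG(2) K(1,2) test_continuous[OF \<phi>] pc]
  have "(\<integral>x. (c * u x + d * v x) * ?f x \<partial>M) = (\<integral>x. c * (u x * ?f x) + d * (v x * ?f x) \<partial>M)"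
    by (simp add: algebra_simps)
  also have "\<dots> = c * (\<integral>x. u x * ?f x \<partial>M) + d * (\<integral>x. v x * ?f x \<partial>M)" using I1 by simp
  also have "\<dots> = - (c * (\<integral>x. (G x \<bullet> i) * \<phi> x \<partial>M) + d * (\<integral>x. (H x \<bullet> i) * \<phi> x \<partial>M))"
    using u v \<phi> i by (simp add: is_weak_gradient_def)
  also have "c * (\<integral>x. (G x \<bullet> i) * \<phi> x \<partial>M) + d * (\<integral>x. (H x \<bullet> i) * \<phi> x \<partial>M)
      = (\<integral>x. c * ((G x \<bullet> i) * \<phi> x) + d * ((H x \<bullet> i) * \<phi> x) \<partial>M)" using I2 by simp
  also have "\<dots> = (\<integral>x. ((c *\<^sub>R G x + d *\<^sub>R H x) \<bullet> i) * \<phi> x \<partial>M)" by (simp add: algebra_simps inner_left_distrib)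
  finally show "(\<integral>x. (c * u x + d * v x) * ?f x \<partial>M) = - (\<integral>x. ((c *\<^sub>R G x + d *\<^sub>R H x) \<bullet> i) * \<phi> x \<partial>M)" .
qed

lemma LP_integrable_self:
  fixes f :: "'a \<Rightarrow> 'b::euclidean_space"
  assumes "f \<in> LP M p"
  shows "integrable M f"
proof -
  have "f \<in> LP M 1" by (rule LP_mono[OF _ p_pos(2) assms]) simp
  then show ?thesis by (rule LP_1_integrable)
qed

lemma LP_locally_integrable:
  fixes f :: "'a \<Rightarrow> 'b::euclidean_space"
  assumes "f \<in> LP M p"
  shows "locally_integrable \<Omega> f"
  unfolding locally_integrable_def
  using integrable_lebesgue_on_subset(1)[OF LP_integrable_self[OF assms] _ \<Omega>_sets(1)] by (simp add: borel_compact)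

lemma LP_weak_limit:
  fixes f :: "nat \<Rightarrow> 'a \<Rightarrow> real"
  assumes f: "\<And>k. f k \<in> LP M p" and g: "g \<in> LP M p" and lim: "(\<lambda>k. LP_int M p (\<lambda>x. f k x - g x)) \<longlonglongrightarrow> 0"
    and h: "h \<in> borel_measurable M" "\<And>x. \<bar>h x\<bar> \<le> C"
  shows "(\<lambda>k. \<integral>x. f k x * h x \<partial>M) \<longlonglongrightarrow> (\<integral>x. g x * h x \<partial>M)"
proof -
  have "(\<lambda>k. LP_int M 1 (\<lambda>x. f k x - g x)) \<longlonglongrightarrow> 0"
    by (rule LP_lim_mono[OF _ p_pos(2) f g lim]) simp
  then have lim1: "(\<lambda>k. C * LP_int M 1 (\<lambda>x. f k x - g x)) \<longlonglongrightarrow> 0" by (rule tendsto_mult_right_zero)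
  have fh: "integrable M (\<lambda>x. w x * h x)" if "integrable M w" for w :: "'a \<Rightarrow> real"
  proof (rule Bochner_Integration.integrable_bound[OF integrable_mult_right[OF that, of C]])
    show "(\<lambda>x. w x * h x) \<in> borel_measurable M"
      by (rule borel_measurable_times[OF borel_measurable_integrable[OF that] h(1)])
    show "AE x in M. norm (w x * h x) \<le> norm (C * w x)"
    proof (rule AE_I2)
      fix x
      have "\<bar>w x\<bar> * \<bar>h x\<bar> \<le> \<bar>w x\<bar> * \<bar>C\<bar>" using h(2)[of x] by (intro mult_left_mono) auto
      then show "norm (w x * h x) \<le> norm (C * w x)" by (simp add: abs_mult mult.commute)
    qed
  qed
  have "(\<lambda>k. (\<integral>x. f k x * h x \<partial>M) - (\<integral>x. g x * h x \<partial>M)) \<longlonglongrightarrow> 0"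
  proof (rule Lim_null_comparison[OF _ lim1], rule always_eventually, rule allI)
    fix k
    have d: "integrable M (\<lambda>x. f k x - g x)" using LP_integrable_self[OF f] LP_integrable_self[OF g] by simp
    have "(\<integral>x. f k x * h x \<partial>M) - (\<integral>x. g x * h x \<partial>M) = (\<integral>x. f k x * h x - g x * h x \<partial>M)"
      by (rule Bochner_Integration.integral_diff[symmetric, OF fh[OF LP_integrable_self[OF f]] fh[OF LP_integrable_self[OF g]]])
    also have "\<dots> = (\<integral>x. (f k x - g x) * h x \<partial>M)" by (simp add: left_diff_distrib)
    also have "norm \<dots> \<le> (\<integral>x. norm ((f k x - g x) * h x) \<partial>M)" by (rule integral_norm_bound)
    also have "\<dots> \<le> (\<integral>x. C * norm (f k x - g x) \<partial>M)"
    proof (rule integral_mono)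
      show "integrable M (\<lambda>x. norm ((f k x - g x) * h x))" by (rule integrable_norm[OF fh[OF d]])
      show "integrable M (\<lambda>x. C * norm (f k x - g x))" by (rule integrable_mult_right[OF integrable_norm[OF d]])
      show "norm ((f k x - g x) * h x) \<le> C * norm (f k x - g x)" for x
        using mult_left_mono[OF h(2)[of x], of "\<bar>f k x - g x\<bar>"] by (simp add: abs_mult mult.commute)
    qed
    also have "\<dots> = C * LP_int M 1 (\<lambda>x. f k x - g x)" by (simp add: LP_int_def)
    finally show "norm ((\<integral>x. f k x * h x \<partial>M) - (\<integral>x. g x * h x \<partial>M)) \<le> C * LP_int M 1 (\<lambda>x. f k x - g x)" .
  qed
  then show ?thesis by (simp add: LIM_zero_iff)
qed

text \<open>Both sides of the integration by parts formula are pairings with bounded functions,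
  hence continuous under the approximation by test functions that defines \<open>W0\<close>.\<close>

lemma W0_is_weak_gradient:
  assumes W: "W0 u G"
  shows "is_weak_gradient \<Omega> u G"
  unfolding is_weak_gradient_def
proof (intro conjI ballI)
  show "locally_integrable \<Omega> u" "locally_integrable \<Omega> G" using W0_LP[OF W] LP_locally_integrable by blast+
  fix \<psi> i assume \<psi>: "\<psi> \<in> test_functions \<Omega>" and i: "i \<in> (Basis :: 'a set)"
  obtain \<phi> where \<phi>: "\<And>k::nat. \<phi> k \<in> test_functions \<Omega>" "(\<lambda>k. LP_int M p (\<lambda>x. \<phi> k x - u x)) \<longlonglongrightarrow> 0"
    "(\<lambda>k. LP_int M p (\<lambda>x. grad (\<phi> k) x - G x)) \<longlonglongrightarrow> 0"
    using W unfolding W0_def by blast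
  obtain K where K: "compact K" "K \<subseteq> \<Omega>" "\<And>x. x \<notin> K \<Longrightarrow> \<psi> x = 0 \<and> grad \<psi> x = 0"
    using test_support[OF \<psi>] by blast
  let ?f = "\<lambda>x. frechet_derivative \<psi> (at x) i"
  have fc: "continuous_on UNIV ?f" "\<And>x. x \<notin> K \<Longrightarrow> ?f x = 0"
    unfolding grad_inner_Basis[OF i, symmetric] using K(3)
    by (auto intro!: continuous_intros test_grad_continuous[OF \<psi>])
  obtain C1 where C1: "\<And>x. \<bar>?f x\<bar> \<le> C1" using continuous_vanishing_bounded[OF K(1) fc] unfolding real_norm_def by blast
  obtain C2 where C2: "\<And>x. \<bar>\<psi> x\<bar> \<le> C2" using continuous_vanishing_bounded[OF K(1) test_continuous[OF \<psi>]] K(3) unfolding real_norm_def by blast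
  have comp: "(\<lambda>x. H x \<bullet> i) \<in> LP M p" if "H \<in> LP M p" for H :: "'a \<Rightarrow> 'a"
  proof -
    note [measurable] = LP_measurable[OF that]
    have "integrable M (\<lambda>x. norm (H x \<bullet> i) powr p)"
    proof (rule Bochner_Integration.integrable_bound[OF LP_integrable[OF that]])
      show "(\<lambda>x. norm (H x \<bullet> i) powr p) \<in> borel_measurable M" by measurable
      show "AE x in M. norm (norm (H x \<bullet> i) powr p) \<le> norm (norm (H x) powr p)"
        using Basis_le_norm[OF i] p_pos by (intro AE_I2) (auto intro!: powr_mono2)
    qed
    then show ?thesis by (simp add: LP_def)
  qed
  have limG: "(\<lambda>k. LP_int M p (\<lambda>x. grad (\<phi> k) x \<bullet> i - G x \<bullet> i)) \<longlonglongrightarrow> 0"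
  proof (rule tendsto_sandwich[OF _ _ tendsto_const \<phi>(3)])
    show "\<forall>\<^sub>F k in sequentially. LP_int M p (\<lambda>x. grad (\<phi> k) x \<bullet> i - G x \<bullet> i) \<le> LP_int M p (\<lambda>x. grad (\<phi> k) x - G x)"
    proof (rule always_eventually, rule allI)
      fix k
      have d: "(\<lambda>x. grad (\<phi> k) x - G x) \<in> LP M p"
        by (rule LP_diff(1)[OF p_pos(3) test_LP(2)[OF \<phi>(1) p_pos(1)] W0_LP(2)[OF W]])
      show "LP_int M p (\<lambda>x. grad (\<phi> k) x \<bullet> i - G x \<bullet> i) \<le> LP_int M p (\<lambda>x. grad (\<phi> k) x - G x)"
        unfolding LP_int_def inner_diff_left[symmetric]
        using Basis_le_norm[OF i] p_pos
        by (intro integral_mono LP_integrable[OF comp[OF d]] LP_integrable[OF d]) (auto intro!: powr_mono2)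
    qed
  qed (simp add: LP_int_nonneg)
  have L1: "(\<lambda>k. \<integral>x. \<phi> k x * ?f x \<partial>M) \<longlonglongrightarrow> (\<integral>x. u x * ?f x \<partial>M)"
    by (rule LP_weak_limit[OF test_LP(1)[OF \<phi>(1) p_pos(1)] W0_LP(1)[OF W] \<phi>(2) borel_measurable_M[OF borel_measurable_continuous_onI[OF fc(1)]] C1])
  have L2: "(\<lambda>k. \<integral>x. (grad (\<phi> k) x \<bullet> i) * \<psi> x \<partial>M) \<longlonglongrightarrow> (\<integral>x. (G x \<bullet> i) * \<psi> x \<partial>M)"
    by (rule LP_weak_limit[OF comp[OF test_LP(2)[OF \<phi>(1) p_pos(1)]] comp[OF W0_LP(2)[OF W]] limG
      borel_measurable_M[OF borel_measurable_continuous_onI[OF test_continuous[OF \<psi>]]] C2])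
  have "(\<integral>x. \<phi> k x * ?f x \<partial>M) = - (\<integral>x. (grad (\<phi> k) x \<bullet> i) * \<psi> x \<partial>M)" for k
    using is_weak_gradient_grad[OF \<phi>(1)] \<psi> i by (simp add: is_weak_gradient_def)
  then have "(\<lambda>k. \<integral>x. \<phi> k x * ?f x \<partial>M) \<longlonglongrightarrow> - (\<integral>x. (G x \<bullet> i) * \<psi> x \<partial>M)"
    using tendsto_minus[OF L2] by simp
  then show "(\<integral>x. u x * ?f x \<partial>M) = - (\<integral>x. (G x \<bullet> i) * \<psi> x \<partial>M)"
    by (rule LIMSEQ_unique[OF L1])
qed

text \<open>A weak gradient is only required to be locally integrable. Exhaustion of \<Omega> by
  compact sets recovers measurability on all of \<Omega>, without which almost everywhere equality
  could not be used under integrals.\<close>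

lemma locally_integrable_measurable:
  fixes f :: "'a \<Rightarrow> 'b::euclidean_space"
  assumes f: "locally_integrable \<Omega> f"
  shows "f \<in> borel_measurable M"
proof -
  obtain C where C: "\<And>n. compact (C n)" "\<And>n. C n \<subseteq> \<Omega>" "\<And>n. C n \<subseteq> interior (C (Suc n))" "\<Union>(range C) = \<Omega>"
    using open_Union_compact_subsets[OF open_\<Omega>] by metis
  have mono: "C n \<subseteq> C m" if "n \<le> m" for n m
    using that
  proof (induction m)
    case (Suc m)
    have "C m \<subseteq> C (Suc m)" using C(3)[of m] interior_subset by blast
    then show ?case using Suc by (cases "n = Suc m") auto
  qed simp
  show ?thesis
  proof (rule borel_measurable_LIMSEQ_metric)
    show "(\<lambda>x. indicator (C n) x *\<^sub>R f x) \<in> borel_measurable M" for n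
    proof -
      have "integrable (lebesgue_on (C n)) f" using f C(1,2) by (auto simp: locally_integrable_def)
      then have "integrable M (\<lambda>x. indicator (C n) x *\<^sub>R f x)"
        using integrable_lebesgue_on_supset C(2) \<Omega>_sets(1) C(1) by (metis borel_compact lmeasurable_compact fmeasurableD)
      then show ?thesis by (rule borel_measurable_integrable)
    qed
    show "(\<lambda>n. indicator (C n) x *\<^sub>R f x) \<longlonglongrightarrow> f x" if "x \<in> space M" for x
    proof -
      have "x \<in> \<Omega>" using that by simp
      then obtain n where "x \<in> C n" using C(4) by blast
      then have "\<forall>m\<ge>n. indicator (C m) x *\<^sub>R f x = f x" using mono by (auto simp: indicator_def)
      then show ?thesis by (intro tendsto_eventually) (auto simp: eventually_sequentially)
    qed
  qed
qed

section \<open>Identification of \<open>W01p\<close> with the closure \<open>W0\<close>\<close>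

lemma Lp_eq_LP: "Lp r \<Omega> = LP M r"
  by (simp add: Lp_def LP_def)

lemma Lp_norm_powr: "r > 0 \<Longrightarrow> Lp_norm r \<Omega> f powr r = LP_int M r f"
  using LP_int_nonneg[of M r f] by (simp add: Lp_norm_def LP_int_def powr_powr)

text \<open>The norm involves the weak gradient chosen for each difference
  \<open>\<phi> k x - u x\<close>. By linearity and uniqueness it agrees almost everywhere with the
  difference of the gradients, and roots do not affect convergence to \<open>0\<close>.\<close>

lemma W1p_norm_tendsto_iff:
  assumes G: "is_weak_gradient \<Omega> u G" "G \<in> LP M p" and u: "u \<in> LP M p" and \<phi>: "\<And>k. \<phi> k \<in> test_functions \<Omega>"
  shows "(\<lambda>k. W1p_norm p \<Omega> (\<lambda>x. \<phi> k x - u x)) \<longlonglongrightarrow> 0 \<longleftrightarrow>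
    (\<lambda>k. LP_int M p (\<lambda>x. \<phi> k x - u x)) \<longlonglongrightarrow> 0 \<and> (\<lambda>k. LP_int M p (\<lambda>x. grad (\<phi> k) x - G x)) \<longlonglongrightarrow> 0"
proof -
  have wg: "is_weak_gradient \<Omega> (\<lambda>x. \<phi> k x - u x) (\<lambda>x. grad (\<phi> k) x - G x)" for k
    using is_weak_gradient_lincomb[OF is_weak_gradient_grad[OF \<phi>] G(1), of 1 k "-1"] by simp
  have wg': "is_weak_gradient \<Omega> (\<lambda>x. \<phi> k x - u x) (weak_gradient \<Omega> (\<lambda>x. \<phi> k x - u x))" for k
    by (rule is_weak_gradient_weak_gradient[OF wg])
  have "LP_int M p (weak_gradient \<Omega> (\<lambda>x. \<phi> k x - u x)) = LP_int M p (\<lambda>x. grad (\<phi> k) x - G x)" for k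
    using wg wg' by (intro LP_int_cong_AE weak_gradient_unique locally_integrable_measurable) (auto simp: is_weak_gradient_def)
  then have eq: "W1p_norm p \<Omega> (\<lambda>x. \<phi> k x - u x)
      = LP_int M p (\<lambda>x. \<phi> k x - u x) powr (1 / p) + LP_int M p (\<lambda>x. grad (\<phi> k) x - G x) powr (1 / p)" for k
    by (simp add: W1p_norm_def Lp_norm_def LP_int_def)
  have root: "(\<lambda>k. a k powr (1 / p)) \<longlonglongrightarrow> 0 \<longleftrightarrow> a \<longlonglongrightarrow> 0" if a: "\<And>k. a k \<ge> 0" for a :: "nat \<Rightarrow> real"
  proof
    assume "(\<lambda>k. a k powr (1 / p)) \<longlonglongrightarrow> 0"
    then have "(\<lambda>k. (a k powr (1 / p)) powr p) \<longlonglongrightarrow> 0 powr p"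
      using p_pos by (intro tendsto_powr') (auto intro!: always_eventually)
    then show "a \<longlonglongrightarrow> 0" using p_pos a by (simp add: powr_powr)
  next
    assume "a \<longlonglongrightarrow> 0"
    then have "(\<lambda>k. a k powr (1 / p)) \<longlonglongrightarrow> 0 powr (1 / p)"
      using p_pos a by (intro tendsto_powr') (auto intro!: always_eventually)
    then show "(\<lambda>k. a k powr (1 / p)) \<longlonglongrightarrow> 0" by simp
  qed
  have sum0: "(\<lambda>k. a k + b k) \<longlonglongrightarrow> 0 \<longleftrightarrow> a \<longlonglongrightarrow> 0 \<and> b \<longlonglongrightarrow> 0"
    if ab: "\<And>k. a k \<ge> 0" "\<And>k. b k \<ge> 0" for a b :: "nat \<Rightarrow> real"
  proof
    assume *: "(\<lambda>k. a k + b k) \<longlonglongrightarrow> 0"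
    have "a \<longlonglongrightarrow> 0" by (rule tendsto_sandwich[OF _ _ tendsto_const *]) (use ab in auto)
    moreover have "b \<longlonglongrightarrow> 0" by (rule tendsto_sandwich[OF _ _ tendsto_const *]) (use ab in auto)
    ultimately show "a \<longlonglongrightarrow> 0 \<and> b \<longlonglongrightarrow> 0" by blast
  next
    assume "a \<longlonglongrightarrow> 0 \<and> b \<longlonglongrightarrow> 0"
    then show "(\<lambda>k. a k + b k) \<longlonglongrightarrow> 0" using tendsto_add[of a 0 sequentially b 0] by simp
  qed
  show ?thesis
    unfolding eq by (subst sum0) (simp_all add: root LP_int_nonneg)
qed

lemma W0_weak_gradient:
  assumes "u \<in> W01p p \<Omega>"
  shows "W0 u (weak_gradient \<Omega> u)"
proof -
  obtain G0 where G0: "u \<in> LP M p" "G0 \<in> LP M p" "is_weak_gradient \<Omega> u G0"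
    using assms by (auto simp: W01p_def W1p_def Lp_eq_LP)
  have wg: "is_weak_gradient \<Omega> u (weak_gradient \<Omega> u)" by (rule is_weak_gradient_weak_gradient[OF G0(3)])
  have LPg: "weak_gradient \<Omega> u \<in> LP M p"
    by (rule LP_cong_AE[OF weak_gradient_unique[OF G0(3) wg] G0(2)])
      (use wg locally_integrable_measurable in \<open>auto simp: is_weak_gradient_def\<close>)
  obtain \<phi> where \<phi>: "\<And>k::nat. \<phi> k \<in> test_functions \<Omega>" "(\<lambda>k. W1p_norm p \<Omega> (\<lambda>x. \<phi> k x - u x)) \<longlonglongrightarrow> 0"
    using assms by (auto simp: W01p_def)
  show ?thesis
    unfolding W0_def using W1p_norm_tendsto_iff[OF wg LPg G0(1), of \<phi>] \<phi> G0(1) LPg by blast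
qed

lemma W0_imp_W01p:
  assumes W: "W0 u G"
  shows "u \<in> W01p p \<Omega>" "AE x in M. weak_gradient \<Omega> u x = G x"
proof -
  obtain \<phi> where \<phi>: "\<And>k::nat. \<phi> k \<in> test_functions \<Omega>" "(\<lambda>k. LP_int M p (\<lambda>x. \<phi> k x - u x)) \<longlonglongrightarrow> 0"
    "(\<lambda>k. LP_int M p (\<lambda>x. grad (\<phi> k) x - G x)) \<longlonglongrightarrow> 0"
    using W unfolding W0_def by blast
  note wG = W0_is_weak_gradient[OF W]
  have "(\<lambda>k. W1p_norm p \<Omega> (\<lambda>x. \<phi> k x - u x)) \<longlonglongrightarrow> 0"
    using W1p_norm_tendsto_iff[OF wG W0_LP(2,1)[OF W], of \<phi>] \<phi> by blast
  then show "u \<in> W01p p \<Omega>"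
    using \<phi>(1) wG W0_LP[OF W] by (auto simp: W01p_def W1p_def Lp_eq_LP)
  have "is_weak_gradient \<Omega> u (weak_gradient \<Omega> u)" by (rule is_weak_gradient_weak_gradient[OF wG])
  then show "AE x in M. weak_gradient \<Omega> u x = G x" using weak_gradient_unique wG by blast
qed

end

section \<open>The logarithmic nonlinearity\<close>

text \<open>From \<open>ln y \<le> y - 1\<close>: at \<open>y = 1 / t\<close> it gives
  \<open>- ln t \<le> 1 / t\<close> below \<open>1\<close>, and at \<open>y = t\<close> it gives
  \<open>ln t \<le> t\<close> above \<open>1\<close>. Each costs one unit in the exponent.\<close>

lemma abs_powr_ln_le:
  fixes t r :: real
  assumes "t \<ge> 0"
  shows "\<bar>t powr r * ln t\<bar> \<le> t powr (r - 1) + t powr (r + 1)"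
proof -
  consider "t = 0" | "0 < t" "t \<le> 1" | "t > 1" using assms by linarith
  then show ?thesis
  proof cases
    case 2
    have "- ln t = ln (1 / t)" using 2 by (simp add: ln_div)
    also have "\<dots> \<le> 1 / t" using 2 ln_le_minus_one[of "1 / t"] by simp
    finally have "t powr r * (- ln t) \<le> t powr r * (1 / t)" by (intro mult_left_mono) auto
    also have "\<dots> = t powr (r - 1)" using 2 by (simp add: powr_diff)
    finally have "\<bar>t powr r * ln t\<bar> \<le> t powr (r - 1)" using 2 by (simp add: abs_mult)
    then show ?thesis by (simp add: add_increasing2)
  next
    case 3
    have "t powr r * ln t \<le> t powr r * t" using 3 ln_le_minus_one[of t] by (intro mult_left_mono) auto
    also have "\<dots> = t powr (r + 1)" using 3 by (simp add: powr_add)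
    finally have "\<bar>t powr r * ln t\<bar> \<le> t powr (r + 1)" using 3 by (simp add: abs_mult)
    then show ?thesis by (simp add: add_increasing)
  qed auto
qed

lemma tendsto_abs_powr_0: "r > 0 \<Longrightarrow> ((\<lambda>x::real. \<bar>x\<bar> powr r) \<longlongrightarrow> 0) (at 0)"
  by (rule tendsto_eq_intros tendsto_powr' | force)+

lemma tendsto_abs_powr_ln_0:
  assumes "r > 1"
  shows "((\<lambda>x::real. \<bar>x\<bar> powr r * ln \<bar>x\<bar>) \<longlongrightarrow> 0) (at 0)"
proof (rule Lim_null_comparison)
  have "((\<lambda>x::real. \<bar>x\<bar> powr (r - 1) + \<bar>x\<bar> powr (r + 1)) \<longlongrightarrow> 0 + 0) (at 0)"
    using assms by (intro tendsto_add tendsto_abs_powr_0) auto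
  then show "((\<lambda>x::real. \<bar>x\<bar> powr (r - 1) + \<bar>x\<bar> powr (r + 1)) \<longlongrightarrow> 0) (at 0)" by simp
  show "\<forall>\<^sub>F x in at 0. norm (\<bar>x\<bar> powr r * ln \<bar>x\<bar>) \<le> \<bar>x\<bar> powr (r - 1) + \<bar>x\<bar> powr (r + 1)"
    using abs_powr_ln_le by (auto intro!: always_eventually)
qed

lemma continuous_abs_powr_ln:
  assumes "r > 1"
  shows "continuous_on UNIV (\<lambda>x::real. \<bar>x\<bar> powr r * ln \<bar>x\<bar>)"
proof (rule continuous_at_imp_continuous_on, rule ballI)
  fix x :: real
  show "isCont (\<lambda>x. \<bar>x\<bar> powr r * ln \<bar>x\<bar>) x"
  proof (cases "x = 0")
    case True
    then show ?thesis using tendsto_abs_powr_ln_0[OF assms] by (simp add: isCont_def)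
  next
    case False
    then show ?thesis by (intro continuous_intros) auto
  qed
qed

definition power_log :: "real \<Rightarrow> real \<Rightarrow> real" where
  "power_log q x = \<bar>x\<bar> powr (q + 1) * ln \<bar>x\<bar>"

definition power_log_der :: "real \<Rightarrow> real \<Rightarrow> real" where
  "power_log_der q x = \<bar>x\<bar> powr (q - 1) * x * ln \<bar>x\<bar>"

text \<open>The primitive of the nonlinearity \<open>power_log_der\<close>; its integral collects
  the two terms of the energy without gradient. The second summand cancels what the product rule
  leaves when the logarithm is differentiated.\<close>

definition power_log_prim :: "real \<Rightarrow> real \<Rightarrow> real" where
  "power_log_prim q x = 1 / (q + 1) * power_log q x - 1 / (q + 1)\<^sup>2 * \<bar>x\<bar> powr (q + 1)"

lemma power_log_bound: "q > 0 \<Longrightarrow> \<bar>power_log q x\<bar> \<le> 2 * (1 + \<bar>x\<bar> powr (q + 2))"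
  using abs_powr_ln_le[of "\<bar>x\<bar>" "q + 1"] powr_le_1_plus[of q "q + 2" "\<bar>x\<bar>"]
  by (simp add: power_log_def add.commute)

lemma power_log_le: "power_log q x \<le> \<bar>x\<bar> powr (q + 2)"
proof (cases "x = 0")
  case False
  have "power_log q x \<le> \<bar>x\<bar> powr (q + 1) * \<bar>x\<bar>"
    unfolding power_log_def using False ln_le_minus_one[of "\<bar>x\<bar>"] by (intro mult_left_mono) auto
  also have "\<dots> = \<bar>x\<bar> powr (q + 1 + 1)" using False by (subst powr_add) auto
  finally show ?thesis by (simp add: add.assoc)
qed (simp add: power_log_def)

lemma power_log_der_abs: "\<bar>power_log_der q x\<bar> = \<bar>\<bar>x\<bar> powr q * ln \<bar>x\<bar>\<bar>"
proof -
  have "\<bar>x\<bar> powr (q - 1) * \<bar>x\<bar> = \<bar>x\<bar> powr q" by (cases "x = 0") (simp_all add: powr_diff)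
  then show ?thesis by (simp add: power_log_der_def abs_mult)
qed

lemma power_log_der_bound: "q > 1 \<Longrightarrow> \<bar>power_log_der q x\<bar> \<le> 2 * (1 + \<bar>x\<bar> powr (q + 1))"
  using abs_powr_ln_le[of "\<bar>x\<bar>" q] powr_le_1_plus[of "q - 1" "q + 1" "\<bar>x\<bar>"]
  by (simp add: power_log_der_abs)

lemma power_log_continuous: "q > 0 \<Longrightarrow> continuous_on UNIV (power_log q)"
  unfolding power_log_def by (rule continuous_abs_powr_ln) simp

lemma power_log_der_continuous:
  assumes "q > 1"
  shows "continuous_on UNIV (power_log_der q)"
proof (rule continuous_at_imp_continuous_on, rule ballI)
  fix x :: real
  show "isCont (power_log_der q) x"
  proof (cases "x = 0")
    case True
    have "((\<lambda>x. \<bar>\<bar>x\<bar> powr q * ln \<bar>x\<bar>\<bar>) \<longlongrightarrow> 0) (at 0)"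
      using tendsto_rabs_zero[OF tendsto_abs_powr_ln_0[OF assms]] .
    then have "(power_log_der q \<longlongrightarrow> 0) (at 0)"
      unfolding power_log_der_abs[symmetric] by (rule tendsto_rabs_zero_cancel)
    then show ?thesis using True by (simp add: isCont_def power_log_der_def)
  next
    case False
    then show ?thesis unfolding power_log_der_def by (intro continuous_intros) auto
  qed
qed

text \<open>Calculus on the positive half line, evenness of the primitive on the negative one, and
  at \<open>0\<close> the decay of \<open>|y| powr q * ln |y|\<close> and
  \<open>|y| powr q\<close>.\<close>

lemma power_log_prim_has_derivative:
  assumes q: "q > 1"
  shows "(power_log_prim q has_real_derivative power_log_der q x) (at x)"
proof -
  have pos: "(power_log_prim q has_real_derivative power_log_der q x) (at x)" if x: "x > 0" for x
  proof -
    have "((\<lambda>x. 1 / (q + 1) * (x powr (q + 1) * ln x) - 1 / (q + 1)\<^sup>2 * x powr (q + 1)) has_real_derivative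
        1 / (q + 1) * ((q + 1) * x powr q * ln x + 1 / x * x powr (q + 1)) - 1 / (q + 1)\<^sup>2 * ((q + 1) * x powr q)) (at x)"
    proof -
      have P: "((\<lambda>x. x powr (q + 1)) has_real_derivative (q + 1) * x powr q) (at x)"
        using has_real_derivative_powr[OF x, of "q + 1"] by simp
      show ?thesis
        by (intro DERIV_diff DERIV_cmult DERIV_mult P DERIV_ln_divide x)
    qed
    moreover have "1 / (q + 1) * ((q + 1) * x powr q * ln x + 1 / x * x powr (q + 1)) - 1 / (q + 1)\<^sup>2 * ((q + 1) * x powr q)
        = power_log_der q x"
    proof -
      have e: "1 / x * x powr (q + 1) = x powr q" "x powr (q - 1) * x = x powr q" using x by (auto simp: powr_add powr_diff)
      have k: "1 / k * (k * X * l + X) - 1 / k\<^sup>2 * (k * X) = X * l" if "k \<noteq> 0" for k X l :: real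
        using that by (simp add: divide_simps power2_eq_square)
      show ?thesis
        unfolding e(1) power_log_der_def abs_of_pos[OF x] e(2) using q by (intro k) simp
    qed
    ultimately have "((\<lambda>x. 1 / (q + 1) * (x powr (q + 1) * ln x) - 1 / (q + 1)\<^sup>2 * x powr (q + 1)) has_real_derivative
        power_log_der q x) (at x)" by simp
    then show ?thesis
      by (rule has_field_derivative_transform_within_open[where S="{0<..}"])
        (use x in \<open>auto simp: power_log_prim_def power_log_def\<close>)
  qed
  consider "x > 0" | "x < 0" | "x = 0" by linarith
  then show ?thesis
  proof cases
    case 2
    have "((\<lambda>y. power_log_prim q (- y)) has_real_derivative power_log_der q (- x) * - 1) (at x)"
      by (rule DERIV_chain2[OF pos]) (use 2 in \<open>auto intro!: derivative_eq_intros\<close>)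
    moreover have "(\<lambda>y. power_log_prim q (- y)) = power_log_prim q" by (simp add: power_log_prim_def power_log_def fun_eq_iff)
    moreover have "power_log_der q (- x) * - 1 = power_log_der q x" by (simp add: power_log_der_def)
    ultimately show ?thesis by metis
  next
    case 3
    have "((\<lambda>y. power_log_prim q y / y) \<longlongrightarrow> 0) (at 0)"
    proof (rule Lim_null_comparison)
      have "((\<lambda>y. \<bar>\<bar>y\<bar> powr q * ln \<bar>y\<bar>\<bar> + \<bar>y\<bar> powr q) \<longlongrightarrow> 0 + 0) (at 0)"
        using q by (intro tendsto_add tendsto_rabs_zero tendsto_abs_powr_ln_0 tendsto_abs_powr_0) auto
      then show "((\<lambda>y. \<bar>\<bar>y\<bar> powr q * ln \<bar>y\<bar>\<bar> + \<bar>y\<bar> powr q) \<longlongrightarrow> 0) (at 0)" by simp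
      have "norm (power_log_prim q y / y) \<le> \<bar>\<bar>y\<bar> powr q * ln \<bar>y\<bar>\<bar> + \<bar>y\<bar> powr q" if "y \<noteq> 0" for y
      proof -
        have e: "\<bar>y\<bar> powr (q + 1) = \<bar>y\<bar> powr q * \<bar>y\<bar>" using that by (simp add: powr_add)
        have k: "0 \<le> 1 / (q + 1)" "1 / (q + 1) \<le> 1" "0 \<le> 1 / (q + 1)\<^sup>2" "1 / (q + 1)\<^sup>2 \<le> 1"
          using q by (auto simp: divide_le_eq_1 power2_eq_square intro: order_trans[OF _ mult_mono[of 1 "q+1" 1 "q+1"]])
        have "\<bar>power_log_prim q y\<bar> \<le> 1 / (q + 1) * \<bar>power_log q y\<bar> + 1 / (q + 1)\<^sup>2 * \<bar>y\<bar> powr (q + 1)"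
          unfolding power_log_prim_def using k by (intro order_trans[OF abs_triangle_ineq4]) (simp add: abs_mult)
        also have "\<dots> \<le> 1 * \<bar>power_log q y\<bar> + 1 * \<bar>y\<bar> powr (q + 1)" using k by (intro add_mono mult_right_mono) auto
        also have "\<dots> = (\<bar>\<bar>y\<bar> powr q * ln \<bar>y\<bar>\<bar> + \<bar>y\<bar> powr q) * \<bar>y\<bar>" unfolding power_log_def e by (simp add: abs_mult distrib_left distrib_right mult_ac)
        finally show ?thesis using that by (simp add: abs_divide pos_divide_le_eq)
      qed
      then show "\<forall>\<^sub>F y in at 0. norm (power_log_prim q y / y) \<le> \<bar>\<bar>y\<bar> powr q * ln \<bar>y\<bar>\<bar> + \<bar>y\<bar> powr q"
        by (auto simp: eventually_at_filter intro!: always_eventually)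
    qed
    then show ?thesis using 3 by (simp add: has_field_derivative_iff power_log_prim_def power_log_def power_log_der_def)
  qed (rule pos)
qed

text \<open>The logarithm breaks homogeneity by the summand with \<open>ln c\<close>; this is how
  the integral \<open>Q\<close> enters the analysis of rays.\<close>

lemma power_log_scale:
  assumes "c > 0"
  shows "power_log q (c * x) = c powr (q + 1) * (power_log q x + ln c * \<bar>x\<bar> powr (q + 1))"
proof (cases "x = 0")
  case False
  have "ln \<bar>c * x\<bar> = ln c + ln \<bar>x\<bar>" using assms False by (simp add: abs_mult ln_mult)
  then show ?thesis using assms by (simp add: power_log_def abs_mult powr_mult algebra_simps)
qed (simp add: power_log_def)

text \<open>The vector \<open>p * norm w powr (p - 2)\<close> times \<open>w\<close> is the gradient
  of the convex function \<open>norm w powr p\<close>. Cauchy-Schwarz reduces the claim to the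
  scalar tangent inequality in \<open>norm v\<close> and \<open>norm w\<close>.\<close>

lemma powr_norm_tangent_le:
  fixes v w :: "'b::real_inner"
  assumes p: "p \<ge> (1::real)"
  shows "norm w powr p + p * ((norm w powr (p - 2) *\<^sub>R w) \<bullet> (v - w)) \<le> norm v powr p"
proof (cases "w = 0")
  case False
  have e: "norm w powr (p - 1) = norm w powr (p - 2) * norm w"
    using False powr_add[of "norm w" "p - 2" 1] by simp
  have "w \<bullet> (v - w) \<le> norm w * (norm v - norm w)"
    using norm_cauchy_schwarz[of w v] by (simp add: inner_diff_right power2_norm_eq_inner[symmetric] power2_eq_square algebra_simps)
  then have "p * (norm w powr (p - 2) * (w \<bullet> (v - w))) \<le> p * (norm w powr (p - 2) * (norm w * (norm v - norm w)))"
    using p by (intro mult_left_mono) auto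
  then have "norm w powr p + p * ((norm w powr (p - 2) *\<^sub>R w) \<bullet> (v - w)) \<le> norm w powr p + p * norm w powr (p - 1) * (norm v - norm w)"
    by (simp add: e mult.assoc)
  also have "\<dots> \<le> norm v powr p" by (rule powr_tangent_le[OF p]) auto
  finally show ?thesis .
qed (use p in auto)

lemma norm_powr_scaleR_eq: "w \<noteq> 0 \<Longrightarrow> norm (norm w powr (p - 2) *\<^sub>R w) = norm w powr (p - 1)"
  using powr_add[of "norm w" "p - 2" 1] by simp

lemma continuous_duality_map:
  assumes p: "p \<ge> (2::real)"
  shows "continuous_on UNIV (\<lambda>w::'b::real_inner. norm w powr (p - 2) *\<^sub>R w)"
proof (rule continuous_at_imp_continuous_on, rule ballI)
  fix x :: 'b
  show "isCont (\<lambda>w. norm w powr (p - 2) *\<^sub>R w) x"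
  proof (cases "x = 0")
    case True
    have "((\<lambda>w::'b. norm w powr (p - 1)) \<longlongrightarrow> 0 powr (p - 1)) (at 0)"
      using p by (intro tendsto_powr' tendsto_norm_zero tendsto_ident_at tendsto_const) (auto intro!: always_eventually)
    then have "((\<lambda>w::'b. norm w powr (p - 1)) \<longlongrightarrow> 0) (at 0)" by simp
    then have "((\<lambda>w::'b. norm w powr (p - 2) *\<^sub>R w) \<longlongrightarrow> 0) (at 0)"
    proof (rule Lim_null_comparison[rotated])
      show "\<forall>\<^sub>F w::'b in at 0. norm (norm w powr (p - 2) *\<^sub>R w) \<le> norm w powr (p - 1)"
        unfolding eventually_at_filter
        by (intro always_eventually allI impI) (rule eq_refl[OF norm_powr_scaleR_eq])
    qed
    then show ?thesis using True by (simp add: isCont_def)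
  next
    case False
    then show ?thesis by (intro continuous_intros) auto
  qed
qed

section \<open>Minimisation on the Nehari manifold\<close>

locale kirchhoff = subcritical_domain \<Omega> p "q + 2" for \<Omega> :: "'a::euclidean_space set" and p q :: real +
  fixes a b :: real
  assumes a_pos: "a > 0" and b_pos: "b > 0" and q_gt: "2 * p - 1 < q" and nonempty_\<Omega>: "\<Omega> \<noteq> {}"
begin

lemma q_pos: "q > 0" "q > 1" "q + 1 > 0" "q + 1 > p" "q + 1 > 2 * p"
  using q_gt p2 by auto

definition L :: "('a \<Rightarrow> real) \<Rightarrow> real" where "L u = (\<integral>x. power_log q (u x) \<partial>M)"

definition Q :: "('a \<Rightarrow> real) \<Rightarrow> real" where "Q u = LP_int M (q + 1) u"

text \<open>In \<open>J\<close> and \<open>I\<close>, the argument \<open>e\<close> stands for \<open>\<parallel>\<nabla>u\<parallel>\<^sub>p\<^sup>p\<close>.\<close>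

definition J :: "real \<Rightarrow> ('a \<Rightarrow> real) \<Rightarrow> real" where
  "J e u = a / p * e + b / (2 * p) * e\<^sup>2 - 1 / (q + 1) * L u + 1 / (q + 1)\<^sup>2 * Q u"

definition I :: "real \<Rightarrow> ('a \<Rightarrow> real) \<Rightarrow> real" where
  "I e u = a * e + b * e\<^sup>2 - L u"

definition Nehari :: "(('a \<Rightarrow> real) \<times> ('a \<Rightarrow> 'a)) set" where
  "Nehari = {(u, G). W0 u G \<and> LP_int M p G > 0 \<and> I (LP_int M p G) u = 0}"

section \<open>The functionals on pairs: continuity and scaling\<close>

lemma LP_int_weak_gradient:
  assumes "W0 u G"
  shows "LP_int M p (weak_gradient \<Omega> u) = LP_int M p G"
  using W0_LP(2)[OF W0_weak_gradient[OF W0_imp_W01p(1)[OF assms]]] W0_LP(2)[OF assms]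
  by (intro LP_int_cong_AE W0_imp_W01p(2)[OF assms]) (auto dest: LP_measurable)

lemma Lp_norm_gradient:
  assumes "W0 u G"
  shows "Lp_norm p \<Omega> (weak_gradient \<Omega> u) powr p = LP_int M p G"
    "Lp_norm p \<Omega> (weak_gradient \<Omega> u) powr (2 * p) = (LP_int M p G)\<^sup>2"
    "Lp_norm p \<Omega> (weak_gradient \<Omega> u) \<noteq> 0 \<longleftrightarrow> LP_int M p G > 0"
proof -
  have eq: "Lp_norm p \<Omega> (weak_gradient \<Omega> u) = LP_int M p G powr (1 / p)"
    using LP_int_weak_gradient[OF assms] by (simp add: Lp_norm_def LP_int_def)
  have e: "LP_int M p G \<ge> 0" by (rule LP_int_nonneg)
  show "Lp_norm p \<Omega> (weak_gradient \<Omega> u) powr p = LP_int M p G"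
    "Lp_norm p \<Omega> (weak_gradient \<Omega> u) powr (2 * p) = (LP_int M p G)\<^sup>2"
    "Lp_norm p \<Omega> (weak_gradient \<Omega> u) \<noteq> 0 \<longleftrightarrow> LP_int M p G > 0"
    unfolding eq using p_pos e by (auto simp: powr_powr powr_numeral)
qed

lemma energy_J_eq:
  assumes "W0 u G"
  shows "energy_J a b p q \<Omega> u = J (LP_int M p G) u" "Nehari_I a b p q \<Omega> u = I (LP_int M p G) u"
  unfolding energy_J_def Nehari_I_def J_def I_def L_def Q_def power_log_def
  using Lp_norm_gradient[OF assms] Lp_norm_powr[of "q + 1" u] q_pos by simp_all

lemma W0_LPs: "W0 u G \<Longrightarrow> u \<in> LP M (q + 2)"
  using W0_Sobolev by blast

lemma LPs_q1: "u \<in> LP M (q + 2) \<Longrightarrow> u \<in> LP M (q + 1)"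
  by (rule LP_mono[where s="q + 2"]) (use q_pos in auto)

lemma power_log_integrable:
  assumes "u \<in> LP M (q + 2)"
  shows "integrable M (\<lambda>x. power_log q (u x))"
  by (rule LP_growth_integrable[OF assms power_log_continuous[OF q_pos(1)], of 2])
    (use power_log_bound[OF q_pos(1)] in simp)

lemma L_tendsto:
  assumes "\<And>k. u k \<in> LP M (q + 2)" "v \<in> LP M (q + 2)" "(\<lambda>k. LP_int M (q + 2) (\<lambda>x. u k x - v x)) \<longlonglongrightarrow> 0"
  shows "(\<lambda>k. L (u k)) \<longlonglongrightarrow> L v"
  unfolding L_def
  by (rule LP_Nemytskii[where p="q + 2" and C=2, OF _ assms power_log_continuous[OF q_pos(1)]])
    (use q_pos power_log_bound[OF q_pos(1)] in auto)

lemma Q_tendsto: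
  assumes "\<And>k. u k \<in> LP M (q + 2)" "v \<in> LP M (q + 2)" "(\<lambda>k. LP_int M (q + 2) (\<lambda>x. u k x - v x)) \<longlonglongrightarrow> 0"
  shows "(\<lambda>k. Q (u k)) \<longlonglongrightarrow> Q v"
  unfolding Q_def
  by (rule LP_int_tendsto[OF q_pos(3) LPs_q1[OF assms(1)] LPs_q1[OF assms(2)]])
    (rule LP_lim_mono[where s="q + 2", OF q_pos(3) _ assms], simp)

lemma L_scale:
  assumes "u \<in> LP M (q + 2)" "c > 0"
  shows "L (\<lambda>x. c * u x) = c powr (q + 1) * (L u + ln c * Q u)"
  unfolding L_def Q_def LP_int_def power_log_scale[OF assms(2)]
  using power_log_integrable[OF assms(1)] LP_integrable[OF LPs_q1[OF assms(1)]] by simp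

lemma Q_scale: "c > 0 \<Longrightarrow> Q (\<lambda>x. c * u x) = c powr (q + 1) * Q u"
  using LP_int_scaleR[of M "q + 1" c u] by (simp add: Q_def)

lemma Q_nonneg: "Q u \<ge> 0"
  unfolding Q_def by (rule LP_int_nonneg)

lemma W0_scale: "W0 u G \<Longrightarrow> W0 (\<lambda>x. c * u x) (\<lambda>x. c *\<^sub>R G x)"
  using W0_lincomb[of u G u G c 0] by simp

section \<open>Rays and the projection onto the Nehari manifold\<close>

lemma I_scale:
  assumes "u \<in> LP M (q + 2)" "c > 0"
  shows "I (c powr p * e) (\<lambda>x. c * u x) = a * e * c powr p + b * e\<^sup>2 * c powr (2 * p) - c powr (q + 1) * (L u + ln c * Q u)"
proof -
  have "(c powr p * e)\<^sup>2 = e\<^sup>2 * c powr (2 * p)"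
    unfolding mult_2[of p] powr_add by (simp add: power2_eq_square)
  then show ?thesis unfolding I_def L_scale[OF assms] by (simp add: mult_ac)
qed

lemma J_scale:
  assumes "u \<in> LP M (q + 2)" "c > 0"
  shows "J (c powr p * e) (\<lambda>x. c * u x) = a * e / p * c powr p + b * e\<^sup>2 / (2 * p) * c powr (2 * p)
    - 1 / (q + 1) * (c powr (q + 1) * (L u + ln c * Q u)) + 1 / (q + 1)\<^sup>2 * Q u * c powr (q + 1)"
proof -
  have "(c powr p * e)\<^sup>2 = e\<^sup>2 * c powr (2 * p)"
    unfolding mult_2[of p] powr_add by (simp add: power2_eq_square)
  then show ?thesis unfolding J_def L_scale[OF assms] Q_scale[OF assms(2)] by (simp add: mult_ac)
qed

text \<open>At a zero of \<open>I\<close> one has \<open>L u = a * e + b * e^2\<close>, so on the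
  ray the powers \<open>c powr p\<close> and \<open>c powr (2 * p)\<close> compete with
  \<open>c powr (q + 1)\<close>, whose exponent is larger. The term \<open>ln c * Q u\<close> only
  reinforces the sign.\<close>

lemma fiber_sign:
  assumes u: "u \<in> LP M (q + 2)" and e: "e > 0" and zero: "I e u = 0"
  shows "0 < c \<Longrightarrow> c < 1 \<Longrightarrow> I (c powr p * e) (\<lambda>x. c * u x) > 0"
    and "1 < c \<Longrightarrow> I (c powr p * e) (\<lambda>x. c * u x) < 0"
proof -
  have Lu: "L u = a * e + b * e\<^sup>2" using zero by (simp add: I_def)
  have ae: "a * e > 0" "b * e\<^sup>2 > 0" using a_pos b_pos e by auto
  {
    assume c: "0 < c" "c < 1"
    have "c powr (q + 1) * (L u + ln c * Q u) \<le> c powr (q + 1) * L u"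
      using c Q_nonneg[of u] by (intro mult_left_mono) (auto simp: mult_nonpos_nonneg)
    also have "\<dots> = a * e * c powr (q + 1) + b * e\<^sup>2 * c powr (q + 1)" by (simp add: Lu algebra_simps)
    also have "\<dots> < a * e * c powr p + b * e\<^sup>2 * c powr (2 * p)"
      using c q_pos ae by (intro add_strict_mono mult_strict_left_mono powr_less_mono') auto
    finally show "I (c powr p * e) (\<lambda>x. c * u x) > 0" unfolding I_scale[OF u c(1)] by simp
  }
  {
    assume c: "1 < c"
    have "a * e * c powr p + b * e\<^sup>2 * c powr (2 * p) < a * e * c powr (q + 1) + b * e\<^sup>2 * c powr (q + 1)"
      using c q_pos ae by (intro add_strict_mono mult_strict_left_mono powr_less_mono) auto
    also have "\<dots> = c powr (q + 1) * L u" by (simp add: Lu algebra_simps)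
    also have "\<dots> \<le> c powr (q + 1) * (L u + ln c * Q u)"
      using c Q_nonneg[of u] by (intro mult_left_mono) auto
    finally show "I (c powr p * e) (\<lambda>x. c * u x) < 0"
      using c I_scale[OF u, of c e] by simp
  }
qed

text \<open>Differentiating \<open>ln c\<close> produces an extra multiple of \<open>Q u\<close>,
  and the last term of \<open>J\<close> has precisely the coefficient that cancels it. What remains
  is \<open>I\<close> on the ray, divided by \<open>c\<close>.\<close>

lemma J_fiber_derivative:
  assumes u: "u \<in> LP M (q + 2)" and c: "c > 0"
  shows "((\<lambda>c. J (c powr p * e) (\<lambda>x. c * u x)) has_real_derivative I (c powr p * e) (\<lambda>x. c * u x) / c) (at c)"
proof -
  let ?j = "\<lambda>c. a * e / p * c powr p + b * e\<^sup>2 / (2 * p) * c powr (2 * p)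
    - 1 / (q + 1) * (c powr (q + 1) * (L u + ln c * Q u)) + 1 / (q + 1)\<^sup>2 * Q u * c powr (q + 1)"
  have P: "((\<lambda>c. c powr r) has_real_derivative r * (c powr r / c)) (at c)" for r
    using has_real_derivative_powr[OF c, of r] c by (simp add: powr_diff)
  have l: "((\<lambda>c. L u + ln c * Q u) has_real_derivative 0 + 1 / c * Q u) (at c)"
    by (intro DERIV_add DERIV_const DERIV_cmult_right DERIV_ln_divide c)
  have "(?j has_real_derivative a * e / p * (p * (c powr p / c)) + b * e\<^sup>2 / (2 * p) * (2 * p * (c powr (2 * p) / c))
     - 1 / (q + 1) * ((q + 1) * (c powr (q + 1) / c) * (L u + ln c * Q u) + (0 + 1 / c * Q u) * c powr (q + 1))
     + 1 / (q + 1)\<^sup>2 * Q u * ((q + 1) * (c powr (q + 1) / c))) (at c)"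
    by (intro DERIV_add DERIV_diff DERIV_cmult DERIV_mult P l)
  also have "a * e / p * (p * (c powr p / c)) + b * e\<^sup>2 / (2 * p) * (2 * p * (c powr (2 * p) / c))
     - 1 / (q + 1) * ((q + 1) * (c powr (q + 1) / c) * (L u + ln c * Q u) + (0 + 1 / c * Q u) * c powr (q + 1))
     + 1 / (q + 1)\<^sup>2 * Q u * ((q + 1) * (c powr (q + 1) / c)) = I (c powr p * e) (\<lambda>x. c * u x) / c"
  proof -
    have k: "1 / k * (k * (X / c) * Y + (0 + 1 / c * Z) * X) - 1 / k\<^sup>2 * Z * (k * (X / c)) = X * Y / c"
      if "k \<noteq> 0" for k X Y Z :: real
      using that c by (simp add: divide_simps power2_eq_square)
    have 1: "a * e / p * (p * (c powr p / c)) = a * e * c powr p / c" using p_pos by simp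
    have 2: "b * e\<^sup>2 / (2 * p) * (2 * p * (c powr (2 * p) / c)) = b * e\<^sup>2 * c powr (2 * p) / c" using p_pos by simp
    show ?thesis
      unfolding I_scale[OF u c] diff_divide_distrib add_divide_distrib 1 2
      using k[of "q + 1" "c powr (q + 1)" "L u + ln c * Q u" "Q u"] q_pos by linarith
  qed
  finally have "(?j has_real_derivative I (c powr p * e) (\<lambda>x. c * u x) / c) (at c)" .
  then show ?thesis
    by (rule has_field_derivative_transform_within_open[where S="{0<..}"]) (use c in \<open>auto simp: J_scale[OF u]\<close>)
qed

lemma J_fiber_max:
  assumes u: "u \<in> LP M (q + 2)" and e: "e > 0" and zero: "I e u = 0" and c: "c > 0"
  shows "J (c powr p * e) (\<lambda>x. c * u x) \<le> J e u"
proof -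
  let ?j = "\<lambda>c. J (c powr p * e) (\<lambda>x. c * u x)"
  have one: "I (1 powr p * e) (\<lambda>x. 1 * u x) = 0" "?j 1 = J e u" using zero by simp_all
  have "?j c \<le> ?j 1"
  proof (cases "c \<le> 1")
    case True
    show ?thesis
    proof (rule DERIV_nonneg_imp_nondecreasing[OF True])
      fix x assume x: "c \<le> x" "x \<le> 1"
      have "I (x powr p * e) (\<lambda>y. x * u y) / x \<ge> 0"
        using x c fiber_sign(1)[OF u e zero, of x] one(1) by (cases "x = 1") auto
      then show "\<exists>y. (?j has_real_derivative y) (at x) \<and> 0 \<le> y"
        using J_fiber_derivative[OF u, of x e] x c by (intro exI conjI) auto
    qed
  next
    case False
    show ?thesis
    proof (rule DERIV_nonpos_imp_nonincreasing[of 1 c])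
      fix x assume x: "1 \<le> x" "x \<le> c"
      have "I (x powr p * e) (\<lambda>y. x * u y) / x \<le> 0"
        using x c fiber_sign(2)[OF u e zero, of x] one(1) by (cases "x = 1") (auto simp: divide_nonpos_pos)
      then show "\<exists>y. (?j has_real_derivative y) (at x) \<and> y \<le> 0"
        using J_fiber_derivative[OF u, of x e] x by (intro exI conjI) auto
    qed (use False in auto)
  qed
  then show ?thesis using one(2) by simp
qed

text \<open>For small \<open>c\<close> the term of order \<open>c powr p\<close> beats those of
  order \<open>c powr (q + 1)\<close>, and \<open>ln c * Q u\<close> has the favourable sign below
  \<open>1\<close>. So \<open>I\<close> starts nonnegative, and the intermediate value theorem gives
  a zero up to \<open>c = 1\<close>.\<close>

lemma Nehari_projection:
  assumes u: "u \<in> LP M (q + 2)" and e: "e > 0" and le: "I e u \<le> 0"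
  shows "\<exists>c. 0 < c \<and> c \<le> 1 \<and> I (c powr p * e) (\<lambda>x. c * u x) = 0"
proof -
  let ?g = "\<lambda>c. I (c powr p * e) (\<lambda>x. c * u x)"
  have ae: "a * e > 0" "b * e\<^sup>2 > 0" using a_pos b_pos e by auto
  have "((\<lambda>c. c powr (q + 1 - p) * \<bar>L u\<bar>) \<longlongrightarrow> 0 powr (q + 1 - p) * \<bar>L u\<bar>) (at_right 0)"
    using q_pos by (intro tendsto_intros tendsto_powr') (auto simp: eventually_at_filter)
  then have "((\<lambda>c. c powr (q + 1 - p) * \<bar>L u\<bar>) \<longlongrightarrow> 0) (at_right 0)" by simp
  then have 1: "\<forall>\<^sub>F c in at_right 0. c powr (q + 1 - p) * \<bar>L u\<bar> < a * e" using ae(1) by (rule order_tendstoD(2))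
  have 2: "\<forall>\<^sub>F c in at_right (0::real). c \<in> {0<..<1}" using eventually_at_right_real[of 0 1] by auto
  obtain c0 where c0: "c0 powr (q + 1 - p) * \<bar>L u\<bar> < a * e" "0 < c0" "c0 < 1"
    using eventually_happens'[OF trivial_limit_at_right_real eventually_conj[OF 1 2]] by auto
  have "c0 powr (q + 1) * (L u + ln c0 * Q u) \<le> c0 powr (q + 1) * \<bar>L u\<bar>"
  proof (rule mult_left_mono)
    have "ln c0 * Q u \<le> 0" using c0 Q_nonneg[of u] by (simp add: mult_nonpos_nonneg)
    then show "L u + ln c0 * Q u \<le> \<bar>L u\<bar>" by linarith
  qed simp
  also have "\<dots> = c0 powr p * (c0 powr (q + 1 - p) * \<bar>L u\<bar>)" using c0 by (simp add: powr_diff)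
  also have "\<dots> < c0 powr p * (a * e)" using c0 by (intro mult_strict_left_mono) auto
  also have "\<dots> = a * e * c0 powr p" by simp
  finally have "c0 powr (q + 1) * (L u + ln c0 * Q u) < a * e * c0 powr p" .
  moreover have "0 \<le> b * e\<^sup>2 * c0 powr (2 * p)" using b_pos by simp
  ultimately have pos: "?g c0 \<ge> 0" unfolding I_scale[OF u c0(2)] by linarith
  have "\<exists>c\<ge>c0. c \<le> 1 \<and> ?g c = 0"
  proof (rule IVT2')
    show "?g 1 \<le> 0" using le by simp
    show "?g c0 \<ge> 0" by (rule pos)
    have "continuous_on {c0..1} (\<lambda>c. a * e * c powr p + b * e\<^sup>2 * c powr (2 * p) - c powr (q + 1) * (L u + ln c * Q u))"
      using c0 by (intro continuous_intros) auto
    then show "continuous_on {c0..1} ?g"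
      by (rule continuous_on_eq) (use c0 I_scale[OF u] in auto)
  qed (use c0 in auto)
  then show ?thesis using c0(2) by (meson less_le_trans)
qed

lemma LP_int_gradient_scale: "c > 0 \<Longrightarrow> LP_int M p (\<lambda>x. c *\<^sub>R G x) = c powr p * LP_int M p G"
  by (simp add: LP_int_scaleR)

lemma Nehari_projection':
  assumes W: "W0 u G" and e: "LP_int M p G > 0" and le: "I (LP_int M p G) u \<le> 0"
  obtains c where "0 < c" "c \<le> 1" "((\<lambda>x. c * u x), (\<lambda>x. c *\<^sub>R G x)) \<in> Nehari"
proof -
  obtain c where c: "0 < c" "c \<le> 1" "I (c powr p * LP_int M p G) (\<lambda>x. c * u x) = 0"
    using Nehari_projection[OF W0_LPs[OF W] e le] by blast
  have "((\<lambda>x. c * u x), (\<lambda>x. c *\<^sub>R G x)) \<in> Nehari"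
    unfolding Nehari_def using c e W0_scale[OF W, of c] by (simp add: LP_int_gradient_scale)
  then show ?thesis using c that by blast
qed

section \<open>Bounds on the Nehari manifold and existence of a minimiser\<close>

lemma L_le_Sobolev:
  assumes "u \<in> LP M (q + 2)"
  shows "L u \<le> LP_int M (q + 2) u"
  unfolding L_def LP_int_def using power_log_le
  by (intro integral_mono power_log_integrable[OF assms] LP_integrable[OF assms]) simp

lemma W0_zero_gradient:
  assumes W: "W0 u G" and "LP_int M p G = 0"
  shows "AE x in M. u x = 0"
proof -
  obtain C where "LP_int M (q + 2) u \<le> C * LP_int M p G powr ((q + 2) / p)" using W0_Sobolev W by blast
  then have "LP_int M (q + 2) u = 0" using assms(2) LP_int_nonneg[of M "q + 2" u] by simp
  then show ?thesis by (rule LP_int_eq_0_AE[OF W0_LPs[OF W]])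
qed

text \<open>\<open>L\<close> of a bump may be negative, but \<open>ln c * Q\<close> grows without
  bound in \<open>c\<close>, so a large multiple has \<open>I \<le> 0\<close> and can be
  projected.\<close>

lemma Nehari_nonempty: "Nehari \<noteq> {}"
proof -
  obtain x0 where "x0 \<in> \<Omega>" using nonempty_\<Omega> by blast
  then obtain u v where uv: "x0 \<in> box u v" "cbox u v \<subseteq> \<Omega>"
    using open_contains_cbox[OF open_\<Omega>] by metis
  define \<phi> where "\<phi> = box_bump u v 1"
  have \<phi>: "\<phi> \<in> test_functions \<Omega>" unfolding \<phi>_def using box_bump_test[OF _ uv(2), of 1] by simp
  note W = W0_test[OF \<phi>]
  have nz: "\<not> (AE x in M. \<phi> x = 0)"
  proof
    assume "AE x in M. \<phi> x = 0"
    then have "AE x in lebesgue. x \<in> \<Omega> \<longrightarrow> \<phi> x = 0" using \<Omega>_sets(1) by (subst (asm) AE_restrict_space_iff) auto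
    then have "AE x in lebesgue. x \<notin> box u v"
    proof eventually_elim
      case (elim x)
      then show ?case using box_bump_pos_iff[of 1 u v x] uv(2) box_subset_cbox[of u v] by (auto simp: \<phi>_def)
    qed
    then have "negligible (box u v)" by (simp add: negligible_iff_null_sets AE_iff_null_sets[symmetric])
    then show False using uv(1) open_box open_not_negligible by blast
  qed
  define e where "e = LP_int M p (grad \<phi>)"
  have e: "e > 0" unfolding e_def using W0_zero_gradient[OF W] nz LP_int_nonneg[of M p "grad \<phi>"] less_le by metis
  have Qp: "Q \<phi> > 0"
    unfolding Q_def using LP_int_eq_0_AE[OF LPs_q1[OF W0_LPs[OF W]]] nz LP_int_nonneg[of M "q + 1" \<phi>] less_le by metis
  have ae: "a * e > 0" "b * e\<^sup>2 > 0" using a_pos b_pos e by auto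
  \<comment> \<open>The exponent makes \<open>L \<phi> + ln c * Q \<phi>\<close> at least
    \<open>a * e + b * e^2\<close>. The maximum with \<open>0\<close> ensures
    \<open>c \<ge> 1\<close>, where \<open>c powr (q + 1)\<close> is the largest of the three
    powers.\<close>
  define c where "c = exp (max 0 ((a * e + b * e\<^sup>2 - L \<phi>) / Q \<phi>))"
  have c: "c \<ge> 1" by (simp add: c_def)
  have lnc: "ln c \<ge> (a * e + b * e\<^sup>2 - L \<phi>) / Q \<phi>" by (simp add: c_def)
  have "(a * e + b * e\<^sup>2 - L \<phi>) / Q \<phi> * Q \<phi> \<le> ln c * Q \<phi>" using lnc Qp by (intro mult_right_mono) auto
  then have ge: "a * e + b * e\<^sup>2 \<le> L \<phi> + ln c * Q \<phi>" using Qp by simp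
  have "a * e * c powr p + b * e\<^sup>2 * c powr (2 * p) \<le> a * e * c powr (q + 1) + b * e\<^sup>2 * c powr (q + 1)"
    using ae q_pos c by (intro add_mono mult_left_mono powr_mono) auto
  also have "\<dots> = c powr (q + 1) * (a * e + b * e\<^sup>2)" by (simp add: algebra_simps)
  also have "\<dots> \<le> c powr (q + 1) * (L \<phi> + ln c * Q \<phi>)" using ge by (intro mult_left_mono) auto
  finally have "I (c powr p * e) (\<lambda>x. c * \<phi> x) \<le> 0" using I_scale[OF W0_LPs[OF W], of c e] c by simp
  moreover have "LP_int M p (\<lambda>x. c *\<^sub>R grad \<phi> x) = c powr p * e"
    using c by (simp add: LP_int_gradient_scale e_def)
  moreover have "c powr p * e > 0" using c e by simp
  ultimately show ?thesis using Nehari_projection'[OF W0_scale[OF W, of c]] by auto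
qed

text \<open>On the manifold \<open>a * e \<le> L u\<close>, and the Sobolev inequality bounds
  \<open>L u\<close> by \<open>C * e powr ((q + 2) / p)\<close>. As this exponent exceeds
  \<open>1\<close>, division by \<open>e\<close> leaves a positive power of \<open>e\<close> that is
  bounded below.\<close>

lemma Nehari_energy_bound: "\<exists>c0>0. \<forall>(u, G)\<in>Nehari. c0 \<le> LP_int M p G"
proof -
  obtain C where C: "C > 0" "\<And>u G. W0 u G \<Longrightarrow> LP_int M (q + 2) u \<le> C * LP_int M p G powr ((q + 2) / p)"
    using W0_Sobolev by blast
  define r where "r = (q + 2) / p - 1"
  have r: "r > 0" using q_pos p_pos by (simp add: r_def field_simps)
  have "(a / C) powr (1 / r) \<le> LP_int M p G" if uG: "(u, G) \<in> Nehari" for u G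
  proof -
    have W: "W0 u G" and e: "LP_int M p G > 0" and I0: "I (LP_int M p G) u = 0" using uG by (auto simp: Nehari_def)
    let ?e = "LP_int M p G"
    have "0 \<le> b * ?e\<^sup>2" using b_pos by simp
    then have "a * ?e \<le> L u" using I0 unfolding I_def by linarith
    also have "\<dots> \<le> LP_int M (q + 2) u" by (rule L_le_Sobolev[OF W0_LPs[OF W]])
    also have "\<dots> \<le> C * ?e powr ((q + 2) / p)" by (rule C(2)[OF W])
    also have "\<dots> = C * (?e powr r * ?e)" using e by (simp add: r_def powr_diff)
    finally have "a \<le> C * ?e powr r" using e by (simp add: mult.assoc[symmetric])
    then have "a / C \<le> ?e powr r" using C(1) by (simp add: pos_divide_le_eq mult.commute)
    then have "(a / C) powr (1 / r) \<le> (?e powr r) powr (1 / r)"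
      using a_pos C(1) r by (intro powr_mono2) auto
    also have "\<dots> = ?e" using e r by (simp add: powr_powr)
    finally show ?thesis .
  qed
  moreover have "(a / C) powr (1 / r) > 0" using a_pos C(1) by simp
  ultimately show ?thesis by (intro exI[of _ "(a / C) powr (1 / r)"]) auto
qed

text \<open>\<open>J\<close> with \<open>L u\<close> eliminated by the equation
  \<open>I e u = 0\<close>. Unlike \<open>J\<close> it is monotone in \<open>e\<close> and
  \<open>Q u\<close>, so it behaves well when the energy drops in a limit or under
  shrinking.\<close>

definition JN :: "real \<Rightarrow> ('a \<Rightarrow> real) \<Rightarrow> real" where
  "JN e u = a * (1 / p - 1 / (q + 1)) * e + b * (1 / (2 * p) - 1 / (q + 1)) * e\<^sup>2 + 1 / (q + 1)\<^sup>2 * Q u"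

lemma JN_coefficients: "a * (1 / p - 1 / (q + 1)) > 0" "b * (1 / (2 * p) - 1 / (q + 1)) > 0" "1 / (q + 1)\<^sup>2 > 0"
proof -
  have "1 / (q + 1) < 1 / p" "1 / (q + 1) < 1 / (2 * p)"
    using q_pos p_pos by (auto intro!: divide_strict_left_mono)
  then show "a * (1 / p - 1 / (q + 1)) > 0" "b * (1 / (2 * p) - 1 / (q + 1)) > 0" using a_pos b_pos by auto
qed (use q_pos in auto)

lemma J_eq_JN: "I e u = 0 \<Longrightarrow> J e u = JN e u"
proof -
  assume "I e u = 0"
  then have "L u = a * e + b * e\<^sup>2" by (simp add: I_def)
  then show ?thesis by (simp add: J_def JN_def algebra_simps)
qed

lemma JN_mono: "0 \<le> e \<Longrightarrow> e \<le> e' \<Longrightarrow> Q u \<le> Q u' \<Longrightarrow> JN e u \<le> JN e' u'"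
  unfolding JN_def using JN_coefficients by (intro add_mono mult_left_mono power_mono) auto

lemma JN_nonneg: "0 \<le> e \<Longrightarrow> 0 \<le> JN e u"
  unfolding JN_def using Q_nonneg[of u]
  by (intro add_nonneg_nonneg mult_nonneg_nonneg[OF less_imp_le[OF JN_coefficients(1)]]
      mult_nonneg_nonneg[OF less_imp_le[OF JN_coefficients(2)]] mult_nonneg_nonneg[OF less_imp_le[OF JN_coefficients(3)]]) auto

theorem Nehari_minimizer:
  obtains u G where "(u, G) \<in> Nehari" "\<And>v H. (v, H) \<in> Nehari \<Longrightarrow> J (LP_int M p G) u \<le> J (LP_int M p H) v"
proof -
  define F :: "('a \<Rightarrow> real) \<times> ('a \<Rightarrow> 'a) \<Rightarrow> real" where "F = (\<lambda>(u, G). JN (LP_int M p G) u)"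
  define d where "d = Inf (F ` Nehari)"
  have F0: "F w \<ge> 0" for w unfolding F_def by (cases w) (simp add: JN_nonneg LP_int_nonneg)
  have bdd: "bdd_below (F ` Nehari)" using F0 by (intro bdd_belowI2[of _ 0])
  have "\<exists>w\<in>Nehari. F w < d + inverse (real (Suc k))" for k
    using cInf_lessD[of "F ` Nehari" "d + inverse (real (Suc k))"] Nehari_nonempty by (auto simp: d_def simp del: of_nat_Suc)
  then obtain w where w: "\<And>k. w k \<in> Nehari" "\<And>k. F (w k) < d + inverse (real (Suc k))" by metis
  define u where "u k = fst (w k)" for k
  define G where "G k = snd (w k)" for k
  define e where "e k = LP_int M p (G k)" for k
  have uG: "W0 (u k) (G k)" "e k > 0" "I (e k) (u k) = 0" "(u k, G k) \<in> Nehari" for k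
    using w(1)[of k] by (auto simp: u_def G_def e_def Nehari_def split: prod.splits)
  have Fk: "JN (e k) (u k) < d + inverse (real (Suc k))" for k
    using w(2)[of k] by (simp add: F_def u_def G_def e_def split: prod.splits)
  have d_le: "d \<le> JN (LP_int M p H) v" if "(v, H) \<in> Nehari" for v H
    using cInf_lower[OF _ bdd, of "JN (LP_int M p H) v"] that unfolding d_def by (force simp: F_def)
  define A where "A = a * (1 / p - 1 / (q + 1))"
  have A: "A > 0" unfolding A_def by (rule JN_coefficients)
  have e_bd: "e k \<le> (d + 1) / A" for k
  proof -
    have "A * e k \<le> JN (e k) (u k)"
      unfolding JN_def A_def using JN_coefficients Q_nonneg[of "u k"] by simp
    also have "\<dots> \<le> d + 1" using Fk[of k] inverse_le_1_iff[of "real (Suc k)"] by (simp add: inverse_eq_divide divide_le_eq_1 order_trans[OF less_imp_le])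
    finally show ?thesis using A by (simp add: pos_le_divide_eq mult.commute)
  qed
  obtain r v where r: "strict_mono (r :: nat \<Rightarrow> nat)" and v: "v \<in> LP M (q + 2)"
    and lim: "(\<lambda>k. LP_int M (q + 2) (\<lambda>x. u (r k) x - v x)) \<longlonglongrightarrow> 0"
    using W0_Rellich[where u=u and G=G and B="(d + 1) / A", OF uG(1)] e_bd unfolding e_def by blast
  \<comment> \<open>A second subsequence makes the energies converge; lower semicontinuity is
    formulated with their limit \<open>l\<close>.\<close>
  have "bounded (range (\<lambda>k. e (r k)))"
    using e_bd uG(2) by (intro boundedI[of _ "(d + 1) / A"]) (auto simp: less_imp_le)
  then obtain l r' where r': "strict_mono (r' :: nat \<Rightarrow> nat)" "((\<lambda>k. e (r k)) \<circ> r') \<longlonglongrightarrow> l"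
    using bounded_imp_convergent_subsequence by blast
  define t where "t k = r (r' k)" for k
  have el: "(\<lambda>k. e (t k)) \<longlonglongrightarrow> l" using r'(2) by (simp add: t_def o_def)
  have lim': "(\<lambda>k. LP_int M (q + 2) (\<lambda>x. u (t k) x - v x)) \<longlonglongrightarrow> 0"
    using LIMSEQ_subseq_LIMSEQ[OF lim r'(1)] by (simp add: t_def o_def)
  obtain H where H: "W0 v H" "LP_int M p H \<le> l"
    using W0_lower_semicontinuous[where u="\<lambda>k. u (t k)" and G="\<lambda>k. G (t k)" and e=l, OF uG(1) v lim'] el
    unfolding e_def by blast
  have Lt: "(\<lambda>k. L (u (t k))) \<longlonglongrightarrow> L v"
    by (rule L_tendsto[OF W0_LPs[OF uG(1)] v lim'])
  have Qt: "(\<lambda>k. Q (u (t k))) \<longlonglongrightarrow> Q v"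
    by (rule Q_tendsto[OF W0_LPs[OF uG(1)] v lim'])
  have "(\<lambda>k. a * e (t k) + b * (e (t k))\<^sup>2) \<longlonglongrightarrow> a * l + b * l\<^sup>2"
    by (intro tendsto_intros el)
  moreover have "a * e k + b * (e k)\<^sup>2 = L (u k)" for k using uG(3)[of k] by (simp add: I_def)
  \<comment> \<open>Strong convergence preserves the constraint with the limiting energy
    \<open>l\<close>, which may exceed the energy of \<open>H\<close>.\<close>
  ultimately have Lv: "L v = a * l + b * l\<^sup>2" using LIMSEQ_unique[OF Lt] by simp
  obtain c0 where c0: "c0 > 0" "\<And>u G. (u, G) \<in> Nehari \<Longrightarrow> c0 \<le> LP_int M p G"
    using Nehari_energy_bound by blast
  \<comment> \<open>The uniform lower bound on the manifold keeps the limit nontrivial: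
    \<open>L v\<close> is positive, so \<open>v\<close> is not zero.\<close>
  have "c0 \<le> l" by (rule LIMSEQ_le_const[OF el]) (use c0(2)[OF uG(4)] in \<open>auto simp: e_def\<close>)
  then have l: "l > 0" using c0 by simp
  have Lv_pos: "L v > 0" unfolding Lv using l a_pos b_pos by (simp add: add_pos_pos)
  have EH: "LP_int M p H > 0"
  proof (rule ccontr)
    assume "\<not> LP_int M p H > 0"
    then have "LP_int M p H = 0" using LP_int_nonneg[of M p H] by simp
    then have "AE x in M. v x = 0" by (rule W0_zero_gradient[OF H(1)])
    then have "L v = (\<integral>x. 0 \<partial>M)"
      unfolding L_def using borel_measurable_integrable[OF power_log_integrable[OF v]]
      by (intro integral_cong_AE) (auto simp: power_log_def elim!: eventually_mono)
    then show False using Lv_pos by simp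
  qed
  \<comment> \<open>The energy can only have dropped from \<open>l\<close> while \<open>L v\<close>
    kept its value. The projection therefore shrinks \<open>v\<close>, and shrinking does not
    increase \<open>JN\<close>.\<close>
  have "I (LP_int M p H) v \<le> 0"
    unfolding I_def Lv using H(2) EH a_pos b_pos by (simp add: add_mono mult_left_mono power_mono less_imp_le)
  then obtain c where c: "0 < c" "c \<le> 1" "((\<lambda>x. c * v x), (\<lambda>x. c *\<^sub>R H x)) \<in> Nehari"
    using Nehari_projection'[OF H(1) EH] by blast
  have cpow: "c powr x \<le> 1" if "x \<ge> 0" for x using c that by (intro powr_le1) auto
  have "JN (LP_int M p (\<lambda>x. c *\<^sub>R H x)) (\<lambda>x. c * v x) \<le> JN l v"
  proof (rule JN_mono)
    show "LP_int M p (\<lambda>x. c *\<^sub>R H x) \<le> l"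
      unfolding LP_int_gradient_scale[OF c(1)] using cpow[OF p_pos(3)] EH H(2)
      by (intro order_trans[OF mult_left_le_one_le]) auto
    show "Q (\<lambda>x. c * v x) \<le> Q v"
      unfolding Q_scale[OF c(1)] using cpow[of "q + 1"] q_pos Q_nonneg[of v] by (intro mult_left_le_one_le) auto
  qed (rule LP_int_nonneg)
  also have "JN l v \<le> d"
  proof (rule LIMSEQ_le)
    show "(\<lambda>k. JN (e (t k)) (u (t k))) \<longlonglongrightarrow> JN l v" unfolding JN_def by (intro tendsto_intros el Qt)
    have "(\<lambda>k. d + inverse (real (Suc k))) \<longlonglongrightarrow> d + 0" by (intro tendsto_intros LIMSEQ_inverse_real_of_nat)
    then have "(\<lambda>k. d + inverse (real (Suc k))) \<longlonglongrightarrow> d" by simp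
    from LIMSEQ_subseq_LIMSEQ[OF this strict_mono_o[OF r r'(1)]]
    show "(\<lambda>k. d + inverse (real (Suc (t k)))) \<longlonglongrightarrow> d" by (simp add: o_def t_def)
    show "\<exists>N. \<forall>k\<ge>N. JN (e (t k)) (u (t k)) \<le> d + inverse (real (Suc (t k)))" using Fk less_imp_le by blast
  qed
  finally have min: "JN (LP_int M p (\<lambda>x. c *\<^sub>R H x)) (\<lambda>x. c * v x) \<le> d" .
  have J_JN: "J (LP_int M p H) v = JN (LP_int M p H) v" if "(v, H) \<in> Nehari" for v H
    using that by (intro J_eq_JN) (auto simp: Nehari_def)
  show ?thesis
  proof (rule that[OF c(3)])
    fix v' H' assume v': "(v', H') \<in> Nehari"
    show "J (LP_int M p (\<lambda>x. c *\<^sub>R H x)) (\<lambda>x. c * v x) \<le> J (LP_int M p H') v'"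
      using min d_le[OF v'] unfolding J_JN[OF c(3)] J_JN[OF v'] by linarith
  qed
qed

end

section \<open>Minimisers are solutions\<close>

lemma power_log_prim_mvt: "q > 1 \<Longrightarrow> \<exists>z. \<bar>z - y\<bar> \<le> \<bar>h\<bar> \<and> power_log_prim q (y + h) - power_log_prim q y = h * power_log_der q z"
proof -
  assume q: "q > 1"
  note der = power_log_prim_has_derivative[OF q]
  consider "h = 0" | "h > 0" | "h < 0" by linarith
  then show ?thesis
  proof cases
    case 2
    then obtain z where "y < z" "z < y + h" "power_log_prim q (y + h) - power_log_prim q y = (y + h - y) * power_log_der q z"
      using MVT2[of y "y + h" "power_log_prim q" "power_log_der q"] der by auto
    then show ?thesis by (intro exI[of _ z]) auto
  next
    case 3
    then obtain z where z: "y + h < z" "z < y" "power_log_prim q y - power_log_prim q (y + h) = (y - (y + h)) * power_log_der q z"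
      using MVT2[of "y + h" y "power_log_prim q" "power_log_der q"] der by auto
    from z(3) have "power_log_prim q (y + h) - power_log_prim q y = h * power_log_der q z" by (simp add: algebra_simps)
    then show ?thesis using z(1,2) by (intro exI[of _ z]) auto
  qed auto
qed

context kirchhoff
begin

section \<open>Perturbation of a minimiser along the manifold\<close>

lemma LP_int_lincomb_tendsto:
  fixes f g :: "'a \<Rightarrow> 'b::euclidean_space"
  assumes r: "r > 0" and f: "f \<in> LP M r" and g: "g \<in> LP M r"
    and c: "c \<longlonglongrightarrow> c0" and d: "d \<longlonglongrightarrow> d0"
  shows "(\<lambda>k. LP_int M r (\<lambda>x. (c k *\<^sub>R f x + d k *\<^sub>R g x) - (c0 *\<^sub>R f x + d0 *\<^sub>R g x))) \<longlonglongrightarrow> 0"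
proof (rule tendsto_sandwich[OF _ _ tendsto_const])
  have eq: "(c k *\<^sub>R f x + d k *\<^sub>R g x) - (c0 *\<^sub>R f x + d0 *\<^sub>R g x) = (c k - c0) *\<^sub>R f x + (d k - d0) *\<^sub>R g x" for k x
    by (simp add: scaleR_diff_left)
  have r0: "r \<ge> 0" using r by simp
  have "(\<lambda>k. \<bar>c k - c0\<bar>) \<longlonglongrightarrow> \<bar>c0 - c0\<bar>" "(\<lambda>k. \<bar>d k - d0\<bar>) \<longlonglongrightarrow> \<bar>d0 - d0\<bar>"
    by (intro tendsto_intros c d)+
  then have h: "(\<lambda>k. \<bar>c k - c0\<bar> powr r) \<longlonglongrightarrow> \<bar>c0 - c0\<bar> powr r" "(\<lambda>k. \<bar>d k - d0\<bar> powr r) \<longlonglongrightarrow> \<bar>d0 - d0\<bar> powr r"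
    using r by (intro tendsto_powr'; auto)+
  have "(\<lambda>k. 2 powr r * (\<bar>c k - c0\<bar> powr r * LP_int M r f + \<bar>d k - d0\<bar> powr r * LP_int M r g)) \<longlonglongrightarrow>
      2 powr r * (\<bar>c0 - c0\<bar> powr r * LP_int M r f + \<bar>d0 - d0\<bar> powr r * LP_int M r g)"
    by (intro tendsto_mult tendsto_add tendsto_const h)
  then show "(\<lambda>k. 2 powr r * (\<bar>c k - c0\<bar> powr r * LP_int M r f + \<bar>d k - d0\<bar> powr r * LP_int M r g)) \<longlonglongrightarrow> 0" by simp
  show "\<forall>\<^sub>F k in sequentially. LP_int M r (\<lambda>x. (c k *\<^sub>R f x + d k *\<^sub>R g x) - (c0 *\<^sub>R f x + d0 *\<^sub>R g x))
      \<le> 2 powr r * (\<bar>c k - c0\<bar> powr r * LP_int M r f + \<bar>d k - d0\<bar> powr r * LP_int M r g)"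
    unfolding eq LP_int_scaleR[symmetric] by (intro always_eventually allI LP_add(2)[OF r0] LP_scaleR f g)
qed (simp add: LP_int_nonneg)

lemma energy_lincomb_tendsto:
  assumes "G \<in> LP M p" "H \<in> LP M p" "c \<longlonglongrightarrow> c0" "d \<longlonglongrightarrow> d0"
  shows "(\<lambda>k. LP_int M p (\<lambda>x. c k *\<^sub>R G x + d k *\<^sub>R H x)) \<longlonglongrightarrow> LP_int M p (\<lambda>x. c0 *\<^sub>R G x + d0 *\<^sub>R H x)"
  by (rule LP_int_tendsto[OF p_pos(1) LP_lincomb[OF p_pos(3) assms(1,2)] LP_lincomb[OF p_pos(3) assms(1,2)]
    LP_int_lincomb_tendsto[OF p_pos(1) assms]])

lemma L_lincomb_tendsto:
  assumes "u \<in> LP M (q + 2)" "v \<in> LP M (q + 2)" "c \<longlonglongrightarrow> c0" "d \<longlonglongrightarrow> d0"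
  shows "(\<lambda>k. L (\<lambda>x. c k * u x + d k * v x)) \<longlonglongrightarrow> L (\<lambda>x. c0 * u x + d0 * v x)"
proof (rule L_tendsto)
  show "(\<lambda>x. c * u x + d * v x) \<in> LP M (q + 2)" for c d
    using LP_lincomb[OF s_pos(3) assms(1,2), of c d] by simp
  then show "(\<lambda>x. c0 * u x + d0 * v x) \<in> LP M (q + 2)" .
  show "(\<lambda>k. LP_int M (q + 2) (\<lambda>x. (c k * u x + d k * v x) - (c0 * u x + d0 * v x))) \<longlonglongrightarrow> 0"
    using LP_int_lincomb_tendsto[OF s_pos(1) assms] by simp
qed

lemma I_lincomb_tendsto:
  assumes u: "W0 u G" and v: "W0 v H" and cd: "c \<longlonglongrightarrow> c0" "d \<longlonglongrightarrow> d0"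
  shows "(\<lambda>k. I (LP_int M p (\<lambda>x. c k *\<^sub>R G x + d k *\<^sub>R H x)) (\<lambda>x. c k * u x + d k * v x)) \<longlonglongrightarrow>
    I (LP_int M p (\<lambda>x. c0 *\<^sub>R G x + d0 *\<^sub>R H x)) (\<lambda>x. c0 * u x + d0 * v x)"
  unfolding I_def
  by (intro tendsto_intros energy_lincomb_tendsto[OF W0_LP(2)[OF u] W0_LP(2)[OF v] cd]
      L_lincomb_tendsto[OF W0_LPs[OF u] W0_LPs[OF v] cd])

text \<open>Since \<open>I\<close> changes sign strictly along the ray through \<open>u\<close>, every direction can be
  followed on the Nehari manifold after a small correction of the radial parameter.\<close>

lemma Nehari_perturbation:
  assumes uG: "(u, G) \<in> Nehari" and v: "W0 v H"
  obtains c d where "c \<longlonglongrightarrow> 1" "d \<longlonglongrightarrow> 0" "\<And>k::nat. 1/2 \<le> c k \<and> c k \<le> 3/2 \<and> 0 < d k \<and> d k \<le> (1::real)"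
    "\<And>k. I (LP_int M p (\<lambda>x. c k *\<^sub>R G x + d k *\<^sub>R H x)) (\<lambda>x. c k * u x + d k * v x) = 0"
proof -
  have u: "W0 u G" and e: "LP_int M p G > 0" and I0: "I (LP_int M p G) u = 0" using uG by (auto simp: Nehari_def)
  let ?I = "\<lambda>c d. I (LP_int M p (\<lambda>x. c *\<^sub>R G x + d *\<^sub>R H x)) (\<lambda>x. c * u x + d * v x)"
  have I_ray: "?I c 0 = I (c powr p * LP_int M p G) (\<lambda>x. c * u x)" if "c > 0" for c
    using that by (simp add: LP_int_gradient_scale)
  have "\<forall>k. \<exists>cd. \<bar>fst cd - 1\<bar> \<le> inverse (real (Suc (Suc k))) \<and> 0 < snd cd \<and> snd cd \<le> inverse (real (Suc k)) \<and>
      ?I (fst cd) (snd cd) = 0"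
  proof
    fix k :: nat
    \<comment> \<open>The shift by two in the index keeps the radius at most \<open>1/2\<close>, so
      \<open>1 - r\<close> is positive and the ray lemma applies to it.\<close>
    define r where "r = inverse (real (Suc (Suc k)))"
    have r: "0 < r" "r \<le> 1/2" by (auto simp: r_def field_simps)
    have pos: "?I (1 - r) 0 > 0" and neg: "?I (1 + r) 0 < 0"
      using I_ray[of "1 - r"] I_ray[of "1 + r"] r
        fiber_sign(1)[OF W0_LPs[OF u] e I0, of "1 - r"] fiber_sign(2)[OF W0_LPs[OF u] e I0, of "1 + r"] by auto
    define t where "t n = inverse (real (Suc n))" for n
    have t: "t \<longlonglongrightarrow> 0" unfolding t_def by (rule LIMSEQ_inverse_real_of_nat)
    \<comment> \<open>At \<open>d = 0\<close> the two signs are strict, so they persist for small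
      \<open>d\<close>; a zero in \<open>c\<close> lies between them.\<close>
    have "\<forall>\<^sub>F n in sequentially. ?I (1 - r) (t n) > 0 \<and> ?I (1 + r) (t n) < 0 \<and> t n < inverse (real (Suc k))"
      by (intro eventually_conj order_tendstoD(1)[OF I_lincomb_tendsto[OF u v tendsto_const t] pos]
          order_tendstoD(2)[OF I_lincomb_tendsto[OF u v tendsto_const t] neg] order_tendstoD(2)[OF t]) auto
    then obtain n where n: "?I (1 - r) (t n) > 0" "?I (1 + r) (t n) < 0" "t n < inverse (real (Suc k))"
      by (auto simp: eventually_sequentially)
    have "\<exists>c\<ge>1 - r. c \<le> 1 + r \<and> ?I c (t n) = 0"
    proof (rule IVT2')
      show "continuous_on {1 - r..1 + r} (\<lambda>c. ?I c (t n))"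
        unfolding continuous_on_sequentially o_def
        by (intro allI ballI impI I_lincomb_tendsto[OF u v _ tendsto_const]) (elim conjE)
    qed (use n r in auto)
    then obtain c where c: "1 - r \<le> c" "c \<le> 1 + r" "?I c (t n) = 0" by blast
    have "\<bar>c - 1\<bar> \<le> inverse (real (Suc (Suc k)))" using c(1,2) unfolding r_def by linarith
    moreover have "0 < t n" by (simp add: t_def)
    ultimately show "\<exists>cd. \<bar>fst cd - 1\<bar> \<le> inverse (real (Suc (Suc k))) \<and> 0 < snd cd \<and> snd cd \<le> inverse (real (Suc k)) \<and>
      ?I (fst cd) (snd cd) = 0"
      using c(3) less_imp_le[OF n(3)] by (intro exI[of _ "(c, t n)"]) (simp only: fst_conv snd_conv simp_thms)
  qed
  from choice[OF this] obtain cd where cd': "\<And>k. \<bar>fst (cd k) - 1\<bar> \<le> inverse (real (Suc (Suc k))) \<and> 0 < snd (cd k) \<and>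
      snd (cd k) \<le> inverse (real (Suc k)) \<and> ?I (fst (cd k)) (snd (cd k)) = 0"
    by blast
  define c where "c k = fst (cd k)" for k
  define d where "d k = snd (cd k)" for k
  have cd: "\<And>k. \<bar>c k - 1\<bar> \<le> inverse (real (Suc (Suc k)))" "\<And>k. 0 < d k" "\<And>k. d k \<le> inverse (real (Suc k))"
    "\<And>k. ?I (c k) (d k) = 0"
    using cd' unfolding c_def d_def by blast+
  have "(\<lambda>k. inverse (real (Suc (Suc k)))) \<longlonglongrightarrow> 0" using LIMSEQ_Suc[OF LIMSEQ_inverse_real_of_nat] .
  then have "(\<lambda>k. c k - 1) \<longlonglongrightarrow> 0"
    by (rule Lim_null_comparison[rotated]) (use cd(1) in \<open>auto intro!: always_eventually\<close>)
  then have c1: "c \<longlonglongrightarrow> 1" by (simp add: LIM_zero_iff)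
  have d0: "d \<longlonglongrightarrow> 0"
    by (rule Lim_null_comparison[OF _ LIMSEQ_inverse_real_of_nat])
      (use cd(2,3) in \<open>auto intro!: always_eventually simp: abs_of_pos simp del: of_nat_Suc\<close>)
  have "1/2 \<le> c k \<and> c k \<le> 3/2 \<and> 0 < d k \<and> d k \<le> 1" for k
  proof -
    have "inverse (real (Suc (Suc k))) \<le> 1/2" "inverse (real (Suc k)) \<le> 1" by (auto simp: field_simps)
    then show ?thesis using cd(1)[of k] cd(2)[of k] cd(3)[of k] by linarith
  qed
  from that[OF c1 d0 this cd(4)] show ?thesis .
qed

text \<open>A crude form of Young's inequality: both norms are replaced by the larger one, whose
  exponents add up to \<open>p\<close>.\<close>

lemma duality_bound:
  fixes w h :: "'b::euclidean_space"
  shows "\<bar>(norm w powr (p - 2) *\<^sub>R w) \<bullet> h\<bar> \<le> norm w powr p + norm h powr p"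
proof (cases "w = 0")
  case False
  have "\<bar>(norm w powr (p - 2) *\<^sub>R w) \<bullet> h\<bar> \<le> norm w powr (p - 1) * norm h"
    using Cauchy_Schwarz_ineq2[of "norm w powr (p - 2) *\<^sub>R w" h] unfolding norm_powr_scaleR_eq[OF False] .
  also have "\<dots> \<le> max (norm w) (norm h) powr (p - 1) * max (norm w) (norm h) powr 1"
    using p_pos by (intro mult_mono powr_mono2) auto
  also have "\<dots> = max (norm w) (norm h) powr p" by (simp only: powr_add[symmetric]) simp
  also have "\<dots> \<le> norm w powr p + norm h powr p" by (auto simp: max_def)
  finally show ?thesis .
qed auto

text \<open>The weak form of the negative p-Laplacian: the field \<open>G\<close> tested with
  \<open>H\<close>.\<close>

definition D :: "('a \<Rightarrow> 'a) \<Rightarrow> ('a \<Rightarrow> 'a) \<Rightarrow> real" where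
  "D G H = (\<integral>x. (norm (G x) powr (p - 2) *\<^sub>R G x) \<bullet> H x \<partial>M)"

lemma duality_measurable:
  fixes G H :: "'a \<Rightarrow> 'a"
  assumes "G \<in> borel_measurable M" "H \<in> borel_measurable M"
  shows "(\<lambda>x. (norm (G x) powr (p - 2) *\<^sub>R G x) \<bullet> H x) \<in> borel_measurable M"
  using assms by measurable

lemma duality_integrable:
  fixes G H :: "'a \<Rightarrow> 'a"
  assumes G: "G \<in> LP M p" and H: "H \<in> LP M p"
  shows "integrable M (\<lambda>x. (norm (G x) powr (p - 2) *\<^sub>R G x) \<bullet> H x)"
proof (rule Bochner_Integration.integrable_bound)
  show "integrable M (\<lambda>x. norm (G x) powr p + norm (H x) powr p)"
    using LP_integrable[OF G] LP_integrable[OF H] by simp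
  show "AE x in M. norm ((norm (G x) powr (p - 2) *\<^sub>R G x) \<bullet> H x) \<le> norm (norm (G x) powr p + norm (H x) powr p)"
    using duality_bound by (intro AE_I2) (simp add: order_trans[OF _ abs_ge_self])
qed (rule duality_measurable[OF LP_measurable[OF G] LP_measurable[OF H]])

text \<open>Convexity is used with the tangent at the perturbed point, not at
  \<open>c *\<^sub>R G x\<close>. This gives an upper bound for the increment, the only direction
  needed, and spares the derivative of the energy.\<close>

lemma energy_difference_le:
  fixes G H :: "'a \<Rightarrow> 'a"
  assumes G: "G \<in> LP M p" and H: "H \<in> LP M p"
  shows "LP_int M p (\<lambda>x. c *\<^sub>R G x + d *\<^sub>R H x) - LP_int M p (\<lambda>x. c *\<^sub>R G x)
    \<le> d * p * D (\<lambda>x. c *\<^sub>R G x + d *\<^sub>R H x) H"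
proof -
  let ?w = "\<lambda>x. c *\<^sub>R G x + d *\<^sub>R H x"
  have w: "?w \<in> LP M p" by (rule LP_lincomb[OF p_pos(3) G H])
  have "(\<integral>x. norm (?w x) powr p + - (d * p) * ((norm (?w x) powr (p - 2) *\<^sub>R ?w x) \<bullet> H x) \<partial>M) \<le> LP_int M p (\<lambda>x. c *\<^sub>R G x)"
    unfolding LP_int_def
  proof (rule integral_mono)
    show "integrable M (\<lambda>x. norm (?w x) powr p + - (d * p) * ((norm (?w x) powr (p - 2) *\<^sub>R ?w x) \<bullet> H x))"
      by (intro Bochner_Integration.integrable_add LP_integrable[OF w] integrable_mult_right duality_integrable[OF w H])
    show "integrable M (\<lambda>x. norm (c *\<^sub>R G x) powr p)" by (rule LP_integrable[OF LP_scaleR[OF G]])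
    show "norm (?w x) powr p + - (d * p) * ((norm (?w x) powr (p - 2) *\<^sub>R ?w x) \<bullet> H x) \<le> norm (c *\<^sub>R G x) powr p" for x
    proof -
      have "c *\<^sub>R G x - ?w x = - d *\<^sub>R H x" by simp
      then have eq: "p * ((norm (?w x) powr (p - 2) *\<^sub>R ?w x) \<bullet> (c *\<^sub>R G x - ?w x)) = - (d * p) * ((norm (?w x) powr (p - 2) *\<^sub>R ?w x) \<bullet> H x)"
        by (simp only: inner_scaleR_right) simp
      show ?thesis using powr_norm_tangent_le[OF p_pos(2), of "?w x" "c *\<^sub>R G x"] unfolding eq .
    qed
  qed
  also have "(\<integral>x. norm (?w x) powr p + - (d * p) * ((norm (?w x) powr (p - 2) *\<^sub>R ?w x) \<bullet> H x) \<partial>M)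
      = LP_int M p ?w + - (d * p) * D ?w H"
    unfolding LP_int_def D_def
    by (subst Bochner_Integration.integral_add[OF LP_integrable[OF w] integrable_mult_right[OF duality_integrable[OF w H]]]) simp
  finally show ?thesis by simp
qed

lemma D_tendsto:
  fixes G H :: "'a \<Rightarrow> 'a"
  assumes G: "G \<in> LP M p" and H: "H \<in> LP M p" and c: "c \<longlonglongrightarrow> 1" and d: "d \<longlonglongrightarrow> 0"
    and bd: "\<And>k. \<bar>c k\<bar> \<le> 2 \<and> \<bar>d k\<bar> \<le> 1"
  shows "(\<lambda>k. D (\<lambda>x. c k *\<^sub>R G x + d k *\<^sub>R H x) H) \<longlonglongrightarrow> D G H"
  unfolding D_def
proof (rule integral_dominated_convergence)
  let ?w = "\<lambda>k x. c k *\<^sub>R G x + d k *\<^sub>R H x"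
  let ?W = "\<lambda>x. 2 powr p * (2 powr p * norm (G x) powr p + norm (H x) powr p) + norm (H x) powr p"
  show "(\<lambda>x. (norm (G x) powr (p - 2) *\<^sub>R G x) \<bullet> H x) \<in> borel_measurable M"
    by (rule duality_measurable[OF LP_measurable[OF G] LP_measurable[OF H]])
  show "(\<lambda>x. (norm (?w k x) powr (p - 2) *\<^sub>R ?w k x) \<bullet> H x) \<in> borel_measurable M" for k
    by (rule duality_measurable[OF LP_measurable[OF LP_lincomb[OF p_pos(3) G H]] LP_measurable[OF H]])
  show "integrable M ?W" using LP_integrable[OF G] LP_integrable[OF H] by simp
  show "AE x in M. (\<lambda>k. (norm (?w k x) powr (p - 2) *\<^sub>R ?w k x) \<bullet> H x) \<longlonglongrightarrow> (norm (G x) powr (p - 2) *\<^sub>R G x) \<bullet> H x"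
  proof (rule AE_I2)
    fix x
    have "(\<lambda>k. ?w k x) \<longlonglongrightarrow> 1 *\<^sub>R G x + 0 *\<^sub>R H x" by (intro tendsto_intros c d)
    then have "(\<lambda>k. ?w k x) \<longlonglongrightarrow> G x" by simp
    then have "(\<lambda>k. norm (?w k x) powr (p - 2) *\<^sub>R ?w k x) \<longlonglongrightarrow> norm (G x) powr (p - 2) *\<^sub>R G x"
      by (rule continuous_on_tendsto_compose[OF continuous_duality_map[OF p2]]) auto
    then show "(\<lambda>k. (norm (?w k x) powr (p - 2) *\<^sub>R ?w k x) \<bullet> H x) \<longlonglongrightarrow> (norm (G x) powr (p - 2) *\<^sub>R G x) \<bullet> H x"
      by (intro tendsto_inner tendsto_const)
  qed
  show "AE x in M. norm ((norm (?w k x) powr (p - 2) *\<^sub>R ?w k x) \<bullet> H x) \<le> ?W x" for k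
  proof (rule AE_I2)
    fix x
    have "\<bar>c k\<bar> powr p \<le> 2 powr p" "\<bar>d k\<bar> powr p \<le> 1 powr p" using bd[of k] p_pos by (intro powr_mono2; simp)+
    then have cd: "\<bar>c k\<bar> powr p * norm (G x) powr p \<le> 2 powr p * norm (G x) powr p"
      "\<bar>d k\<bar> powr p * norm (H x) powr p \<le> 1 * norm (H x) powr p"
      by (intro mult_right_mono; simp)+
    have "norm (?w k x) powr p \<le> 2 powr p * (norm (c k *\<^sub>R G x) powr p + norm (d k *\<^sub>R H x) powr p)"
      by (rule norm_add_powr_le[OF p_pos(3)])
    also have "\<dots> \<le> 2 powr p * (2 powr p * norm (G x) powr p + norm (H x) powr p)"
      using cd by (intro mult_left_mono) (auto simp: powr_mult)
    finally show "norm ((norm (?w k x) powr (p - 2) *\<^sub>R ?w k x) \<bullet> H x) \<le> ?W x"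
      using duality_bound[of "?w k x" "H x"] by simp
  qed
qed

definition prim_int :: "('a \<Rightarrow> real) \<Rightarrow> real" where
  "prim_int u = (\<integral>x. power_log_prim q (u x) \<partial>M)"

lemma prim_integrable:
  assumes "u \<in> LP M (q + 2)"
  shows "integrable M (\<lambda>x. power_log_prim q (u x))" "prim_int u = 1 / (q + 1) * L u - 1 / (q + 1)\<^sup>2 * Q u"
  using power_log_integrable[OF assms] LP_integrable[OF LPs_q1[OF assms]]
  by (simp_all add: power_log_prim_def prim_int_def L_def Q_def LP_int_def)

lemma J_eq_prim: "u \<in> LP M (q + 2) \<Longrightarrow> J e u = a / p * e + b / (2 * p) * e\<^sup>2 - prim_int u"
  by (simp add: J_def prim_integrable(2))

text \<open>The mean value theorem writes the quotient as the nonlinearity at an intermediate value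
  times \<open>v x\<close>. The intermediate values converge to \<open>u x\<close>, and dominated
  convergence applies.\<close>

lemma prim_difference_quotient_tendsto:
  assumes u: "u \<in> LP M (q + 2)" and v: "v \<in> LP M (q + 2)" and c: "c \<longlonglongrightarrow> 1" and d: "d \<longlonglongrightarrow> 0"
    and bd: "\<And>k. \<bar>c k\<bar> \<le> 2 \<and> \<bar>d k\<bar> \<le> 1" and d_pos: "\<And>k. d k > 0"
  shows "(\<lambda>k. (prim_int (\<lambda>x. c k * u x + d k * v x) - prim_int (\<lambda>x. c k * u x)) / d k)
    \<longlonglongrightarrow> (\<integral>x. power_log_der q (u x) * v x \<partial>M)"
proof -
  let ?g = "\<lambda>k x. (power_log_prim q (c k * u x + d k * v x) - power_log_prim q (c k * u x)) / d k"
  note [measurable] = LP_measurable[OF u] LP_measurable[OF v]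
  have [measurable]: "power_log_der q \<in> borel_measurable borel"
    by (rule borel_measurable_continuous_onI[OF power_log_der_continuous[OF q_pos(2)]])
  have "continuous_on UNIV (power_log_prim q)"
    by (rule DERIV_continuous_on, rule DERIV_subset[OF power_log_prim_has_derivative[OF q_pos(2)]]) auto
  then have [measurable]: "power_log_prim q \<in> borel_measurable borel" by (rule borel_measurable_continuous_onI)
  have "\<exists>z. \<bar>z - c k * u x\<bar> \<le> \<bar>d k * v x\<bar> \<and> ?g k x = power_log_der q z * v x" for k x
  proof -
    obtain z where "\<bar>z - c k * u x\<bar> \<le> \<bar>d k * v x\<bar>"
      "power_log_prim q (c k * u x + d k * v x) - power_log_prim q (c k * u x) = d k * v x * power_log_der q z"
      using power_log_prim_mvt[OF q_pos(2), of "c k * u x" "d k * v x"] by blast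
    then show ?thesis using d_pos[of k] by (intro exI[of _ z]) simp
  qed
  then obtain z where z: "\<And>k x. \<bar>z k x - c k * u x\<bar> \<le> \<bar>d k * v x\<bar>" "\<And>k x. ?g k x = power_log_der q (z k x) * v x"
    by metis
  let ?W = "\<lambda>x. 2 * (1 + 2 * (2 powr (q + 2) * (2 powr (q + 2) * norm (u x) powr (q + 2) + norm (v x) powr (q + 2))))"
  have "(\<lambda>k. \<integral>x. ?g k x \<partial>M) \<longlonglongrightarrow> (\<integral>x. power_log_der q (u x) * v x \<partial>M)"
  proof (rule integral_dominated_convergence)
    show "integrable M ?W" using LP_integrable[OF u] LP_integrable[OF v] by simp
    show "AE x in M. (\<lambda>k. ?g k x) \<longlonglongrightarrow> power_log_der q (u x) * v x"
    proof (rule AE_I2)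
      fix x
      have "(\<lambda>k. \<bar>d k * v x\<bar>) \<longlonglongrightarrow> \<bar>0 * v x\<bar>" by (intro tendsto_intros d)
      then have "(\<lambda>k. \<bar>d k * v x\<bar>) \<longlonglongrightarrow> 0" by simp
      then have "(\<lambda>k. z k x - c k * u x) \<longlonglongrightarrow> 0"
        by (rule Lim_null_comparison[rotated]) (use z(1) in \<open>auto intro!: always_eventually\<close>)
      moreover have "(\<lambda>k. c k * u x) \<longlonglongrightarrow> 1 * u x" by (intro tendsto_intros c)
      ultimately have "(\<lambda>k. (z k x - c k * u x) + c k * u x) \<longlonglongrightarrow> 0 + 1 * u x" by (rule tendsto_add)
      then have "(\<lambda>k. z k x) \<longlonglongrightarrow> u x" by simp
      then have "(\<lambda>k. power_log_der q (z k x)) \<longlonglongrightarrow> power_log_der q (u x)"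
        by (rule continuous_on_tendsto_compose[OF power_log_der_continuous[OF q_pos(2)]]) auto
      then show "(\<lambda>k. ?g k x) \<longlonglongrightarrow> power_log_der q (u x) * v x"
        unfolding z(2) by (intro tendsto_mult tendsto_const)
    qed
    show "AE x in M. norm (?g k x) \<le> ?W x" for k
    proof (rule AE_I2)
      fix x
      \<comment> \<open>A common bound for the intermediate values and for \<open>|v x|\<close>;
        growth \<open>q + 1\<close> times one further factor \<open>y\<close> stays within the
        integrable exponent \<open>q + 2\<close>.\<close>
      define y where "y = 2 * \<bar>u x\<bar> + \<bar>v x\<bar>"
      have y: "y \<ge> 0" "\<bar>v x\<bar> \<le> y" by (auto simp: y_def)
      have "\<bar>c k * u x\<bar> \<le> 2 * \<bar>u x\<bar>" "\<bar>d k * v x\<bar> \<le> 1 * \<bar>v x\<bar>"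
        unfolding abs_mult using bd[of k] by (intro mult_right_mono; simp)+
      then have zy: "\<bar>z k x\<bar> \<le> y" using z(1)[of k x] unfolding y_def by linarith
      have "\<bar>power_log_der q (z k x)\<bar> \<le> 2 * (1 + \<bar>z k x\<bar> powr (q + 1))" by (rule power_log_der_bound[OF q_pos(2)])
      also have "\<dots> \<le> 2 * (1 + y powr (q + 1))" using zy q_pos by (intro mult_left_mono add_left_mono powr_mono2) auto
      finally have "\<bar>power_log_der q (z k x)\<bar> * \<bar>v x\<bar> \<le> 2 * (1 + y powr (q + 1)) * y"
        using y by (intro mult_mono) auto
      also have "\<dots> = 2 * (y powr 1 + y powr (q + 2))"
      proof -
        have "y powr (q + 2) = y powr (q + 1) * y"
        proof (cases "y = 0")
          case False
          then show ?thesis using y powr_add[of y "q + 1" 1] by (simp add: add.commute)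
        qed simp
        then show ?thesis using y by (simp add: algebra_simps)
      qed
      also have "\<dots> \<le> 2 * (1 + 2 * y powr (q + 2))"
        using powr_le_1_plus[of 1 "q + 2" y] y q_pos by simp
      also have "y powr (q + 2) \<le> 2 powr (q + 2) * (2 powr (q + 2) * norm (u x) powr (q + 2) + norm (v x) powr (q + 2))"
        using norm_add_powr_le[of "q + 2" "2 * \<bar>u x\<bar>" "\<bar>v x\<bar>"] q_pos y by (simp add: y_def powr_mult)
      finally show "norm (?g k x) \<le> ?W x" unfolding z(2) by (simp add: abs_mult)
    qed
  qed measurable
  moreover have "(\<integral>x. ?g k x \<partial>M) = (prim_int (\<lambda>x. c k * u x + d k * v x) - prim_int (\<lambda>x. c k * u x)) / d k" for k
    unfolding prim_int_def
    using prim_integrable(1)[of "\<lambda>x. c k * u x + d k * v x"] prim_integrable(1)[of "\<lambda>x. c k * u x"]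
      LP_lincomb[OF s_pos(3) u v, of "c k" "d k"] LP_scaleR[OF u, of "c k"] by simp
  ultimately show ?thesis by (simp only:)
qed

lemma minimizer_derivative_nonneg:
  assumes uG: "(u, G) \<in> Nehari" and min: "\<And>v H. (v, H) \<in> Nehari \<Longrightarrow> J (LP_int M p G) u \<le> J (LP_int M p H) v"
    and v: "W0 v H"
  shows "0 \<le> (a + b * LP_int M p G) * D G H - (\<integral>x. power_log_der q (u x) * v x \<partial>M)"
proof -
  have u: "W0 u G" and e: "LP_int M p G > 0" and I0: "I (LP_int M p G) u = 0" using uG by (auto simp: Nehari_def)
  note GLP = W0_LP(2)[OF u] and HLP = W0_LP(2)[OF v] and us = W0_LPs[OF u] and vs = W0_LPs[OF v]
  obtain c d where cd: "c \<longlonglongrightarrow> 1" "d \<longlonglongrightarrow> 0" "\<And>k::nat. 1/2 \<le> c k \<and> c k \<le> 3/2 \<and> 0 < d k \<and> d k \<le> (1::real)"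
    and Icd: "\<And>k. I (LP_int M p (\<lambda>x. c k *\<^sub>R G x + d k *\<^sub>R H x)) (\<lambda>x. c k * u x + d k * v x) = 0"
    using Nehari_perturbation[OF uG v] by blast
  have bd: "\<bar>c k\<bar> \<le> 2 \<and> \<bar>d k\<bar> \<le> 1" "d k > 0" "c k > 0" for k using cd(3)[of k] by auto
  let ?w = "\<lambda>k x. c k *\<^sub>R G x + d k *\<^sub>R H x"
  define Ew where "Ew k = LP_int M p (?w k)" for k
  define Ev where "Ev k = LP_int M p (\<lambda>x. c k *\<^sub>R G x)" for k
  define Dk where "Dk k = D (?w k) H" for k
  define P where "P k = (prim_int (\<lambda>x. c k * u x + d k * v x) - prim_int (\<lambda>x. c k * u x)) / d k" for k
  \<comment> \<open>\<open>d k * X k\<close> is an upper bound for the increment of \<open>J\<close>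
    from \<open>c k * u\<close> to \<open>c k * u + d k * v\<close>; the quadratic energy term is
    treated by \<open>(Ew - Ev) * (Ew + Ev)\<close>.\<close>
  define X where "X k = a * Dk k + b / 2 * Dk k * (Ew k + Ev k) - P k" for k
  have Ew: "Ew \<longlonglongrightarrow> LP_int M p G"
    using energy_lincomb_tendsto[OF GLP HLP cd(1,2)] by (simp add: Ew_def[abs_def])
  have Ev: "Ev \<longlonglongrightarrow> LP_int M p G"
    using energy_lincomb_tendsto[OF GLP HLP cd(1) tendsto_const, of 0] by (simp add: Ev_def[abs_def])
  have Dk: "Dk \<longlonglongrightarrow> D G H"
    unfolding Dk_def[abs_def] by (rule D_tendsto[OF GLP HLP cd(1,2) bd(1)])
  have P: "P \<longlonglongrightarrow> (\<integral>x. power_log_der q (u x) * v x \<partial>M)"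
    unfolding P_def[abs_def] by (rule prim_difference_quotient_tendsto[OF us vs cd(1,2) bd(1,2)])
  have "X \<longlonglongrightarrow> a * D G H + b / 2 * D G H * (LP_int M p G + LP_int M p G) - (\<integral>x. power_log_der q (u x) * v x \<partial>M)"
    unfolding X_def[abs_def] by (intro tendsto_intros Dk Ew Ev P)
  then have X: "X \<longlonglongrightarrow> (a + b * LP_int M p G) * D G H - (\<integral>x. power_log_der q (u x) * v x \<partial>M)"
    by (simp add: algebra_simps)
  have step: "X k \<ge> 0" if Ewk: "Ew k > 0" for k
  proof -
    have W: "W0 (\<lambda>x. c k * u x + d k * v x) (?w k)" by (rule W0_lincomb[OF u v])
    have "((\<lambda>x. c k * u x + d k * v x), ?w k) \<in> Nehari"
      using W Ewk Icd[of k] by (simp add: Nehari_def Ew_def)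
    then have "J (LP_int M p G) u \<le> J (Ew k) (\<lambda>x. c k * u x + d k * v x)" unfolding Ew_def by (rule min)
    \<comment> \<open>Comparison with \<open>c k * u\<close> instead of \<open>u\<close> eliminates
      the radial correction: only the increment \<open>d k * v\<close> remains, so no rate for
      \<open>c k\<close> tending to \<open>1\<close> is required.\<close>
    moreover have "J (Ev k) (\<lambda>x. c k * u x) \<le> J (LP_int M p G) u"
      unfolding Ev_def LP_int_gradient_scale[OF bd(3)] by (rule J_fiber_max[OF us e I0 bd(3)])
    ultimately have "J (Ev k) (\<lambda>x. c k * u x) \<le> J (Ew k) (\<lambda>x. c k * u x + d k * v x)" by linarith
    moreover have "prim_int (\<lambda>x. c k * u x + d k * v x) - prim_int (\<lambda>x. c k * u x) = d k * P k"
      using bd(2)[of k] by (simp add: P_def)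
    ultimately have 1: "d k * P k \<le> a / p * (Ew k - Ev k) + b / (2 * p) * ((Ew k)\<^sup>2 - (Ev k)\<^sup>2)"
      using J_eq_prim[OF W0_LPs[OF W], of "Ew k"] J_eq_prim[OF W0_LPs[OF W0_scale[OF u]], of "Ev k" "c k"]
      by (simp add: right_diff_distrib)
    have diff: "Ew k - Ev k \<le> d k * p * Dk k"
      unfolding Ew_def Ev_def Dk_def by (rule energy_difference_le[OF GLP HLP])
    have "a / p * (Ew k - Ev k) \<le> a / p * (d k * p * Dk k)"
      using diff a_pos p_pos by (intro mult_left_mono) auto
    also have "\<dots> = d k * (a * Dk k)" using p_pos by simp
    finally have 2: "a / p * (Ew k - Ev k) \<le> d k * (a * Dk k)" .
    have "b / (2 * p) * ((Ew k)\<^sup>2 - (Ev k)\<^sup>2) = b / (2 * p) * ((Ew k - Ev k) * (Ew k + Ev k))"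
      by (simp add: power2_eq_square algebra_simps)
    also have "\<dots> \<le> b / (2 * p) * ((d k * p * Dk k) * (Ew k + Ev k))"
      using diff b_pos p_pos LP_int_nonneg[of M p] by (intro mult_left_mono mult_right_mono) (auto simp: Ew_def Ev_def intro!: add_nonneg_nonneg)
    also have "\<dots> = d k * (b / 2 * Dk k * (Ew k + Ev k))" using p_pos by simp
    finally have 3: "b / (2 * p) * ((Ew k)\<^sup>2 - (Ev k)\<^sup>2) \<le> d k * (b / 2 * Dk k * (Ew k + Ev k))" .
    have "d k * X k = d k * (a * Dk k) + d k * (b / 2 * Dk k * (Ew k + Ev k)) - d k * P k"
      by (simp add: X_def algebra_simps)
    then have "d k * X k \<ge> 0" using 1 2 3 by linarith
    then show ?thesis using bd(2)[of k] by (simp add: zero_le_mult_iff)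
  qed
  \<comment> \<open>Membership in the manifold asks for positive energy, which the perturbed points
    have once they are close to \<open>u\<close>.\<close>
  have "\<forall>\<^sub>F k in sequentially. Ew k > 0" by (rule order_tendstoD(1)[OF Ew e])
  then have "\<forall>\<^sub>F k in sequentially. 0 \<le> X k" by eventually_elim (rule step)
  then show ?thesis by (rule tendsto_lowerbound[OF X]) simp
qed

text \<open>Directions form a vector space and the expression is linear in them, so the inequality
  for both \<open>v\<close> and \<open>- v\<close> is an equality.\<close>

theorem minimizer_critical:
  assumes uG: "(u, G) \<in> Nehari" and min: "\<And>v H. (v, H) \<in> Nehari \<Longrightarrow> J (LP_int M p G) u \<le> J (LP_int M p H) v"
    and v: "W0 v H"
  shows "(a + b * LP_int M p G) * D G H - (\<integral>x. power_log_der q (u x) * v x \<partial>M) = 0"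
proof -
  have "W0 (\<lambda>x. - v x) (\<lambda>x. - H x)" using W0_scale[OF v, of "-1"] by simp
  from minimizer_derivative_nonneg[OF uG min this]
  have "(a + b * LP_int M p G) * D G H - (\<integral>x. power_log_der q (u x) * v x \<partial>M) \<le> 0"
    by (simp add: D_def)
  moreover have "(a + b * LP_int M p G) * D G H - (\<integral>x. power_log_der q (u x) * v x \<partial>M) \<ge> 0"
    by (rule minimizer_derivative_nonneg[OF uG min v])
  ultimately show ?thesis by linarith
qed

section \<open>Return to the functionals and sets of the statement\<close>

lemma energy_J'_eq:
  assumes "u \<in> W01p p \<Omega>"
  shows "energy_J' a b p q \<Omega> u v = (a + b * LP_int M p (weak_gradient \<Omega> u)) * D (weak_gradient \<Omega> u) (weak_gradient \<Omega> v)
    - (\<integral>x. power_log_der q (u x) * v x \<partial>M)"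
  unfolding energy_J'_def Kirchhoff_M_def D_def power_log_der_def
  using Lp_norm_gradient(1)[OF W0_weak_gradient[OF assms]] by simp

lemma Nehari_manifold_iff: "u \<in> Nehari_manifold a b p q \<Omega> \<longleftrightarrow> u \<in> W01p p \<Omega> \<and> (u, weak_gradient \<Omega> u) \<in> Nehari"
proof (cases "u \<in> W01p p \<Omega>")
  case True
  note W = W0_weak_gradient[OF True]
  show ?thesis
    unfolding Nehari_manifold_def Nehari_def
    using True W energy_J_eq(2)[OF W] Lp_norm_gradient(3)[OF W] by auto
qed (simp add: Nehari_manifold_def)

lemma L_ae_zero:
  assumes "u \<in> LP M (q + 2)" "AE x in M. u x = 0"
  shows "L u = 0"
proof -
  have "L u = (\<integral>x. 0 \<partial>M)"
    unfolding L_def using assms(2) borel_measurable_integrable[OF power_log_integrable[OF assms(1)]]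
    by (intro integral_cong_AE) (auto simp: power_log_def elim!: eventually_mono)
  then show ?thesis by simp
qed

lemma Nehari_manifold_not_ae_zero:
  assumes "u \<in> Nehari_manifold a b p q \<Omega>"
  shows "u \<notin> ae_zero \<Omega>"
proof
  assume "u \<in> ae_zero \<Omega>"
  then have z: "AE x in M. u x = 0" by (simp add: ae_zero_def)
  have uG: "(u, weak_gradient \<Omega> u) \<in> Nehari" using assms by (simp add: Nehari_manifold_iff)
  then have "L u = 0" using z by (intro L_ae_zero) (auto simp: Nehari_def intro: W0_LPs)
  moreover have "a * LP_int M p (weak_gradient \<Omega> u) > 0" "b * (LP_int M p (weak_gradient \<Omega> u))\<^sup>2 \<ge> 0"
    using uG a_pos b_pos by (auto simp: Nehari_def)
  ultimately show False using uG by (auto simp: Nehari_def I_def)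
qed

lemma solutions_subset_Nehari:
  assumes u: "u \<in> solutions_Phi a b p q \<Omega>" "u \<notin> ae_zero \<Omega>"
  shows "u \<in> Nehari_manifold a b p q \<Omega>"
proof -
  have uW: "u \<in> W01p p \<Omega>" and z: "energy_J' a b p q \<Omega> u u = 0" using u(1) by (auto simp: solutions_Phi_def)
  let ?G = "weak_gradient \<Omega> u"
  note W = W0_weak_gradient[OF uW]
  have "D ?G ?G = LP_int M p ?G"
    unfolding D_def LP_int_def
  proof (rule Bochner_Integration.integral_cong[OF refl])
    fix x
    show "(norm (?G x) powr (p - 2) *\<^sub>R ?G x) \<bullet> ?G x = norm (?G x) powr p"
    proof (cases "?G x = 0")
      case False
      then have "norm (?G x) powr (p - 2) * norm (?G x) powr 2 = norm (?G x) powr p" by (simp only: powr_add[symmetric]) simp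
      then show ?thesis using False by (simp add: powr_numeral power2_norm_eq_inner)
    qed (use p_pos in auto)
  qed
  moreover have "(\<integral>x. power_log_der q (u x) * u x \<partial>M) = L u"
    unfolding L_def
  proof (rule Bochner_Integration.integral_cong[OF refl])
    fix x
    have "\<bar>u x\<bar> powr (q - 1) * u x * u x = \<bar>u x\<bar> powr (q + 1)"
    proof (cases "u x = 0")
      case False
      then have "\<bar>u x\<bar> powr (q - 1) * \<bar>u x\<bar> powr 2 = \<bar>u x\<bar> powr (q + 1)" by (simp only: powr_add[symmetric]) (simp add: algebra_simps)
      then show ?thesis using False by (simp add: powr_numeral power2_eq_square mult.assoc)
    qed simp
    then show "power_log_der q (u x) * u x = power_log q (u x)"
      by (simp add: power_log_der_def power_log_def mult_ac)
  qed
  ultimately have "I (LP_int M p ?G) u = 0"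
    using z unfolding energy_J'_eq[OF uW] I_def by (simp add: algebra_simps power2_eq_square)
  moreover have "LP_int M p ?G > 0"
  proof (rule ccontr)
    assume "\<not> LP_int M p ?G > 0"
    then have "LP_int M p ?G = 0" using LP_int_nonneg[of M p ?G] by simp
    then have "u \<in> ae_zero \<Omega>" using W0_zero_gradient[OF W] by (simp add: ae_zero_def)
    then show False using u(2) by blast
  qed
  ultimately show ?thesis using uW W by (simp add: Nehari_manifold_iff Nehari_def)
qed

theorem ground_state_exists:
  "\<exists>u\<in>Nehari_manifold a b p q \<Omega>.
    (\<forall>v\<in>Nehari_manifold a b p q \<Omega>. energy_J a b p q \<Omega> u \<le> energy_J a b p q \<Omega> v) \<and> u \<in> solutions_Phi a b p q \<Omega>"
proof -
  obtain u G where uG: "(u, G) \<in> Nehari" and min: "\<And>v H. (v, H) \<in> Nehari \<Longrightarrow> J (LP_int M p G) u \<le> J (LP_int M p H) v"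
    using Nehari_minimizer by blast
  have W: "W0 u G" using uG by (simp add: Nehari_def)
  let ?G = "weak_gradient \<Omega> u"
  have uW: "u \<in> W01p p \<Omega>" by (rule W0_imp_W01p(1)[OF W])
  have eG: "LP_int M p ?G = LP_int M p G" by (rule LP_int_weak_gradient[OF W])
  have uG': "(u, ?G) \<in> Nehari" using uG W0_weak_gradient[OF uW] by (simp add: Nehari_def eG)
  have min': "J (LP_int M p ?G) u \<le> J (LP_int M p H) v" if "(v, H) \<in> Nehari" for v H
    unfolding eG using min that .
  show ?thesis
  proof (intro bexI conjI ballI)
    show "u \<in> Nehari_manifold a b p q \<Omega>" using uW uG' by (simp add: Nehari_manifold_iff)
    show "energy_J a b p q \<Omega> u \<le> energy_J a b p q \<Omega> v" if v: "v \<in> Nehari_manifold a b p q \<Omega>" for v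
    proof -
      have vN: "(v, weak_gradient \<Omega> v) \<in> Nehari" using v by (simp add: Nehari_manifold_iff)
      then have "W0 v (weak_gradient \<Omega> v)" by (simp add: Nehari_def)
      then show ?thesis using min'[OF vN] energy_J_eq(1)[OF W0_weak_gradient[OF uW]] energy_J_eq(1) by simp
    qed
    have "energy_J' a b p q \<Omega> u v = 0" if v: "v \<in> W01p p \<Omega>" for v
      unfolding energy_J'_eq[OF uW] by (rule minimizer_critical[OF uG' min' W0_weak_gradient[OF v]])
    then show "u \<in> solutions_Phi a b p q \<Omega>" using uW by (simp add: solutions_Phi_def)
  qed
qed

end

text \<open>For \<open>p < n\<close> this is the hypothesis multiplied by \<open>n - p\<close>.
  Otherwise the conjugate is infinite, and \<open>n \<le> p\<close> alone bounds the left side by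
  \<open>q + 2 - p\<close>.\<close>

lemma subcritical_exponent:
  fixes p q :: real
  assumes p: "2 \<le> p" and q: "2 * p - 1 < q" and sub: "ereal q < sobolev_conjugate n p - 2"
  shows "real n * ((q + 2 - p) / p) < q + 2"
proof (cases "p < real n")
  case True
  have "ereal q < ereal (real n * p / (real n - p)) - ereal 2"
    using sub True by (simp add: sobolev_conjugate_def numeral_eq_ereal)
  then have "q < real n * p / (real n - p) - 2" by simp
  then have "(q + 2) * (real n - p) < real n * p" using True by (simp add: pos_less_divide_eq[symmetric])
  then have "real n * (q + 2 - p) < (q + 2) * p" by (simp add: algebra_simps)
  then show ?thesis using p by (simp add: pos_divide_less_eq)
next
  case False
  have "real n * (q + 2 - p) \<le> p * (q + 2 - p)" using False p q by (intro mult_right_mono) auto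
  also have "\<dots> < (q + 2) * p" using p by (simp add: algebra_simps)
  finally show ?thesis using p by (simp add: pos_divide_less_eq)
qed

theorem theorem9:
  fixes \<Omega> :: "'a::euclidean_space set" and a b p q :: real
  assumes "smooth_bounded_domain \<Omega>"
    and "a > 0" and "b > 0"
    and "2 \<le> p" and "ereal p < sobolev_conjugate DIM('a) 2"
    and "2 * p - 1 < q" and "ereal q < sobolev_conjugate DIM('a) p - 2"
  shows "\<exists>u\<in>Nehari_manifold a b p q \<Omega>.
    (ereal (energy_J a b p q \<Omega> u) =
       (INF v\<in>Nehari_manifold a b p q \<Omega>. ereal (energy_J a b p q \<Omega> v)) \<and>
     (INF v\<in>Nehari_manifold a b p q \<Omega>. ereal (energy_J a b p q \<Omega> v)) = depth_d a b p q \<Omega>) \<and>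
    ground_state a b p q \<Omega> u"
proof -
  interpret kirchhoff \<Omega> p q a b
    using assms subcritical_exponent[of p q "DIM('a)"]
    by unfold_locales (auto simp: smooth_bounded_domain_def)
  obtain u where u: "u \<in> Nehari_manifold a b p q \<Omega>"
    and min: "\<And>v. v \<in> Nehari_manifold a b p q \<Omega> \<Longrightarrow> energy_J a b p q \<Omega> u \<le> energy_J a b p q \<Omega> v"
    and sol: "u \<in> solutions_Phi a b p q \<Omega>"
    using ground_state_exists by blast
  \<comment> \<open>Both infima are taken over subsets of the manifold that contain
    \<open>u\<close>, so one argument serves the manifold itself and the nontrivial
    solutions.\<close>
  have inf: "ereal (energy_J a b p q \<Omega> u) = (INF v\<in>S. ereal (energy_J a b p q \<Omega> v))"
    if "u \<in> S" "S \<subseteq> Nehari_manifold a b p q \<Omega>" for S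
    using that min by (intro antisym INF_greatest INF_lower) auto
  have uS: "u \<in> solutions_Phi a b p q \<Omega> - ae_zero \<Omega>" using sol Nehari_manifold_not_ae_zero[OF u] by blast
  show ?thesis
  proof (rule bexI[OF _ u], intro conjI)
    show "ereal (energy_J a b p q \<Omega> u) = (INF v\<in>Nehari_manifold a b p q \<Omega>. ereal (energy_J a b p q \<Omega> v))"
      by (rule inf[OF u order_refl])
    show "(INF v\<in>Nehari_manifold a b p q \<Omega>. ereal (energy_J a b p q \<Omega> v)) = depth_d a b p q \<Omega>"
      by (simp add: depth_d_def)
    show "ground_state a b p q \<Omega> u"
      unfolding ground_state_def using uS inf[OF uS] solutions_subset_Nehari by blast
  qed
qed

end
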